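(* If a configuration $C=p_r\dots p_s$ of g-2PATH satisfies the condition of noninterference of extensions (CNI), then \[\mathrm{mft}_{\text{g-2PATH}}(C)=\min_{r\le i\le0\le j\le s}\max\{-2i+j+g(i,j),\ 2j-i+f(i,j)\}.\]
   Context: Positions are elements of $\mathbb{Z}^2$; with $\epsilon_0=(1,0),\epsilon_1=(0,1),\epsilon_2=(-1,0),\epsilon_3=(0,-1)$, positions $p,p'$ are adjacent if $p'-p$ is some $\epsilon_i$. A configuration of g-2PATH is a sequence $C=p_r\dots p_s$ ($r\le0\le s$) of positions with $p_0=(0,0)$ (the general), consecutive positions adjacent, all positions distinct, and $p_l,p_m$ not adjacent whenever $|l-m|\ge2$; it is identified with its set of positions. For $p\in C$, $\mathrm{bc}_C(p)=(b_0,\dots,b_3)\in\{0,1\}^4$ with $b_i=1$ iff $p+\epsilon_i\in C$. Firing squad model (boundary-sensitive): a finite automaton $A$ has a finite state set containing a quiescent state $\mathrm{Q}$, general states $\mathrm{G}_0,\dots,\mathrm{G}_{m-1}$, a set $\mathcal F$ of firing states with $\mathrm{Q}\notin\mathcal F$, a map $\tau:\{0,1\}^4\to\{0,\dots,m-1\}$, and a transition function computing the next state from the current state and the states of the four neighbours (the symbol $\#$ where there is no node), such that a node in $\mathrm{Q}$ with all inputs in $\{\mathrm{Q},\#\}$ stays in $\mathrm{Q}$. With a copy of $A$ at each position of $C$, at time $0$ the node $(0,0)$ is in $\mathrm{G}_{\tau(\mathrm{bc}_C((0,0)))}$ and all others in $\mathrm{Q}$; nodes update synchronously. $A$ is a solution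 of g-2PATH if for every configuration $C$ there is $t_C$ such that no node is in $\mathcal F$ before $t_C$ and all nodes are in $\mathcal F$ at $t_C$; $\mathrm{ft}(C,A)=t_C$. $\mathrm{mft}_{\text{g-2PATH}}(C)=\min_A\mathrm{ft}(C,A)$ over all solutions. For fixed $C$ and $r\le i\le0\le j\le s$: $W(i,j)$ is the set of pairs $(x_0,x_1)$ of finite, possibly empty, sequences of positions such that $x_0p_i\dots p_jx_1$ is a configuration $C'$ of g-2PATH (general at $p_0$) with $\mathrm{bc}_{C'}(p_l)=\mathrm{bc}_C(p_l)$ for all $i\le l\le j$; $U(i,j)$, $V(i,j)$ are the sets of first, resp. second, components of elements of $W(i,j)$; $f(i,j)=\sup\{|x_0|:x_0\in U(i,j)\}$, $g(i,j)=\sup\{|x_1|:x_1\in V(i,j)\}$ ($|x|$ = number of positions; values may be $\infty$, and $\max\{a,\infty\}=\infty$). $\mathrm{NI}(i,j)$ means $W(i,j)=U(i,j)\times V(i,j)$. $I=\{(i,j): r\le i-1,\ W(i,j)$ infinite, $W(i-1,j)$ finite$\}$, $J=\{(i,j): j+1\le s,\ W(i,j)$ infinite, $W(i,j+1)$ finite$\}$, $K=\{(i,j): W(i,j)$ finite$\}$. $C$ satisfies CNI if $\mathrm{NI}(i,j)$ holds for all $(i,j)\in I\cup J\cup K$. *)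

theory Defs
  imports Main "HOL-Library.Extended_Nat"
begin

type_synonym pos = "int \<times> int"

definition eps :: "nat \<Rightarrow> pos" where
  "eps k = (if k = 0 then (1,0) else if k = 1 then (0,1) else if k = 2 then (-1,0) else (0,-1))"

definition shift :: "pos \<Rightarrow> nat \<Rightarrow> pos" where
  "shift q k = (fst q + fst (eps k), snd q + snd (eps k))"

definition adj :: "pos \<Rightarrow> pos \<Rightarrow> bool" where
  "adj q q' \<longleftrightarrow> (\<exists>k<4. q' = shift q k)"

definition bc :: "pos set \<Rightarrow> pos \<Rightarrow> bool \<times> bool \<times> bool \<times> bool" where
  "bc S q = (shift q 0 \<in> S, shift q 1 \<in> S, shift q 2 \<in> S, shift q 3 \<in> S)"

definition lconfig :: "pos list \<Rightarrow> bool" where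
  "lconfig xs \<longleftrightarrow> (0,0) \<in> set xs \<and> distinct xs
     \<and> (\<forall>l. l + 1 < length xs \<longrightarrow> adj (xs ! l) (xs ! (l+1)))
     \<and> (\<forall>l m. l < length xs \<longrightarrow> m < length xs \<longrightarrow> l + 2 \<le> m \<longrightarrow> \<not> adj (xs ! l) (xs ! m))"

definition g2path :: "int \<Rightarrow> int \<Rightarrow> (int \<Rightarrow> pos) \<Rightarrow> bool" where
  "g2path r s p \<longleftrightarrow> r \<le> 0 \<and> 0 \<le> s \<and> p 0 = (0,0) \<and> lconfig (map p [r..s])"

text \<open>States are encoded as natural numbers (any finite automaton is isomorphic to one of
this form); the symbol # is encoded as None.\<close>
record fsa =
  states :: "nat set"
  quiescent :: nat
  ngen :: nat
  gen :: "nat \<Rightarrow> nat"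
  firing :: "nat set"
  tau :: "bool \<times> bool \<times> bool \<times> bool \<Rightarrow> nat"
  delta :: "nat \<Rightarrow> nat option \<Rightarrow> nat option \<Rightarrow> nat option \<Rightarrow> nat option \<Rightarrow> nat"

definition wf_fsa :: "fsa \<Rightarrow> bool" where
  "wf_fsa A \<longleftrightarrow> finite (states A) \<and> quiescent A \<in> states A
     \<and> (\<forall>k < ngen A. gen A k \<in> states A)
     \<and> firing A \<subseteq> states A \<and> quiescent A \<notin> firing A
     \<and> (\<forall>b. tau A b < ngen A)
     \<and> (\<forall>x \<in> states A. \<forall>y0 y1 y2 y3.
           (\<forall>y \<in> {y0,y1,y2,y3}. y = None \<or> the y \<in> states A) \<longrightarrow> delta A x y0 y1 y2 y3 \<in> states A)
     \<and> (\<forall>y0 y1 y2 y3. {y0,y1,y2,y3} \<subseteq> {None, Some (quiescent A)} \<longrightarrow>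
           delta A (quiescent A) y0 y1 y2 y3 = quiescent A)"

fun run :: "fsa \<Rightarrow> pos set \<Rightarrow> nat \<Rightarrow> pos \<Rightarrow> nat" where
  "run A S 0 = (\<lambda>q. if q = (0,0) then gen A (tau A (bc S (0,0))) else quiescent A)"
| "run A S (Suc t) = (\<lambda>q. let nb = (\<lambda>k. if shift q k \<in> S then Some (run A S t (shift q k)) else None)
     in delta A (run A S t q) (nb 0) (nb 1) (nb 2) (nb 3))"

definition fires_at :: "fsa \<Rightarrow> pos set \<Rightarrow> nat \<Rightarrow> bool" where
  "fires_at A S t \<longleftrightarrow> (\<forall>t' < t. \<forall>q \<in> S. run A S t' q \<notin> firing A)
                     \<and> (\<forall>q \<in> S. run A S t q \<in> firing A)"

definition is_solution :: "fsa \<Rightarrow> bool" where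
  "is_solution A \<longleftrightarrow> wf_fsa A \<and> (\<forall>xs. lconfig xs \<longrightarrow> (\<exists>t. fires_at A (set xs) t))"

definition ft :: "pos set \<Rightarrow> fsa \<Rightarrow> nat" where
  "ft S A = (LEAST t. fires_at A S t)"

definition mft :: "pos set \<Rightarrow> nat" where
  "mft S = (LEAST n. \<exists>A. is_solution A \<and> ft S A = n)"

definition W :: "int \<Rightarrow> int \<Rightarrow> (int \<Rightarrow> pos) \<Rightarrow> int \<Rightarrow> int \<Rightarrow> (pos list \<times> pos list) set" where
  "W r s p i j = {(x0, x1). lconfig (x0 @ map p [i..j] @ x1)
      \<and> (\<forall>l \<in> {i..j}. bc (set (x0 @ map p [i..j] @ x1)) (p l) = bc (p ` {r..s}) (p l))}"

definition U :: "int \<Rightarrow> int \<Rightarrow> (int \<Rightarrow> pos) \<Rightarrow> int \<Rightarrow> int \<Rightarrow> pos list set" where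
  "U r s p i j = fst ` W r s p i j"

definition V :: "int \<Rightarrow> int \<Rightarrow> (int \<Rightarrow> pos) \<Rightarrow> int \<Rightarrow> int \<Rightarrow> pos list set" where
  "V r s p i j = snd ` W r s p i j"

definition fW :: "int \<Rightarrow> int \<Rightarrow> (int \<Rightarrow> pos) \<Rightarrow> int \<Rightarrow> int \<Rightarrow> enat" where
  "fW r s p i j = Sup ((\<lambda>x. enat (length x)) ` U r s p i j)"

definition gW :: "int \<Rightarrow> int \<Rightarrow> (int \<Rightarrow> pos) \<Rightarrow> int \<Rightarrow> int \<Rightarrow> enat" where
  "gW r s p i j = Sup ((\<lambda>x. enat (length x)) ` V r s p i j)"

definition NI :: "int \<Rightarrow> int \<Rightarrow> (int \<Rightarrow> pos) \<Rightarrow> int \<Rightarrow> int \<Rightarrow> bool" where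
  "NI r s p i j \<longleftrightarrow> W r s p i j = U r s p i j \<times> V r s p i j"

definition idx :: "int \<Rightarrow> int \<Rightarrow> (int \<times> int) set" where
  "idx r s = {(i, j). r \<le> i \<and> i \<le> 0 \<and> 0 \<le> j \<and> j \<le> s}"

definition Iset :: "int \<Rightarrow> int \<Rightarrow> (int \<Rightarrow> pos) \<Rightarrow> (int \<times> int) set" where
  "Iset r s p = {(i, j) \<in> idx r s. r \<le> i - 1 \<and> infinite (W r s p i j) \<and> finite (W r s p (i - 1) j)}"

definition Jset :: "int \<Rightarrow> int \<Rightarrow> (int \<Rightarrow> pos) \<Rightarrow> (int \<times> int) set" where
  "Jset r s p = {(i, j) \<in> idx r s. j + 1 \<le> s \<and> infinite (W r s p i j) \<and> finite (W r s p i (j + 1))}"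

definition Kset :: "int \<Rightarrow> int \<Rightarrow> (int \<Rightarrow> pos) \<Rightarrow> (int \<times> int) set" where
  "Kset r s p = {(i, j) \<in> idx r s. finite (W r s p i j)}"

definition CNI :: "int \<Rightarrow> int \<Rightarrow> (int \<Rightarrow> pos) \<Rightarrow> bool" where
  "CNI r s p \<longleftrightarrow> (\<forall>(i, j) \<in> Iset r s p \<union> Jset r s p \<union> Kset r s p. NI r s p i j)"

end

(* Lower bound: suppose a solution fires C at time t. Start with the segment p_r .. p_s and shrink it,
keeping a configuration x0 p_i .. p_j x1 that fires at t, with x0 and x1 longest in U(i,j) and V(i,j).
If t < 2j - i + |x0|, the free end of x0 cannot know at time t what happens at p_j, so x0 p_i .. p_(j-1) z1
fires at t too for every z1 in V(i,j-1). Here noninterference is needed, both for combining x0 with z1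
and for U(i,j-1) = U(i,j). As all nodes are awake at t, W(i,j-1) is finite, and the argument goes on with (i,j-1).
The other side is symmetric. When neither inequality fails any more, t is at least the term for (i,j).

Upper bound: if the term for (i,j) is a finite number T, then in every configuration of W(i,j) each node knows
at time T the boundary conditions of p_i .. p_j, so exactly the configurations of W(i,j) can fire at T. All others
run a fixed solution started at T + 1. Such a solution exists: ports propagated from the general orient the
path, and the resulting line is synchronised by repeated halving with signals of speed 1 and 1/3. *)
theory Submission
  imports Defs
begin

section \<open>Paths indexed by integers\<close>

text \<open>Node \<open>l\<close> has distance |l| from the general and wakes up at time |l|, so the
  boundary condition of \<open>p m\<close> can reach node \<open>l\<close> only at time |m| + |m -
  l|. For m = j and the left end l = i - |x0| this is 2j - i + |x0|; for m = i and the right end it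
  is j - 2i + |x1|. These are the two terms of the formula, and no other choice of m between i and j
  and of a node l exceeds both. One obstacle is that a set of nodes carries no direction: a node
  sees four compass directions, but not which way along the path is left. Hence claims are proved
  for one orientation and transferred by l -> -l, and a segment found in an unknown configuration
  has to be matched in either reading. Another is that firing at T must be unanimous. A single node
  that knows the boundary conditions of the segment suffices for this: they place the configuration
  in W(i,j), and then the time bound gives every node the same knowledge.\<close>

definition opp :: "nat \<Rightarrow> nat" where
  "opp k = (k + 2) mod 4"

lemma less_4_cases: "k < (4::nat) \<Longrightarrow> k = 0 \<or> k = 1 \<or> k = 2 \<or> k = 3"
  by arith

lemma opp_less: "opp k < 4"
  by (simp add: opp_def)

lemma shift_opp: "k < 4 \<Longrightarrow> shift (shift q k) (opp k) = q"
  by (auto dest!: less_4_cases simp: opp_def shift_def eps_def)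

lemma shift_inj: "k < 4 \<Longrightarrow> k' < 4 \<Longrightarrow> shift q k = shift q k' \<Longrightarrow> k = k'"
  by (auto dest!: less_4_cases simp: shift_def eps_def)

lemma shift_inj_pos: "shift q k = shift q' k \<Longrightarrow> q = q'"
  by (auto simp: shift_def prod_eq_iff)

lemma adj_sym: "adj q q' \<Longrightarrow> adj q' q"
  unfolding adj_def by (metis opp_less shift_opp)

lemma not_adj_refl: "\<not> adj q q"
  by (auto simp: adj_def shift_def eps_def prod_eq_iff split: if_splits)

text \<open>The definition of \<open>g2path\<close> speaks of a list, whereas the later inductions
  run on the signed index, the distance to the general with a side.\<close>

lemma g2path_iff:
  "g2path r s p \<longleftrightarrow> r \<le> 0 \<and> 0 \<le> s \<and> p 0 = (0,0) \<and> inj_on p {r..s}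
     \<and> (\<forall>l. r \<le> l \<longrightarrow> l < s \<longrightarrow> adj (p l) (p (l+1)))
     \<and> (\<forall>l m. r \<le> l \<longrightarrow> l + 2 \<le> m \<longrightarrow> m \<le> s \<longrightarrow> \<not> adj (p l) (p m))" (is "?A \<longleftrightarrow> ?B")
proof (cases "r \<le> 0 \<and> 0 \<le> s \<and> p 0 = (0,0)")
  case True
  let ?xs = "map p [r..s]"
  have len: "length ?xs = nat (s - r + 1)" by simp
  have nth: "?xs ! k = p (r + int k)" if "k < length ?xs" for k
    using that by (simp add: nth_upto)
  have mem: "(0,0) \<in> set ?xs" using True by (auto intro!: image_eqI[where x=0])
  have dist: "distinct ?xs \<longleftrightarrow> inj_on p {r..s}" by (simp add: distinct_map)
  have A1: "(\<forall>l. l + 1 < length ?xs \<longrightarrow> adj (?xs ! l) (?xs ! (l+1)))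
     \<longleftrightarrow> (\<forall>l. r \<le> l \<longrightarrow> l < s \<longrightarrow> adj (p l) (p (l+1)))"
  proof (intro iffI allI impI)
    fix l assume H: "\<forall>l. l + 1 < length ?xs \<longrightarrow> adj (?xs ! l) (?xs ! (l+1))" "r \<le> l" "l < s"
    have *: "nat (l - r) + 1 < length ?xs" using H(2,3) by auto
    then have "adj (p (r + int (nat (l - r)))) (p (r + int (nat (l - r) + 1)))"
      using H(1) nth by (metis add_lessD1)
    then show "adj (p l) (p (l+1))" using H(2) by (simp add: algebra_simps)
  next
    fix l assume H: "\<forall>l. r \<le> l \<longrightarrow> l < s \<longrightarrow> adj (p l) (p (l+1))" "l + 1 < length ?xs"
    have "adj (p (r + int l)) (p (r + int l + 1))" using H by auto
    then show "adj (?xs ! l) (?xs ! (l+1))" using H(2) nth[of l] nth[of "l+1"] by (simp add: algebra_simps)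
  qed
  have A2: "(\<forall>l m. l < length ?xs \<longrightarrow> m < length ?xs \<longrightarrow> l + 2 \<le> m \<longrightarrow> \<not> adj (?xs ! l) (?xs ! m))
     \<longleftrightarrow> (\<forall>l m. r \<le> l \<longrightarrow> l + 2 \<le> m \<longrightarrow> m \<le> s \<longrightarrow> \<not> adj (p l) (p m))"
  proof (intro iffI allI impI)
    fix l m assume H: "\<forall>l m. l < length ?xs \<longrightarrow> m < length ?xs \<longrightarrow> l + 2 \<le> m \<longrightarrow> \<not> adj (?xs ! l) (?xs ! m)"
      "r \<le> l" "l + 2 \<le> m" "m \<le> s"
    have *: "nat (l - r) < length ?xs" "nat (m - r) < length ?xs" "nat (l - r) + 2 \<le> nat (m - r)"
      using H(2-) by auto
    then have "\<not> adj (p (r + int (nat (l - r)))) (p (r + int (nat (m - r))))"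
      using H(1) nth by metis
    then show "\<not> adj (p l) (p m)" using H(2,3) by simp
  next
    fix l m assume H: "\<forall>l m. r \<le> l \<longrightarrow> l + 2 \<le> m \<longrightarrow> m \<le> s \<longrightarrow> \<not> adj (p l) (p m)"
      "l < length ?xs" "m < length ?xs" "l + 2 \<le> m"
    have "\<not> adj (p (r + int l)) (p (r + int m))" using H by auto
    then show "\<not> adj (?xs ! l) (?xs ! m)" using nth[OF H(2)] nth[OF H(3)] by simp
  qed
  show ?thesis
    unfolding g2path_def lconfig_def using True mem dist A1 A2 by blast
next
  case False
  then show ?thesis by (auto simp: g2path_def)
qed

lemma g2pathD:
  assumes "g2path r s p"
  shows "r \<le> 0" "0 \<le> s" "p 0 = (0,0)"
    and "\<And>l m. r \<le> l \<Longrightarrow> l \<le> s \<Longrightarrow> r \<le> m \<Longrightarrow> m \<le> s \<Longrightarrow> p l = p m \<longleftrightarrow> l = m"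
    and "\<And>l. r \<le> l \<Longrightarrow> l < s \<Longrightarrow> adj (p l) (p (l+1))"
    and "\<And>l. r < l \<Longrightarrow> l \<le> s \<Longrightarrow> adj (p l) (p (l-1))"
    and "\<And>l m. r \<le> l \<Longrightarrow> l \<le> s \<Longrightarrow> r \<le> m \<Longrightarrow> m \<le> s \<Longrightarrow> adj (p l) (p m) \<Longrightarrow> m = l + 1 \<or> m = l - 1"
proof -
  note * = assms[unfolded g2path_iff]
  show "r \<le> 0" "0 \<le> s" "p 0 = (0,0)" using * by auto
  show "\<And>l m. r \<le> l \<Longrightarrow> l \<le> s \<Longrightarrow> r \<le> m \<Longrightarrow> m \<le> s \<Longrightarrow> p l = p m \<longleftrightarrow> l = m"
    using * by (auto dest: inj_onD)
  show "\<And>l. r \<le> l \<Longrightarrow> l < s \<Longrightarrow> adj (p l) (p (l+1))" using * by auto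
  show "adj (p l) (p (l-1))" if "r < l" "l \<le> s" for l
  proof -
    have "adj (p (l-1)) (p (l-1+1))" using * that by (metis add_le_cancel_right diff_add_cancel zle_diff1_eq zless_imp_add1_zle)
    then show ?thesis using adj_sym by simp
  qed
  show "m = l + 1 \<or> m = l - 1" if "r \<le> l" "l \<le> s" "r \<le> m" "m \<le> s" "adj (p l) (p m)" for l m
  proof (rule ccontr)
    assume "\<not> (m = l + 1 \<or> m = l - 1)"
    then consider "m = l" | "l + 2 \<le> m" | "m + 2 \<le> l" by linarith
    then show False
    proof cases
      case 3
      then have "\<not> adj (p m) (p l)" using * that by auto
      then show False using that(5) adj_sym by blast
    qed (use * that not_adj_refl in auto)
  qed
qed

text \<open>Non-consecutive nodes are never adjacent, so the plane can be forgotten: all that a node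
  sees are its two path neighbours.\<close>

lemma g2path_nbr:
  assumes "g2path r s p" "r \<le> l" "l \<le> s" "k < 4"
  shows "shift (p l) k \<in> p ` {r..s} \<longleftrightarrow>
    (l < s \<and> shift (p l) k = p (l+1)) \<or> (r < l \<and> shift (p l) k = p (l-1))" (is "?A \<longleftrightarrow> ?B")
proof
  assume ?A
  then obtain m where m: "r \<le> m" "m \<le> s" "shift (p l) k = p m" by auto
  then have "adj (p l) (p m)" using assms(4) unfolding adj_def by metis
  then have "m = l + 1 \<or> m = l - 1" using g2pathD(7)[OF assms(1)] assms m by blast
  then show ?B using m by auto
next
  assume ?B
  then show ?A
  proof
    assume "l < s \<and> shift (p l) k = p (l+1)"
    then show ?A using assms(2) by (auto intro!: image_eqI[where x="l+1"])
  next
    assume "r < l \<and> shift (p l) k = p (l-1)"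
    then show ?A using assms(3) by (auto intro!: image_eqI[where x="l-1"])
  qed
qed

lemma bc_eq_iff: "bc S q = bc S' q' \<longleftrightarrow> (\<forall>k<4. shift q k \<in> S \<longleftrightarrow> shift q' k \<in> S')"
  by (auto simp: bc_def dest!: less_4_cases)

text \<open>By \<open>g2path_nbr\<close> a boundary condition is determined by the position and its
  path neighbours. This serves for nodes whose boundary condition is not prescribed by membership in
  \<open>W\<close>.\<close>

lemma bc_path_cong:
  assumes "g2path r s p" "g2path r' s' p'" "r \<le> l" "l \<le> s" "r' \<le> l" "l \<le> s'"
    and "p l = p' l" "l < s \<longleftrightarrow> l < s'" "r < l \<longleftrightarrow> r' < l"
    and "l < s \<Longrightarrow> p (l+1) = p' (l+1)" "r < l \<Longrightarrow> p (l-1) = p' (l-1)"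
  shows "bc (p ` {r..s}) (p l) = bc (p' ` {r'..s'}) (p' l)"
  unfolding bc_eq_iff
proof (intro allI impI)
  fix k :: nat assume k: "k < 4"
  show "shift (p l) k \<in> p ` {r..s} \<longleftrightarrow> shift (p' l) k \<in> p' ` {r'..s'}"
    unfolding g2path_nbr[OF assms(1,3,4) k] g2path_nbr[OF assms(2,5,6) k]
    by (rule disj_cong; rule conj_cong) (simp_all only: assms(7-))
qed

section \<open>Reversing a path\<close>

lemma image_uminus_interval: "(\<lambda>l. p (- l)) ` {- s..- r} = p ` {r..s}" for r s :: int
  using image_image[of p uminus "{- s..- r}"] by (simp add: image_uminus_atLeastAtMost)

lemma g2path_mirror:
  assumes "g2path r s p"
  shows "g2path (- s) (- r) (\<lambda>l. p (- l))"
proof -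
  note D = g2pathD[OF assms]
  show ?thesis
    unfolding g2path_iff
  proof (intro conjI allI impI)
    show "inj_on (\<lambda>l. p (- l)) {- s..- r}"
    proof (rule inj_onI)
      fix x y assume "x \<in> {- s..- r}" "y \<in> {- s..- r}" "p (- x) = p (- y)"
      then show "x = y" using D(4)[of "- x" "- y"] by auto
    qed
    show "adj (p (- l)) (p (- (l + 1)))" if "- s \<le> l" "l < - r" for l
      using D(6)[of "- l"] that by simp
    show "\<not> adj (p (- l)) (p (- m))" if "- s \<le> l" "l + 2 \<le> m" "m \<le> - r" for l m
      using D(7)[of "- l" "- m"] that by auto
  qed (use D(1-3) in auto)
qed

lemma map_upto_mirror: "map (\<lambda>l. p (- l)) [- j..- i] = rev (map p [i..j])"
proof (rule nth_equalityI)
  show "length (map (\<lambda>l. p (- l)) [- j..- i]) = length (rev (map p [i..j]))" by simp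
  fix k assume "k < length (map (\<lambda>l. p (- l)) [- j..- i])"
  then have k: "int k \<le> j - i" by auto
  have "rev (map p [i..j]) ! k = p ([i..j] ! (nat (j - i + 1) - Suc k))"
    using k by (simp add: rev_nth)
  also have "[i..j] ! (nat (j - i + 1) - Suc k) = i + int (nat (j - i + 1) - Suc k)"
    by (rule nth_upto) (use k in auto)
  also have "\<dots> = j - int k" using k by auto
  finally have "rev (map p [i..j]) ! k = p (j - int k)" .
  moreover have "[- j..- i] ! k = - j + int k" by (rule nth_upto) (use k in auto)
  ultimately show "map (\<lambda>l. p (- l)) [- j..- i] ! k = rev (map p [i..j]) ! k"
    using k by simp
qed

definition idxf :: "'a list \<Rightarrow> int \<Rightarrow> int \<Rightarrow> 'a" where
  "idxf xs a l = xs ! nat (l - a)"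

lemma map_idxf: "map (idxf xs a) [a..a + int (length xs) - 1] = xs"
  by (rule nth_equalityI) (auto simp: nth_upto idxf_def)

lemma image_map_upto: "set (map p [a..b]) = p ` {a..b}"
  by simp

lemma lconfig_path:
  assumes "lconfig xs"
  obtains r s p where "g2path r s p" "set xs = p ` {r..s}"
proof -
  obtain c where c: "c < length xs" "xs ! c = (0,0)"
    using assms by (auto simp: lconfig_def in_set_conv_nth)
  let ?r = "- int c" and ?p = "idxf xs (- int c)"
  let ?s = "?r + int (length xs) - 1"
  have "map ?p [?r..?s] = xs" by (rule map_idxf)
  moreover have "?p 0 = (0,0)" using c by (simp add: idxf_def)
  ultimately have "g2path ?r ?s ?p" using c assms by (simp add: g2path_def)
  moreover have "set xs = ?p ` {?r..?s}"
    using image_map_upto[of ?p ?r ?s] \<open>map ?p [?r..?s] = xs\<close> by metis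
  ultimately show ?thesis using that by blast
qed

lemma lconfig_rev: "lconfig xs \<Longrightarrow> lconfig (rev xs)"
  unfolding lconfig_def
proof (elim conjE, intro conjI allI impI)
  assume A: "\<forall>l. l + 1 < length xs \<longrightarrow> adj (xs ! l) (xs ! (l + 1))"
    and N: "\<forall>l m. l < length xs \<longrightarrow> m < length xs \<longrightarrow> l + 2 \<le> m \<longrightarrow> \<not> adj (xs ! l) (xs ! m)"
  show "adj (rev xs ! l) (rev xs ! (l + 1))" if "l + 1 < length (rev xs)" for l
  proof -
    let ?l = "length xs - Suc (Suc l)"
    have "adj (xs ! ?l) (xs ! (?l + 1))" using A that by auto
    moreover have "?l + 1 = length xs - Suc l" using that by auto
    ultimately show ?thesis using that by (simp add: rev_nth adj_sym)
  qed
  show "\<not> adj (rev xs ! l) (rev xs ! m)"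
    if "l < length (rev xs)" "m < length (rev xs)" "l + 2 \<le> m" for l m
  proof -
    let ?l = "length xs - Suc l" and ?m = "length xs - Suc m"
    have "\<not> adj (xs ! ?m) (xs ! ?l)" using N that by auto
    then have "\<not> adj (xs ! ?l) (xs ! ?m)" using adj_sym by blast
    then show ?thesis using that by (simp add: rev_nth)
  qed
qed auto

section \<open>Propagation of information\<close>

lemma run_Suc:
  "run A S (Suc t) q = delta A (run A S t q)
     (if shift q 0 \<in> S then Some (run A S t (shift q 0)) else None)
     (if shift q 1 \<in> S then Some (run A S t (shift q 1)) else None)
     (if shift q 2 \<in> S then Some (run A S t (shift q 2)) else None)
     (if shift q 3 \<in> S then Some (run A S t (shift q 3)) else None)"
  by (simp add: Let_def)

lemma run_Suc_cong:
  assumes "run A S t q = run A' S' t' q'" "delta A = delta A'"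
    and "\<And>k. k < 4 \<Longrightarrow> (if shift q k \<in> S then Some (run A S t (shift q k)) else None) =
                 (if shift q' k \<in> S' then Some (run A' S' t' (shift q' k)) else None)"
  shows "run A S (Suc t) q = run A' S' (Suc t') q'"
  unfolding run_Suc using assms(1,2) assms(3)[of 0] assms(3)[of 1] assms(3)[of 2] assms(3)[of 3]
  by (simp del: run.simps)

lemma wf_fsa_quiescentD:
  assumes "wf_fsa A" "y0 \<in> {None, Some (quiescent A)}" "y1 \<in> {None, Some (quiescent A)}"
    "y2 \<in> {None, Some (quiescent A)}" "y3 \<in> {None, Some (quiescent A)}"
  shows "delta A (quiescent A) y0 y1 y2 y3 = quiescent A"
  using assms(1) unfolding wf_fsa_def using assms(2-) by blast

text \<open>Signals advance one node per step, and only along the path, so the general needs |l|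
  steps to wake node \<open>l\<close>.\<close>

lemma run_quiescent:
  assumes "wf_fsa A" "g2path r s p" "r \<le> l" "l \<le> s" "int t < \<bar>l\<bar>"
  shows "run A (p ` {r..s}) t (p l) = quiescent A"
  using assms(3-)
proof (induction t arbitrary: l)
  case 0
  then have "p l \<noteq> p 0" using g2pathD(4)[OF assms(2), of l 0] g2pathD(1,2)[OF assms(2)] by auto
  then show ?case using g2pathD(3)[OF assms(2)] by simp
next
  case (Suc t)
  have own: "run A (p ` {r..s}) t (p l) = quiescent A" using Suc by auto
  have nb: "(if shift (p l) k \<in> p ` {r..s} then Some (run A (p ` {r..s}) t (shift (p l) k)) else None)
     \<in> {None, Some (quiescent A)}" if "k < 4" for k
    using g2path_nbr[OF assms(2) Suc.prems(1,2) that] Suc.IH[of "l+1"] Suc.IH[of "l-1"] Suc.prems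
    by auto
  show ?case
    unfolding run_Suc own
    by (rule wf_fsa_quiescentD[OF assms(1)]) (rule nb, simp)+
qed

text \<open>The configurations can differ only beyond \<open>b\<close>. Node \<open>b + 1\<close>
  sleeps until time \<open>b + 1\<close>, and a difference arising there needs
  \<open>b + 1 - l\<close> more steps to come back to node \<open>l\<close>; the bound is the sum of
  both delays. Equal boundary conditions at \<open>b\<close> ensure that node \<open>b + 1\<close>
  exists in both configurations or in neither.\<close>

lemma run_cone:
  assumes wf: "wf_fsa A" and p1: "g2path r s1 p1" and p2: "g2path r s2 p2"
    and b: "0 \<le> b" "b \<le> s1" "b \<le> s2"
    and eq: "\<And>l. r \<le> l \<Longrightarrow> l \<le> b \<Longrightarrow> p1 l = p2 l"
    and bc: "\<And>l. r \<le> l \<Longrightarrow> l \<le> b \<Longrightarrow> bc (p1 ` {r..s1}) (p1 l) = bc (p2 ` {r..s2}) (p1 l)"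
    and l: "r \<le> l" "l \<le> b" "int t < 2 * (b + 1) - l"
  shows "run A (p1 ` {r..s1}) t (p1 l) = run A (p2 ` {r..s2}) t (p1 l)"
  using l
proof (induction t arbitrary: l)
  case 0
  have "bc (p1 ` {r..s1}) (0,0) = bc (p2 ` {r..s2}) (0,0)"
    using bc[of 0] b(1) g2pathD(1,3)[OF p1] by simp
  then show ?case by simp
next
  case (Suc t)
  let ?S1 = "p1 ` {r..s1}" and ?S2 = "p2 ` {r..s2}"
  show ?case
  proof (rule run_Suc_cong)
    show "run A ?S1 t (p1 l) = run A ?S2 t (p1 l)" using Suc by auto
    fix k :: nat assume k: "k < 4"
    have l1: "l \<le> s1" and l2: "l \<le> s2" using Suc.prems b by auto
    have mem: "shift (p1 l) k \<in> ?S1 \<longleftrightarrow> shift (p1 l) k \<in> ?S2"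
      using bc[OF Suc.prems(1,2)] k unfolding bc_eq_iff by blast
    have "run A ?S1 t (shift (p1 l) k) = run A ?S2 t (shift (p1 l) k)" if in1: "shift (p1 l) k \<in> ?S1"
    proof -
      have in2: "shift (p2 l) k \<in> ?S2" using in1 mem eq[OF Suc.prems(1,2)] by simp
      consider (left) "r < l" "shift (p1 l) k = p1 (l - 1)"
        | (right) "l < b" "shift (p1 l) k = p1 (l + 1)"
        | (out) "l = b" "l < s1" "shift (p1 l) k = p1 (l + 1)"
        using in1 Suc.prems(2) unfolding g2path_nbr[OF p1 Suc.prems(1) l1 k] by fastforce
      then show ?thesis
      proof cases
        case left
        then show ?thesis using Suc.IH[of "l - 1"] Suc.prems by simp
      next
        case right
        then show ?thesis using Suc.IH[of "l + 1"] Suc.prems by simp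
      next
        \<comment> \<open>\<open>p1 (b + 1)\<close> also lies in the second configuration. It is not
          the predecessor of \<open>p2 b\<close>, which is \<open>p1 (b - 1)\<close>, so it is
          \<open>p2 (b + 1)\<close>. It sleeps in both runs, since
          \<open>Suc t < 2 * (b + 1) - b\<close> gives \<open>t < b + 1\<close>.\<close>
        case out
        have "\<not> (r < l \<and> shift (p2 l) k = p2 (l - 1))"
        proof
          assume "r < l \<and> shift (p2 l) k = p2 (l - 1)"
          then have "p1 (l + 1) = p1 (l - 1)"
            using out eq[of l] eq[of "l - 1"] Suc.prems by simp
          then show False using g2pathD(4)[OF p1, of "l + 1" "l - 1"] \<open>r < l \<and> _\<close> out by auto
        qed
        then have p2l: "l < s2" "shift (p1 l) k = p2 (l + 1)"
          using in2 eq[OF Suc.prems(1,2)] unfolding g2path_nbr[OF p2 Suc.prems(1) l2 k] by auto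
        have t: "int t < \<bar>l + 1\<bar>" using Suc.prems out b by auto
        have "run A ?S1 t (p1 (l + 1)) = quiescent A"
          using Suc.prems out t by (intro run_quiescent[OF wf p1]) auto
        moreover have "run A ?S2 t (p2 (l + 1)) = quiescent A"
          using Suc.prems p2l t by (intro run_quiescent[OF wf p2]) auto
        ultimately show ?thesis using out p2l by metis
      qed
    qed
    then show "(if shift (p1 l) k \<in> ?S1 then Some (run A ?S1 t (shift (p1 l) k)) else None) =
          (if shift (p1 l) k \<in> ?S2 then Some (run A ?S2 t (shift (p1 l) k)) else None)"
      using mem by simp
  qed simp
qed

text \<open>All nodes fire together and for the first time, so a single node with the same history
  in both configurations forces equal firing times. The main use is with an end of the path, far
  from the place where the configurations differ.\<close>

lemma fires_at_unique:
  assumes "fires_at A S t" "fires_at A S' t'" "q \<in> S" "q \<in> S'"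
    and "\<And>u. u \<le> t \<Longrightarrow> run A S u q = run A S' u q"
  shows "t' = t"
proof (rule linorder_cases[of t t'])
  assume "t < t'"
  then show ?thesis using assms unfolding fires_at_def by (metis order_refl)
next
  assume "t' < t"
  then show ?thesis using assms unfolding fires_at_def by (metis less_imp_le)
qed simp

lemma ft_eq:
  assumes "fires_at A S t" "S \<noteq> {}"
  shows "ft S A = t"
proof -
  obtain q where "q \<in> S" using assms by blast
  then show ?thesis unfolding ft_def
    by (intro Least_equality assms) (use assms fires_at_unique in \<open>metis order_refl\<close>)
qed

text \<open>The quiescent state is not a firing state, so a node must have been woken before it
  fires. This bounds the length of all configurations that fire at \<open>t\<close>.\<close>

lemma fires_at_bound:
  assumes "wf_fsa A" "g2path r s p" "fires_at A (p ` {r..s}) t" "r \<le> l" "l \<le> s"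
  shows "\<bar>l\<bar> \<le> int t"
proof (rule ccontr)
  assume "\<not> \<bar>l\<bar> \<le> int t"
  then have "run A (p ` {r..s}) t (p l) = quiescent A"
    using run_quiescent[OF assms(1,2,4,5)] by auto
  then have "quiescent A \<in> firing A" using assms(3-) unfolding fires_at_def by force
  then show False using assms(1) by (simp add: wf_fsa_def)
qed

section \<open>Positions reachable in bounded time\<close>

lemma adj_bound: "adj q q' \<Longrightarrow> \<bar>fst q' - fst q\<bar> \<le> 1 \<and> \<bar>snd q' - snd q\<bar> \<le> 1"
  by (auto simp: adj_def shift_def eps_def)

text \<open>Contains all positions awake at time \<open>n\<close>. Its finiteness yields finitely
  many extensions in the lower bound and finitely many states of the delayed automaton in the upper
  bound.\<close>

definition box :: "nat \<Rightarrow> pos set" where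
  "box n = {- int n..int n} \<times> {- int n..int n}"

lemma finite_box: "finite (box n)"
  by (simp add: box_def)

lemma box_step:
  assumes "q \<in> box n" "adj q q'"
  shows "q' \<in> box (Suc n)"
  using adj_bound[OF assms(2)] assms(1) by (cases q; cases q') (auto simp: box_def)

lemma box_mono: "n \<le> m \<Longrightarrow> box n \<subseteq> box m"
  by (auto simp: box_def)

lemma g2path_box:
  assumes "g2path r s p" "r \<le> l" "l \<le> s" "\<bar>l\<bar> \<le> int n"
  shows "p l \<in> box n"
  using assms(2-)
proof (induction n arbitrary: l)
  case 0
  then show ?case using g2pathD(3)[OF assms(1)] by (simp add: box_def)
next
  case (Suc n)
  consider "\<bar>l\<bar> \<le> int n" | "l = int n + 1" | "l = - int n - 1" using Suc.prems by linarith
  then show ?case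
  proof cases
    case 1
    then show ?thesis using Suc.IH[of l] Suc.prems box_mono[of n "Suc n"] by auto
  next
    case 2
    then have "p (l - 1) \<in> box n" using Suc.IH[of "l - 1"] Suc.prems g2pathD(1)[OF assms(1)] by auto
    moreover have "adj (p (l - 1)) (p l)"
      using g2pathD(5)[OF assms(1), of "l - 1"] 2 Suc.prems g2pathD(1)[OF assms(1)] by auto
    ultimately show ?thesis by (rule box_step)
  next
    case 3
    then have "p (l + 1) \<in> box n" using Suc.IH[of "l + 1"] Suc.prems g2pathD(2)[OF assms(1)] by auto
    moreover have "adj (p (l + 1)) (p l)"
      using g2pathD(6)[OF assms(1), of "l + 1"] 3 Suc.prems g2pathD(2)[OF assms(1)] by auto
    ultimately show ?thesis by (rule box_step)
  qed
qed

section \<open>Extensions of a segment\<close>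

text \<open>Indexed so that the general keeps index 0: \<open>x0\<close> ends at
  \<open>i - 1\<close> and \<open>x1\<close> begins at \<open>j + 1\<close>. Extensions become paths
  in the sense of \<open>g2path\<close>, and two extensions with the same \<open>x0\<close> agree
  index by index on the left.\<close>

definition ext :: "(int \<Rightarrow> 'a) \<Rightarrow> int \<Rightarrow> int \<Rightarrow> 'a list \<Rightarrow> 'a list \<Rightarrow> int \<Rightarrow> 'a" where
  "ext p i j x0 x1 l = (if l < i then x0 ! nat (l - i + int (length x0))
     else if l \<le> j then p l else x1 ! nat (l - j - 1))"

lemma map_ext:
  assumes "i \<le> j + 1"
  shows "map (ext p i j x0 x1) [i - int (length x0)..j + int (length x1)] = x0 @ map p [i..j] @ x1"
    (is "?A = ?B")
proof (rule nth_equalityI)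
  show len: "length ?A = length ?B" using assms by auto
  fix k assume k: "k < length ?A"
  define l where "l = i - int (length x0) + int k"
  have "[i - int (length x0)..j + int (length x1)] ! k = l"
    unfolding l_def by (rule nth_upto) (use k in auto)
  then have A: "?A ! k = ext p i j x0 x1 l" using k by simp
  consider "l < i" | "i \<le> l" "l \<le> j" | "j < l" "i \<le> l" by linarith
  then show "?A ! k = ?B ! k"
  proof cases
    case 1
    then show ?thesis unfolding A by (auto simp: ext_def nth_append l_def)
  next
    case 2
    then have "k - length x0 < length (map p [i..j])" "\<not> k < length x0" by (auto simp: l_def)
    moreover have "[i..j] ! (k - length x0) = i + int (k - length x0)"
      by (rule nth_upto) (use 2 in \<open>auto simp: l_def\<close>)
    ultimately show ?thesis unfolding A using 2 by (auto simp: ext_def nth_append l_def algebra_simps)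
  next
    case 3
    then have "\<not> k < length x0" "\<not> k - length x0 < length (map p [i..j])" using assms by (auto simp: l_def)
    moreover have "nat (l - j - 1) = k - length x0 - nat (j - i + 1)"
      using 3 assms by (auto simp: l_def)
    ultimately show ?thesis unfolding A using 3 by (auto simp: ext_def nth_append)
  qed
qed

lemma set_ext:
  assumes "i \<le> j + 1"
  shows "set (x0 @ map p [i..j] @ x1) =
    ext p i j x0 x1 ` {i - int (length x0)..j + int (length x1)}"
  unfolding map_ext[OF assms, symmetric] by simp

lemma W_iff:
  assumes "g2path r s p" "i \<le> 0" "0 \<le> j"
  shows "(x0, x1) \<in> W r s p i j \<longleftrightarrow>
    g2path (i - int (length x0)) (j + int (length x1)) (ext p i j x0 x1) \<and>
    (\<forall>l\<in>{i..j}. bc (ext p i j x0 x1 ` {i - int (length x0)..j + int (length x1)}) (p l) = bc (p ` {r..s}) (p l))"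
proof -
  have le: "i \<le> j + 1" using assms by simp
  have "ext p i j x0 x1 0 = (0,0)" using assms g2pathD(3)[OF assms(1)] by (simp add: ext_def)
  then show ?thesis
    unfolding W_def g2path_def map_ext[OF le] set_ext[OF le, symmetric]
    using assms by auto
qed

lemma W_self:
  assumes "g2path r s p" "r \<le> i" "i \<le> 0" "0 \<le> j" "j \<le> s"
  shows "(map p [r..i - 1], map p [j + 1..s]) \<in> W r s p i j"
proof -
  have "[r..s] = [r..i - 1] @ [i..s]" using assms upto_split1[of r i s] by simp
  also have "[i..s] = [i..j] @ [j + 1..s]" using assms upto_split2[of i j s] by simp
  finally have "map p [r..i - 1] @ map p [i..j] @ map p [j + 1..s] = map p [r..s]" by simp
  then show ?thesis using assms(1) by (simp add: W_def g2path_def del: map_append set_append)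
qed

lemma W_shrink_right:
  assumes "(x0, x1) \<in> W r s p i j" "i \<le> j"
  shows "(x0, p j # x1) \<in> W r s p i (j - 1)"
proof -
  have "[i..j] = [i..j - 1] @ [j]" using assms(2) by (rule upto_rec2)
  then show ?thesis using assms(1) by (simp add: W_def)
qed

text \<open>Moving \<open>p j\<close> into the right extension gives one inclusion. For the other,
  noninterference allows replacing the right part that accompanies \<open>y0\<close> by the right
  part of C itself, which contains \<open>p j\<close>.\<close>

lemma U_shrink_right:
  assumes p: "g2path r s p" and ij: "r \<le> i" "i \<le> 0" "0 < j" "j \<le> s" and ni: "NI r s p i (j - 1)"
  shows "U r s p i (j - 1) = U r s p i j"
proof
  show "U r s p i j \<subseteq> U r s p i (j - 1)"
  proof
    fix y0 assume "y0 \<in> U r s p i j"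
    then obtain y1 where "(y0, y1) \<in> W r s p i j" unfolding U_def by auto
    then have "(y0, p j # y1) \<in> W r s p i (j - 1)" using W_shrink_right ij by simp
    then show "y0 \<in> U r s p i (j - 1)" unfolding U_def by force
  qed
  show "U r s p i (j - 1) \<subseteq> U r s p i j"
  proof
    fix y0 assume y0: "y0 \<in> U r s p i (j - 1)"
    let ?c0 = "map p [r..i - 1]" and ?c1 = "map p [j + 1..s]"
    have "(?c0, ?c1) \<in> W r s p i j" using W_self p ij by simp
    then have "(?c0, p j # ?c1) \<in> W r s p i (j - 1)" using W_shrink_right ij by simp
    then have "(y0, p j # ?c1) \<in> W r s p i (j - 1)"
      using y0 ni unfolding NI_def V_def by force
    moreover have "[i..j] = [i..j - 1] @ [j]" using ij by (intro upto_rec2) auto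
    ultimately have lc: "lconfig (y0 @ map p [i..j] @ ?c1)"
      and bc: "\<forall>l\<in>{i..j - 1}. bc (set (y0 @ map p [i..j] @ ?c1)) (p l) = bc (p ` {r..s}) (p l)"
      by (auto simp: W_def)
    let ?P = "ext p i j y0 ?c1"
    let ?a = "i - int (length y0)"
    have len: "j + int (length ?c1) = s" using ij by simp
    have le: "i \<le> j + 1" using ij by simp
    have "map ?P [?a..s] = y0 @ map p [i..j] @ ?c1"
      using map_ext[OF le, of p y0 ?c1] unfolding len .
    moreover have "?P 0 = (0,0)" using ij g2pathD(3)[OF p] by (simp add: ext_def)
    ultimately have P: "g2path ?a s ?P" using lc ij by (simp add: g2path_def)
    have set: "set (y0 @ map p [i..j] @ ?c1) = ?P ` {?a..s}"
      using set_ext[OF le, of y0 p ?c1] unfolding len .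
    \<comment> \<open>Membership in \<open>W\<close> for \<open>j - 1\<close> says nothing about the
      boundary condition of \<open>p j\<close>, but now both neighbours of \<open>p j\<close> are
      those in C.\<close>
    have "bc (?P ` {?a..s}) (?P j) = bc (p ` {r..s}) (p j)"
    proof (rule bc_path_cong[OF P p])
      show "?P (j + 1) = p (j + 1)" if "j < s" using that ij by (simp add: ext_def nth_upto)
    qed (use ij in \<open>auto simp: ext_def\<close>)
    then have "bc (set (y0 @ map p [i..j] @ ?c1)) (p j) = bc (p ` {r..s}) (p j)"
      unfolding set using ij by (simp add: ext_def)
    then have "\<forall>l\<in>{i..j}. bc (set (y0 @ map p [i..j] @ ?c1)) (p l) = bc (p ` {r..s}) (p l)"
      using bc by (metis (no_types, lifting) atLeastAtMost_iff zle_diff1_eq order_le_less)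
    then have "(y0, ?c1) \<in> W r s p i j" using lc by (simp add: W_def)
    then show "y0 \<in> U r s p i j" unfolding U_def by force
  qed
qed

section \<open>The lower bound\<close>

text \<open>\<open>run_cone\<close> is applied with \<open>b = j - 1\<close> and observed at the
  left end, index \<open>i - length x0\<close>; its bound \<open>2 * (b + 1) - l\<close> is then the
  one in \<open>late\<close>.\<close>

lemma fires_extend_right:
  assumes sol: "is_solution A" and p: "g2path r s p" and ij: "r \<le> i" "i \<le> 0" "0 \<le> j" "j \<le> s"
    and x: "(x0, x1) \<in> W r s p i j" and fires: "fires_at A (set (x0 @ map p [i..j] @ x1)) t"
    and late: "int t < 2 * j - i + int (length x0)"
    and ni: "0 < j \<Longrightarrow> NI r s p i (j - 1)"
  shows "0 < j"
    and "z1 \<in> V r s p i (j - 1) \<Longrightarrow> (x0, z1) \<in> W r s p i (j - 1)"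
    and "z1 \<in> V r s p i (j - 1) \<Longrightarrow> fires_at A (set (x0 @ map p [i..j - 1] @ z1)) t"
proof -
  have wf: "wf_fsa A" using sol by (simp add: is_solution_def)
  let ?a = "i - int (length x0)"
  let ?P1 = "ext p i j x0 x1" and ?s1 = "j + int (length x1)"
  have P1: "g2path ?a ?s1 ?P1"
    and bc1: "\<And>l. i \<le> l \<Longrightarrow> l \<le> j \<Longrightarrow> bc (?P1 ` {?a..?s1}) (p l) = bc (p ` {r..s}) (p l)"
    using x ij unfolding W_iff[OF p ij(2,3)] by auto
  have set1: "set (x0 @ map p [i..j] @ x1) = ?P1 ` {?a..?s1}"
    by (rule set_ext) (use ij in simp)
  \<comment> \<open>For \<open>j = 0\<close> the bound \<open>late\<close> would leave the left end
    asleep at time \<open>t\<close>, although it fires then.\<close>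
  show j: "0 < j"
  proof (rule ccontr)
    assume "\<not> 0 < j"
    then have "int t < \<bar>?a\<bar>" using late ij by auto
    moreover have "\<bar>?a\<bar> \<le> int t"
      using fires_at_bound[OF wf P1 fires[unfolded set1], of ?a] ij by auto
    ultimately show False by simp
  qed
  assume z1: "z1 \<in> V r s p i (j - 1)"
  \<comment> \<open>This puts \<open>x0\<close> into \<open>U\<close> for \<open>j - 1\<close>, and
    noninterference pairs it with any \<open>z1\<close>.\<close>
  have "(x0, p j # x1) \<in> W r s p i (j - 1)" using W_shrink_right[OF x] ij by simp
  then show z: "(x0, z1) \<in> W r s p i (j - 1)"
    using z1 ni[OF j] unfolding NI_def U_def by force
  let ?P2 = "ext p i (j - 1) x0 z1" and ?s2 = "j - 1 + int (length z1)"
  have j1: "0 \<le> j - 1" using j by simp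
  have P2: "g2path ?a ?s2 ?P2"
    and bc2: "\<And>l. i \<le> l \<Longrightarrow> l \<le> j - 1 \<Longrightarrow> bc (?P2 ` {?a..?s2}) (p l) = bc (p ` {r..s}) (p l)"
    using z unfolding W_iff[OF p ij(2) j1] by auto
  have set2: "set (x0 @ map p [i..j - 1] @ z1) = ?P2 ` {?a..?s2}"
    by (rule set_ext) (use ij in simp)
  have agree: "?P1 l = ?P2 l" if "l \<le> j - 1" for l
    using that by (simp add: ext_def)
  have same: "run A (?P1 ` {?a..?s1}) u (?P1 ?a) = run A (?P2 ` {?a..?s2}) u (?P1 ?a)" if "u \<le> t" for u
  proof (rule run_cone[OF wf P1 P2 j1])
    show "?P1 l = ?P2 l" if "l \<le> j - 1" for l by (rule agree[OF that])
    \<comment> \<open>\<open>W\<close> prescribes boundary conditions only from \<open>i\<close> on.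
      Left of \<open>i\<close> both neighbours have index at most \<open>i \<le> j - 1\<close>,
      where the two paths coincide.\<close>
    show "bc (?P1 ` {?a..?s1}) (?P1 l) = bc (?P2 ` {?a..?s2}) (?P1 l)" if "?a \<le> l" "l \<le> j - 1" for l
    proof (cases "i \<le> l")
      case True
      then show ?thesis using bc1[of l] bc2[of l] that by (simp add: ext_def)
    next
      case False
      have "bc (?P1 ` {?a..?s1}) (?P1 l) = bc (?P2 ` {?a..?s2}) (?P2 l)"
        by (rule bc_path_cong[OF P1 P2]) (use False that ij j in \<open>auto intro!: agree\<close>)
      then show ?thesis using agree that by simp
    qed
  qed (use ij late that in auto)
  have "lconfig (x0 @ map p [i..j - 1] @ z1)" using z by (simp add: W_def)
  then obtain t2 where t2: "fires_at A (?P2 ` {?a..?s2}) t2"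
    using sol set2 unfolding is_solution_def by metis
  have "t2 = t"
  proof (rule fires_at_unique[OF fires[unfolded set1] t2 _ _ same])
    show "?P1 ?a \<in> ?P1 ` {?a..?s1}" using ij by (intro imageI) auto
    show "?P1 ?a \<in> ?P2 ` {?a..?s2}" using agree[of ?a] ij j by (simp add: image_eqI)
  qed
  then show "fires_at A (set (x0 @ map p [i..j - 1] @ z1)) t" using t2 set2 by simp
qed

text \<open>The invariant of the descent. Maximality bounds \<open>fW\<close> and \<open>gW\<close>
  by the lengths of \<open>x0\<close> and \<open>x1\<close>, which turns a statement about one
  configuration into one about the term for \<open>(i, j)\<close>. Finiteness of \<open>W\<close> is
  what makes CNI applicable to the next pair.\<close>

definition firing_witness ::
  "fsa \<Rightarrow> nat \<Rightarrow> int \<Rightarrow> int \<Rightarrow> (int \<Rightarrow> pos) \<Rightarrow> int \<Rightarrow> int \<Rightarrow> pos list \<Rightarrow> pos list \<Rightarrow> bool" where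
  "firing_witness A t r s p i j x0 x1 \<longleftrightarrow>
     (i, j) \<in> idx r s \<and> finite (W r s p i j) \<and> (x0, x1) \<in> W r s p i j \<and>
     fires_at A (set (x0 @ map p [i..j] @ x1)) t \<and>
     (\<forall>y\<in>U r s p i j. length y \<le> length x0) \<and> (\<forall>y\<in>V r s p i j. length y \<le> length x1)"

lemma ex_longest:
  assumes "finite X" "x \<in> X"
  shows "\<exists>y\<in>X. \<forall>z\<in>X. length z \<le> length y"
proof -
  have "Max (length ` X) \<in> length ` X" using assms by (intro Max_in) auto
  then obtain y where "y \<in> X" "length y = Max (length ` X)" by auto
  then show ?thesis using assms(1) by (metis Max_ge finite_imageI imageI)
qed

text \<open>\<open>x0\<close> stays longest because \<open>U\<close> does not change, and
  \<open>W\<close> stays finite because noninterference makes it the product of \<open>U\<close>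
  with a finite \<open>V\<close>.\<close>

lemma firing_witness_right:
  assumes sol: "is_solution A" and p: "g2path r s p"
    and w: "firing_witness A t r s p i j x0 x1"
    and late: "int t < 2 * j - i + int (length x0)"
    and ni: "0 < j \<Longrightarrow> NI r s p i (j - 1)"
  obtains z1 where "firing_witness A t r s p i (j - 1) x0 z1" "0 < j"
proof -
  have ij: "r \<le> i" "i \<le> 0" "0 \<le> j" "j \<le> s" and x: "(x0, x1) \<in> W r s p i j"
    and fires: "fires_at A (set (x0 @ map p [i..j] @ x1)) t" and fin: "finite (W r s p i j)"
    and max0: "\<forall>y\<in>U r s p i j. length y \<le> length x0"
    using w by (auto simp: firing_witness_def idx_def)
  note * = fires_extend_right[OF sol p ij x fires late ni]
  have wf: "wf_fsa A" using sol by (simp add: is_solution_def)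
  have j: "0 < j" and j1: "0 \<le> j - 1" using *(1) by auto
  have U: "U r s p i (j - 1) = U r s p i j" using U_shrink_right p ij j ni by simp
  \<comment> \<open>Each \<open>z1\<close> completes \<open>x0\<close> to a configuration firing at
    \<open>t\<close>, whose indices are therefore at most \<open>t\<close> in absolute value. The
    last index is \<open>j - 1 + length z1\<close> with \<open>j \<ge> 1\<close>, hence
    \<open>length z1 \<le> t\<close>.\<close>
  have "V r s p i (j - 1) \<subseteq> {xs. set xs \<subseteq> box t \<and> length xs \<le> t}"
  proof
    fix z1 assume z1: "z1 \<in> V r s p i (j - 1)"
    let ?P = "ext p i (j - 1) x0 z1" and ?a = "i - int (length x0)" and ?b = "j - 1 + int (length z1)"
    have P: "g2path ?a ?b ?P" using *(2)[OF _ z1] unfolding W_iff[OF p ij(2) j1] by auto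
    have set: "set (x0 @ map p [i..j - 1] @ z1) = ?P ` {?a..?b}"
      by (rule set_ext) (use ij in simp)
    have bound: "\<bar>l\<bar> \<le> int t" if "?a \<le> l" "l \<le> ?b" for l
      using fires_at_bound[OF wf P *(3)[OF _ z1, unfolded set]] that by simp
    have "?P ` {?a..?b} \<subseteq> box t"
      using g2path_box[OF P] bound by auto
    then have "set (x0 @ map p [i..j - 1] @ z1) \<subseteq> box t" unfolding set .
    then have "set z1 \<subseteq> box t" by auto
    moreover have "length z1 \<le> t" using bound[of ?b] ij j by auto
    ultimately show "z1 \<in> {xs. set xs \<subseteq> box t \<and> length xs \<le> t}" by simp
  qed
  then have finV: "finite (V r s p i (j - 1))"
    using finite_lists_length_le[OF finite_box] finite_subset by blast
  have "finite (U r s p i (j - 1))" using fin U by (simp add: U_def)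
  then have finW: "finite (W r s p i (j - 1))" using finV ni[OF j] by (simp add: NI_def)
  have "p j # x1 \<in> V r s p i (j - 1)" using W_shrink_right[OF x] ij unfolding V_def by force
  then obtain z1 where z1: "z1 \<in> V r s p i (j - 1)" "\<forall>z\<in>V r s p i (j - 1). length z \<le> length z1"
    using ex_longest[OF finV] by blast
  have "firing_witness A t r s p i (j - 1) x0 z1"
    unfolding firing_witness_def using finW z1 *(2,3) max0 ij j U by (auto simp: idx_def)
  then show thesis using that j by blast
qed

section \<open>Reversing extensions\<close>

lemma W_mirror_iff:
  assumes "g2path r s p"
  shows "(rev x1, rev x0) \<in> W (- s) (- r) (\<lambda>l. p (- l)) (- j) (- i) \<longleftrightarrow> (x0, x1) \<in> W r s p i j"
proof -
  have xs: "rev x1 @ map (\<lambda>l. p (- l)) [- j..- i] @ rev x0 = rev (x0 @ map p [i..j] @ x1)"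
    by (simp add: map_upto_mirror)
  let ?X = "x0 @ map p [i..j] @ x1"
  have "lconfig (rev ?X) = lconfig ?X" using lconfig_rev[of ?X] lconfig_rev[of "rev ?X"] by auto
  moreover have "(\<forall>l\<in>{- j..- i}. P (- l)) \<longleftrightarrow> (\<forall>l\<in>{i..j}. P l)" for P :: "int \<Rightarrow> bool"
    by (metis atLeastAtMost_iff minus_le_iff le_minus_iff minus_minus)
  from this[of "\<lambda>l. bc (set ?X) (p l) = bc (p ` {r..s}) (p l)"]
  have "(\<forall>l\<in>{- j..- i}. bc (set ?X) (p (- l)) = bc (p ` {r..s}) (p (- l))) \<longleftrightarrow>
    (\<forall>l\<in>{i..j}. bc (set ?X) (p l) = bc (p ` {r..s}) (p l))" .
  ultimately show ?thesis
    unfolding W_def mem_Collect_eq prod.case xs set_rev image_uminus_interval by blast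
qed

lemma W_mirror:
  assumes "g2path r s p"
  shows "W (- s) (- r) (\<lambda>l. p (- l)) (- j) (- i) = (\<lambda>(x0, x1). (rev x1, rev x0)) ` W r s p i j"
  (is "?L = ?R")
proof (rule set_eqI)
  fix z :: "pos list \<times> pos list"
  obtain a b where z: "z = (rev a, rev b)" by (metis prod.exhaust rev_rev_ident)
  have "z \<in> ?L \<longleftrightarrow> (b, a) \<in> W r s p i j" unfolding z by (rule W_mirror_iff[OF assms])
  also have "\<dots> \<longleftrightarrow> z \<in> ?R" unfolding z by force
  finally show "z \<in> ?L \<longleftrightarrow> z \<in> ?R" .
qed

lemma UV_mirror:
  assumes "g2path r s p"
  shows "U (- s) (- r) (\<lambda>l. p (- l)) (- j) (- i) = rev ` V r s p i j"
    and "V (- s) (- r) (\<lambda>l. p (- l)) (- j) (- i) = rev ` U r s p i j"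
  unfolding U_def V_def W_mirror[OF assms] by force+

lemma finite_W_mirror:
  assumes "g2path r s p"
  shows "finite (W (- s) (- r) (\<lambda>l. p (- l)) (- j) (- i)) \<longleftrightarrow> finite (W r s p i j)"
  unfolding W_mirror[OF assms] by (rule finite_image_iff) (auto simp: inj_on_def)

lemma NI_mirror:
  assumes "g2path r s p"
  shows "NI (- s) (- r) (\<lambda>l. p (- l)) (- j) (- i) \<longleftrightarrow> NI r s p i j"
proof -
  let ?f = "\<lambda>(x0 :: pos list, x1 :: pos list). (rev x1, rev x0)"
  have inj: "inj ?f" by (auto simp: inj_def)
  have "rev ` V r s p i j \<times> rev ` U r s p i j = ?f ` (U r s p i j \<times> V r s p i j)" by force
  then show ?thesis
    unfolding NI_def W_mirror[OF assms] UV_mirror[OF assms] by (simp add: inj_image_eq_iff[OF inj])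
qed

lemma firing_witness_mirror:
  assumes "g2path r s p"
  shows "firing_witness A t (- s) (- r) (\<lambda>l. p (- l)) (- j) (- i) (rev x1) (rev x0) \<longleftrightarrow>
    firing_witness A t r s p i j x0 x1"
proof -
  have xs: "rev x1 @ map (\<lambda>l. p (- l)) [- j..- i] @ rev x0 = rev (x0 @ map p [i..j] @ x1)"
    by (simp add: map_upto_mirror)
  have "(- j, - i) \<in> idx (- s) (- r) \<longleftrightarrow> (i, j) \<in> idx r s" by (auto simp: idx_def)
  then show ?thesis
    unfolding firing_witness_def xs set_rev finite_W_mirror[OF assms] W_mirror_iff[OF assms] UV_mirror[OF assms]
    by auto
qed

text \<open>Reflection replaces (i, j) by (-j, -i) and \<open>x0\<close> by the reversed
  \<open>x1\<close>, which turns 2j - i + |x0| into the present bound; the left step is the right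
  step for the reversed path.\<close>

lemma firing_witness_left:
  assumes sol: "is_solution A" and p: "g2path r s p"
    and w: "firing_witness A t r s p i j x0 x1"
    and late: "int t < - 2 * i + j + int (length x1)"
    and ni: "i < 0 \<Longrightarrow> NI r s p (i + 1) j"
  obtains z0 where "firing_witness A t r s p (i + 1) j z0 x1" "i < 0"
proof -
  have "firing_witness A t (- s) (- r) (\<lambda>l. p (- l)) (- j) (- i) (rev x1) (rev x0)"
    using w firing_witness_mirror[OF p] by blast
  moreover have "int t < 2 * (- i) - (- j) + int (length (rev x1))" using late by simp
  moreover have "NI (- s) (- r) (\<lambda>l. p (- l)) (- j) (- i - 1)" if "0 < - i"
    using ni that NI_mirror[OF p, of j "i + 1"] by simp
  ultimately obtain z where z:
    "firing_witness A t (- s) (- r) (\<lambda>l. p (- l)) (- j) (- i - 1) (rev x1) z" "0 < - i"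
    using firing_witness_right[OF sol g2path_mirror[OF p]] by metis
  then have "firing_witness A t r s p (i + 1) j (rev z) x1"
    using firing_witness_mirror[OF p, of A t j "i + 1" x1 "rev z"] by simp
  then show thesis using that z(2) by simp
qed

text \<open>The descent only visits pairs with finite \<open>W\<close>. The next pair either has
  finite \<open>W\<close> too and lies in \<open>Kset\<close>, or has infinite \<open>W\<close> and
  lies in \<open>Jset\<close>, because increasing \<open>j\<close> leads back to a finite
  \<open>W\<close>.\<close>

lemma CNI_right:
  assumes "CNI r s p" "(i, j) \<in> idx r s" "finite (W r s p i j)" "0 < j"
  shows "NI r s p i (j - 1)"
proof -
  have "(i, j - 1) \<in> Jset r s p \<union> Kset r s p"
    using assms(2-) by (auto simp: Jset_def Kset_def idx_def)
  then show ?thesis using assms(1) unfolding CNI_def by blast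
qed

lemma CNI_left:
  assumes "CNI r s p" "(i, j) \<in> idx r s" "finite (W r s p i j)" "i < 0"
  shows "NI r s p (i + 1) j"
proof -
  have "(i + 1, j) \<in> Iset r s p \<union> Kset r s p"
    using assms(2-) by (auto simp: Iset_def Kset_def idx_def)
  then show ?thesis using assms(1) unfolding CNI_def by blast
qed

text \<open>Each shortening comes with \<open>0 < j\<close> or \<open>i < 0\<close>, so the segment
  never loses the general and its length can serve as the measure.\<close>

lemma firing_witness_descent:
  assumes sol: "is_solution A" and p: "g2path r s p" and cni: "CNI r s p"
    and w: "firing_witness A t r s p i j x0 x1"
  shows "\<exists>i j x0 x1. firing_witness A t r s p i j x0 x1 \<and>
    2 * j - i + int (length x0) \<le> int t \<and> - 2 * i + j + int (length x1) \<le> int t"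
  using w
proof (induction "nat (j - i)" arbitrary: i j x0 x1 rule: less_induct)
  case less
  have idx: "(i, j) \<in> idx r s" and fin: "finite (W r s p i j)"
    using less.prems by (auto simp: firing_witness_def)
  then have ij: "i \<le> 0" "0 \<le> j" by (auto simp: idx_def)
  consider "int t < 2 * j - i + int (length x0)" | "int t < - 2 * i + j + int (length x1)"
    | "2 * j - i + int (length x0) \<le> int t \<and> - 2 * i + j + int (length x1) \<le> int t" by linarith
  then show ?case
  proof cases
    case 1
    obtain z1 where z: "firing_witness A t r s p i (j - 1) x0 z1" "0 < j"
      using firing_witness_right[OF sol p less.prems 1] CNI_right[OF cni idx fin] by blast
    have "nat (j - 1 - i) < nat (j - i)" using z(2) ij by simp
    then show ?thesis using less.hyps z(1) by blast
  next
    case 2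
    obtain z0 where z: "firing_witness A t r s p (i + 1) j z0 x1" "i < 0"
      using firing_witness_left[OF sol p less.prems 2] CNI_left[OF cni idx fin] by blast
    have "nat (j - (i + 1)) < nat (j - i)" using z(2) ij by simp
    then show ?thesis using less.hyps z(1) by blast
  next
    case 3
    then show ?thesis using less.prems by blast
  qed
qed

text \<open>A node beyond an end would be a new neighbour of that end. The prescribed boundary
  condition only allows neighbours from C, so this node would occur twice in the extended path. The
  descent can thus start at \<open>(r, s)\<close>.\<close>

lemma W_full:
  assumes p: "g2path r s p"
  shows "W r s p r s = {([], [])}"
proof -
  note D = g2pathD[OF p]
  have "x0 = [] \<and> x1 = []" if "(x0, x1) \<in> W r s p r s" for x0 x1
  proof -
    let ?P = "ext p r s x0 x1" and ?a = "r - int (length x0)" and ?b = "s + int (length x1)"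
    have P: "g2path ?a ?b ?P"
      and bc: "\<And>l. r \<le> l \<Longrightarrow> l \<le> s \<Longrightarrow> bc (?P ` {?a..?b}) (p l) = bc (p ` {r..s}) (p l)"
      using that unfolding W_iff[OF p D(1,2)] by auto
    have no: "?P m \<notin> ?P ` {?a..?b}" if m: "m = r - 1 \<or> m = s + 1" "m \<in> {?a..?b}" for m
    proof
      assume "?P m \<in> ?P ` {?a..?b}"
      define l where "l = (if m = r - 1 then r else s)"
      have l: "r \<le> l" "l \<le> s" "l = m + 1 \<or> l = m - 1" and lP: "?P l = p l"
        using m D(1,2) by (auto simp: l_def ext_def)
      have lb: "l \<in> {?a..?b}" using l by auto
      have "adj (?P l) (?P m)"
      proof (cases "l = m + 1")
        case True
        then have "m = l - 1" by simp
        then show ?thesis using g2pathD(6)[OF P, of l] m(2) lb by simp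
      next
        case False
        then have "m = l + 1" using l(3) by simp
        then show ?thesis using g2pathD(5)[OF P, of l] m(2) lb by simp
      qed
      then obtain k where k: "k < 4" "?P m = shift (p l) k" unfolding adj_def lP by blast
      then have "?P m \<in> p ` {r..s}"
        using bc[OF l(1,2)] \<open>?P m \<in> _\<close> unfolding bc_eq_iff by metis
      then obtain n where n: "r \<le> n" "n \<le> s" "?P m = p n" by auto
      then have "?P n = ?P m" by (simp add: ext_def)
      then have "n = m" using g2pathD(4)[OF P, of n m] n m(2) by auto
      then show False using n m(1) by auto
    qed
    have "x0 = []"
    proof (rule ccontr)
      assume "x0 \<noteq> []"
      then have "r - 1 \<in> {?a..?b}" using D(1,2) by (cases x0) auto
      then show False using no[of "r - 1"] by blast
    qed
    moreover have "x1 = []"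
    proof (rule ccontr)
      assume "x1 \<noteq> []"
      then have "s + 1 \<in> {?a..?b}" using D(1,2) by (cases x1) auto
      then show False using no[of "s + 1"] by blast
    qed
    ultimately show ?thesis by simp
  qed
  moreover have "([], []) \<in> W r s p r s" using W_self[OF p, of r s] D(1,2) by simp
  ultimately show ?thesis by auto
qed

lemma firing_time_lower_bound:
  assumes sol: "is_solution A" and p: "g2path r s p" and cni: "CNI r s p"
    and fires: "fires_at A (p ` {r..s}) t"
  shows "\<exists>(i, j)\<in>idx r s. max (enat (nat (- 2 * i + j)) + gW r s p i j)
      (enat (nat (2 * j - i)) + fW r s p i j) \<le> enat t"
proof -
  have "firing_witness A t r s p r s [] []"
    unfolding firing_witness_def U_def V_def W_full[OF p]
    using fires g2pathD(1,2)[OF p] by (auto simp: idx_def)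
  then obtain i j x0 x1 where w: "firing_witness A t r s p i j x0 x1"
    and t: "2 * j - i + int (length x0) \<le> int t" "- 2 * i + j + int (length x1) \<le> int t"
    using firing_witness_descent[OF sol p cni] by blast
  have ij: "(i, j) \<in> idx r s" "i \<le> 0" "0 \<le> j" using w by (auto simp: firing_witness_def idx_def)
  have "fW r s p i j \<le> enat (length x0)" "gW r s p i j \<le> enat (length x1)"
    using w unfolding firing_witness_def fW_def gW_def by (auto intro!: Sup_least)
  then have "enat (nat (- 2 * i + j)) + gW r s p i j \<le> enat (nat (- 2 * i + j)) + enat (length x1)"
    "enat (nat (2 * j - i)) + fW r s p i j \<le> enat (nat (2 * j - i)) + enat (length x0)"
    by (simp_all only: add_left_mono)
  moreover have "enat (nat (- 2 * i + j)) + enat (length x1) \<le> enat t"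
    "enat (nat (2 * j - i)) + enat (length x0) \<le> enat t"
    using t ij by auto
  ultimately have "max (enat (nat (- 2 * i + j)) + gW r s p i j)
      (enat (nat (2 * j - i)) + fW r s p i j) \<le> enat t" by (meson max.boundedI order_trans)
  then show ?thesis using ij(1) by blast
qed

section \<open>A firing squad on a line\<close>

text \<open>Prefixes R and L give the direction in which a signal travels. A wall is fresh for one step only,
  as \<^term>\<open>NewWall\<close>; its blank neighbours then become \<^term>\<open>RGen\<close> and \<^term>\<open>LGen\<close>, which stand for a fast and a
  slow signal at once. A slow signal stays in a cell for three steps.\<close>

datatype cell = Blank | Start | NewWall | OldWall | RFast | LFast | RSlow1 | RSlow2 | RSlow3 | LSlow1 | LSlow2 | LSlow3 | RGen | LGen | Fire

definition wall :: "cell option \<Rightarrow> bool" where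
  "wall y \<longleftrightarrow> y = None \<or> y = Some NewWall \<or> y = Some OldWall"

text \<open>\<open>Start\<close> walks to the left end and becomes the first generator. The
  reflected fast signal meets the slow one either in the third step of its stay, and both cells
  become walls (even length), or in the first step, and only the cell of the slow signal does (odd
  length). In a segment of one cell the generator itself becomes a wall. A wall fires once both its
  neighbours are walls.\<close>

fun rule1 :: "cell option \<Rightarrow> cell \<Rightarrow> cell option \<Rightarrow> cell" where
  "rule1 l Fire r = Fire"
| "rule1 l NewWall r = (if wall l \<and> wall r then Fire else OldWall)"
| "rule1 l OldWall r = (if wall l \<and> wall r then Fire else OldWall)"
| "rule1 l Start r = (if l = None then RGen else Blank)"
| "rule1 l RGen r = (if wall r then NewWall else RSlow2)"
| "rule1 l LGen r = (if wall l then NewWall else LSlow2)"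
| "rule1 l RSlow1 r = (if r = Some LFast then NewWall else RSlow2)"
| "rule1 l RSlow2 r = RSlow3"
| "rule1 l RSlow3 r = (if r = Some LFast then NewWall else Blank)"
| "rule1 l LSlow1 r = (if l = Some RFast then NewWall else LSlow2)"
| "rule1 l LSlow2 r = LSlow3"
| "rule1 l LSlow3 r = (if l = Some RFast then NewWall else Blank)"
| "rule1 l RFast r = (if wall r then LFast else if r = Some LSlow3 then NewWall else Blank)"
| "rule1 l LFast r = (if wall l then RFast else if l = Some RSlow3 then NewWall else Blank)"
| "rule1 l Blank r = (if l = Some NewWall then RGen else if r = Some NewWall then LGen
      else if l = Some RFast \<or> l = Some RGen then RFast else if r = Some LFast \<or> r = Some LGen then LFast
      else if l = Some RSlow3 then RSlow1 else if r = Some LSlow3 then LSlow1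
      else if r = Some Start then Start else Blank)"

definition line_step :: "(int \<Rightarrow> cell option) \<Rightarrow> int \<Rightarrow> cell option" where
  "line_step c x = map_option (\<lambda>a. rule1 (c (x - 1)) a (c (x + 1))) (c x)"

text \<open>The middle cells coincide for odd \<open>m\<close>. For m > 1 the signals meet at time
  3q if m = 2q and at 3q + 1 if m = 2q + 1; the walls appear one step later, at
  \<open>half_time m\<close>.\<close>

definition mid1 :: "int \<Rightarrow> int" where "mid1 m = (m + 1) div 2"
definition mid2 :: "int \<Rightarrow> int" where "mid2 m = (m + 2) div 2"
definition half_time :: "int \<Rightarrow> int" where "half_time m = (3 * m + 2) div 2"

text \<open>The content of cell \<^term>\<open>d\<close> of a segment of \<^term>\<open>m\<close> blank cells, \<^term>\<open>u\<close> steps after a wall was created at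
  its left end: the slow signal is in cell \<^term>\<open>d\<close> from time \<^term>\<open>3 * d - 2\<close> to \<^term>\<open>3 * d\<close>, the fast one at time \<^term>\<open>d\<close> and,
  reflected at the other end, at time \<^term>\<open>2 * m + 1 - d\<close>. They meet in the middle just before \<^term>\<open>half_time m\<close>.
  The value is meaningful only for \<^term>\<open>1 \<le> u\<close> and \<^term>\<open>u \<le> half_time m\<close>.\<close>

definition seg_cell :: "int \<Rightarrow> int \<Rightarrow> int \<Rightarrow> cell" where
  "seg_cell m u d =
     (if u = 1 then (if d = 1 then RGen else Blank)
      else if u = half_time m then (if d = mid1 m \<or> d = mid2 m then NewWall else Blank)
      else if u = 3 * d - 2 then RSlow1 else if u = 3 * d - 1 then RSlow2 else if u = 3 * d then RSlow3
      else if u = d then RFast else if u = 2 * m + 1 - d then LFast else Blank)"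

fun mirror :: "cell \<Rightarrow> cell" where
  "mirror RFast = LFast" | "mirror LFast = RFast" | "mirror RGen = LGen" | "mirror LGen = RGen"
| "mirror RSlow1 = LSlow1" | "mirror RSlow2 = LSlow2" | "mirror RSlow3 = LSlow3"
| "mirror LSlow1 = RSlow1" | "mirror LSlow2 = RSlow2" | "mirror LSlow3 = RSlow3"
| "mirror x = x"

lemma seg_cell_iff:
  assumes "1 \<le> u" "u < half_time m" "1 \<le> d" "d \<le> m"
  shows "seg_cell m u d = RGen \<longleftrightarrow> u = 1 \<and> d = 1"
    "seg_cell m u d = RSlow1 \<longleftrightarrow> u \<noteq> 1 \<and> u = 3 * d - 2"
    "seg_cell m u d = RSlow2 \<longleftrightarrow> u \<noteq> 1 \<and> u = 3 * d - 1"
    "seg_cell m u d = RSlow3 \<longleftrightarrow> u \<noteq> 1 \<and> u = 3 * d"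
    "seg_cell m u d = RFast \<longleftrightarrow> u \<noteq> 1 \<and> u = d"
    "seg_cell m u d = LFast \<longleftrightarrow> u \<noteq> 1 \<and> u = 2 * m + 1 - d"
    "seg_cell m u d \<noteq> NewWall" "seg_cell m u d \<noteq> OldWall" "seg_cell m u d \<noteq> Start" "seg_cell m u d \<noteq> Fire"
    "seg_cell m u d \<noteq> LGen" "seg_cell m u d \<noteq> LSlow1" "seg_cell m u d \<noteq> LSlow2" "seg_cell m u d \<noteq> LSlow3"
  using assms unfolding seg_cell_def half_time_def by (auto split: if_splits)

lemma seg_cell_cases:
  assumes "1 \<le> u" "u < half_time m" "1 \<le> d" "d \<le> m"
  obtains "seg_cell m u d = RGen" "u = 1" "d = 1"
  | "seg_cell m u d = RSlow1" "u \<noteq> 1" "u = 3 * d - 2"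
  | "seg_cell m u d = RSlow2" "u \<noteq> 1" "u = 3 * d - 1"
  | "seg_cell m u d = RSlow3" "u \<noteq> 1" "u = 3 * d"
  | "seg_cell m u d = RFast" "u \<noteq> 1" "u = d"
  | "seg_cell m u d = LFast" "u \<noteq> 1" "u = 2 * m + 1 - d"
  | "seg_cell m u d = Blank" "u = 1" "d \<noteq> 1"
  | "seg_cell m u d = Blank" "u \<noteq> 1" "u \<noteq> 3 * d - 2" "u \<noteq> 3 * d - 1" "u \<noteq> 3 * d" "u \<noteq> d" "u \<noteq> 2 * m + 1 - d"
proof -
  have "seg_cell m u d = Blank \<Longrightarrow> u = 1 \<and> d \<noteq> 1 \<or> u \<noteq> 1 \<and> u \<noteq> 3 * d - 2 \<and> u \<noteq> 3 * d - 1 \<and>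
      u \<noteq> 3 * d \<and> u \<noteq> d \<and> u \<noteq> 2 * m + 1 - d"
    using assms unfolding seg_cell_def by (auto split: if_splits)
  note seg_B = this
  show thesis
  proof (cases "seg_cell m u d")
    case RGen
    then show ?thesis using seg_cell_iff(1)[OF assms] that(1) by simp
  next
    case RSlow1
    then show ?thesis using seg_cell_iff(2)[OF assms] that(2) by simp
  next
    case RSlow2
    then show ?thesis using seg_cell_iff(3)[OF assms] that(3) by simp
  next
    case RSlow3
    then show ?thesis using seg_cell_iff(4)[OF assms] that(4) by simp
  next
    case RFast
    then show ?thesis using seg_cell_iff(5)[OF assms] that(5) by simp
  next
    case LFast
    then show ?thesis using seg_cell_iff(6)[OF assms] that(6) by simp
  next
    case Blank
    then consider "u = 1" "d \<noteq> 1" | "u \<noteq> 1" "u \<noteq> 3 * d - 2" "u \<noteq> 3 * d - 1" "u \<noteq> 3 * d" "u \<noteq> d"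
      "u \<noteq> 2 * m + 1 - d" using seg_B by metis
    then show ?thesis using that(7,8) Blank by cases simp_all
  qed (use seg_cell_iff(7-)[OF assms] in simp_all)
qed

lemma mirror_eq_iff: "mirror x = y \<longleftrightarrow> x = mirror y"
  by (cases x; cases y) auto

lemma map_option_mirror_iff: "map_option mirror y = Some z \<longleftrightarrow> y = Some (mirror z)"
  by (cases y) (auto simp: mirror_eq_iff)

lemma half_time_bounds: "2 * half_time m \<le> 3 * m + 2" "3 * m + 1 \<le> 2 * half_time m"
  unfolding half_time_def by auto

lemma mid_bounds: "2 * mid1 m \<le> m + 1" "m \<le> 2 * mid1 m" "mid2 m = m + 1 - mid1 m"
  unfolding mid1_def mid2_def by presburger+

text \<open>Eliminates the divisions, which leaves linear arithmetic.\<close>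

lemma seg_parity:
  obtains q where "m = 2 * q" "half_time m = 3 * q + 1" "mid1 m = q" "mid2 m = q + 1"
  | q where "m = 2 * q + 1" "half_time m = 3 * q + 2" "mid1 m = q + 1" "mid2 m = q + 1"
proof (cases "even m")
  case True
  then obtain q where "m = 2 * q" by blast
  then show ?thesis using that(1) by (simp add: half_time_def mid1_def mid2_def)
next
  case False
  then obtain q where "m = 2 * q + 1" by (rule oddE)
  then show ?thesis using that(2) by (simp add: half_time_def mid1_def mid2_def)
qed

text \<open>\<open>rule1\<close> is not invariant under reflection: a blank cell prefers inputs from
  the left, and \<open>Start\<close> moves only to the left. The mirrored transition is therefore a
  claim of its own.\<close>

lemma seg_step:
  assumes u: "1 \<le> u" "u < half_time m" and d: "1 \<le> d" "d \<le> m"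
    and l: "if d = 1 then l = None \<or> l = Some OldWall else l = Some (seg_cell m u (d - 1))"
    and r: "if d = m then r = None \<or> r = Some OldWall else r = Some (seg_cell m u (d + 1))"
  shows "rule1 l (seg_cell m u d) r = seg_cell m (u + 1) d"
    and "rule1 (map_option mirror r) (mirror (seg_cell m u d)) (map_option mirror l)
      = mirror (seg_cell m (u + 1) d)"
proof -
  have left: "wall l \<longleftrightarrow> d = 1" "wall (map_option mirror l) \<longleftrightarrow> d = 1"
    "l = Some RSlow3 \<longleftrightarrow> d \<noteq> 1 \<and> u \<noteq> 1 \<and> u = 3 * d - 3"
    "l = Some RFast \<longleftrightarrow> d \<noteq> 1 \<and> u \<noteq> 1 \<and> u = d - 1"
    "l = Some RGen \<longleftrightarrow> d = 2 \<and> u = 1"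
    "l \<noteq> Some NewWall" "l \<noteq> Some Start"
    using l seg_cell_iff[OF u, of "d - 1"] d by (auto simp: wall_def mirror_eq_iff split: if_splits)
  have right: "wall r \<longleftrightarrow> d = m" "wall (map_option mirror r) \<longleftrightarrow> d = m"
    "r = Some LFast \<longleftrightarrow> d \<noteq> m \<and> u \<noteq> 1 \<and> u = 2 * m - d"
    "r \<noteq> Some NewWall" "r \<noteq> Some LGen" "r \<noteq> Some LSlow3" "r \<noteq> Some Start"
    using r seg_cell_iff[OF u, of "d + 1"] d by (auto simp: wall_def mirror_eq_iff split: if_splits)
  have u1: "u + 1 \<noteq> 1" using u by simp
  note nxt = seg_cell_def[of m "u + 1" d, unfolded if_not_P[OF u1]]
  \<comment> \<open>A blank cell changes only by an arriving signal: the fast one from cell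
    \<open>d - 1\<close>, the reflected one from cell \<open>d + 1\<close>, or the slow one, which
    spends its last step in cell \<open>d - 1\<close> at time 3(d - 1).\<close>
  have B_next: "seg_cell m (u + 1) d =
      (if u = d - 1 then RFast else if u = 2 * m - d then LFast else if u = 3 * d - 3 then RSlow1 else Blank)"
    if "u \<noteq> 1" "u \<noteq> 3 * d - 2" "u \<noteq> 3 * d - 1" "u \<noteq> 3 * d" "u \<noteq> d" "u \<noteq> 2 * m + 1 - d"
    unfolding nxt using that u d by (cases rule: seg_parity[of m]; smt (verit))
  show "rule1 l (seg_cell m u d) r = seg_cell m (u + 1) d"
  proof (cases rule: seg_cell_cases[OF u d])
    case 1
    show ?thesis unfolding nxt 1(1)
      by (cases rule: seg_parity[of m])
        (use 1(2-) u d in \<open>auto simp: left right; presburger\<close>)+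
  next
    case 2
    show ?thesis unfolding nxt 2(1)
      by (cases rule: seg_parity[of m])
        (use 2(2-) u d in \<open>auto simp: left right; presburger\<close>)+
  next
    case 3
    show ?thesis unfolding nxt 3(1)
      by (cases rule: seg_parity[of m])
        (use 3(2-) u d in \<open>auto simp: left right; presburger\<close>)+
  next
    case 4
    show ?thesis unfolding nxt 4(1)
      by (cases rule: seg_parity[of m])
        (use 4(2-) u d in \<open>auto simp: left right; presburger\<close>)+
  next
    case 5
    show ?thesis unfolding nxt 5(1)
      by (cases rule: seg_parity[of m])
        (use 5(2-) u d in \<open>auto simp: left right; presburger\<close>)+
  next
    case 6
    show ?thesis unfolding nxt 6(1)
      by (cases rule: seg_parity[of m])
        (use 6(2-) u d in \<open>auto simp: left right; presburger\<close>)+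
  next
    case 7
    show ?thesis unfolding nxt 7(1)
      by (cases rule: seg_parity[of m])
        (use 7(2-) u d in \<open>auto simp: left right; presburger\<close>)+
  next
    case 8
    then show ?thesis using B_next u d by (simp add: left right)
  qed
  show "rule1 (map_option mirror r) (mirror (seg_cell m u d)) (map_option mirror l)
      = mirror (seg_cell m (u + 1) d)"
  proof (cases rule: seg_cell_cases[OF u d])
    case 1
    show ?thesis unfolding nxt 1(1)
      by (cases rule: seg_parity[of m])
        (use 1(2-) u d in \<open>auto simp: left right map_option_mirror_iff simp del: map_option_eq_Some; presburger\<close>)+
  next
    case 2
    show ?thesis unfolding nxt 2(1)
      by (cases rule: seg_parity[of m])
        (use 2(2-) u d in \<open>auto simp: left right map_option_mirror_iff simp del: map_option_eq_Some; presburger\<close>)+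
  next
    case 3
    show ?thesis unfolding nxt 3(1)
      by (cases rule: seg_parity[of m])
        (use 3(2-) u d in \<open>auto simp: left right map_option_mirror_iff simp del: map_option_eq_Some; presburger\<close>)+
  next
    case 4
    show ?thesis unfolding nxt 4(1)
      by (cases rule: seg_parity[of m])
        (use 4(2-) u d in \<open>auto simp: left right map_option_mirror_iff simp del: map_option_eq_Some; presburger\<close>)+
  next
    case 5
    show ?thesis unfolding nxt 5(1)
      by (cases rule: seg_parity[of m])
        (use 5(2-) u d in \<open>auto simp: left right map_option_mirror_iff simp del: map_option_eq_Some; presburger\<close>)+
  next
    case 6
    show ?thesis unfolding nxt 6(1)
      by (cases rule: seg_parity[of m])
        (use 6(2-) u d in \<open>auto simp: left right map_option_mirror_iff simp del: map_option_eq_Some; presburger\<close>)+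
  next
    case 7
    show ?thesis unfolding nxt 7(1)
      by (cases rule: seg_parity[of m])
        (use 7(2-) u d in \<open>auto simp: left right map_option_mirror_iff simp del: map_option_eq_Some; presburger\<close>)+
  next
    case 8
    then show ?thesis using B_next u d by (simp add: left right map_option_mirror_iff del: map_option_eq_Some)
  qed
qed

section \<open>All segments in parallel\<close>

text \<open>A cell is labelled \<^term>\<open>None\<close> if it is a wall (or lies outside the line), and
  \<^term>\<open>Some (e, d)\<close> if it is at distance \<^term>\<open>d\<close> from the end of its segment that
  emits the signals; this end is on the left if \<^term>\<open>e\<close> is \<^term>\<open>1\<close> and on the right if it is \<^term>\<open>- 1\<close>.\<close>

definition labelling :: "int \<Rightarrow> (int \<Rightarrow> (int \<times> int) option) \<Rightarrow> bool" where
  "labelling m lab \<longleftrightarrow> (\<forall>x e d. lab x = Some (e, d) \<longrightarrow> (e = 1 \<or> e = -1) \<and> 1 \<le> d \<and> d \<le> m \<and>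
     lab (x + e) = (if d = m then None else Some (e, d + 1)) \<and>
     lab (x - e) = (if d = 1 then None else Some (e, d - 1)))"

text \<open>All segments share the length \<open>m\<close> and the clock \<open>u\<close>; this
  makes them finish simultaneously. An old wall has to border a segment, since between two walls it
  would fire too early.\<close>

definition line_state ::
  "int \<Rightarrow> int \<Rightarrow> (int \<Rightarrow> (int \<times> int) option) \<Rightarrow> (int \<Rightarrow> cell option) \<Rightarrow> bool" where
  "line_state m u lab c \<longleftrightarrow> (\<forall>x. case lab x of
       None \<Rightarrow> c x = None \<or> c x = Some OldWall \<and> (lab (x - 1) \<noteq> None \<or> lab (x + 1) \<noteq> None)
     | Some (e, d) \<Rightarrow> c x = Some (if e = 1 then seg_cell m u d else mirror (seg_cell m u d)))"

lemma line_stateD: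
  assumes "line_state m u lab c"
  shows "lab x = None \<Longrightarrow> c x = None \<or> c x = Some OldWall"
    and "lab x = None \<Longrightarrow> c x = Some OldWall \<Longrightarrow> lab (x - 1) \<noteq> None \<or> lab (x + 1) \<noteq> None"
    and "lab x = Some (1, d) \<Longrightarrow> c x = Some (seg_cell m u d)"
    and "lab x = Some (- 1, d) \<Longrightarrow> c x = Some (mirror (seg_cell m u d))"
  using assms unfolding line_state_def by (auto dest!: spec[of _ x])

lemma labelling_cases:
  assumes "labelling m lab"
  obtains "lab x = None"
  | d where "lab x = Some (1, d)" "1 \<le> d" "d \<le> m"
      "lab (x + 1) = (if d = m then None else Some (1, d + 1))"
      "lab (x - 1) = (if d = 1 then None else Some (1, d - 1))"
  | d where "lab x = Some (- 1, d)" "1 \<le> d" "d \<le> m"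
      "lab (x - 1) = (if d = m then None else Some (- 1, d + 1))"
      "lab (x + 1) = (if d = 1 then None else Some (- 1, d - 1))"
proof (cases "lab x")
  case None
  then show ?thesis using that by blast
next
  case (Some ed)
  obtain e d where ed: "ed = (e, d)" by fastforce
  note * = assms[unfolded labelling_def, rule_format, OF Some[unfolded ed]]
  then consider "e = 1" | "e = - 1" by blast
  then show ?thesis using that(2,3)[of d] * Some ed by cases auto
qed

lemma line_state_step:
  assumes lab: "labelling m lab" and c: "line_state m u lab c" and u: "1 \<le> u" "u < half_time m"
  shows "line_state m (u + 1) lab (line_step c)"
proof -
  note cD = line_stateD[OF c]
  \<comment> \<open>Before \<open>half_time m\<close> there is no wall inside a segment, so the old
    walls do not fire.\<close>
  have nowall: "\<not> wall (c y)" if "lab y \<noteq> None" for y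
    using labelling_cases[OF lab, of y]
  proof cases
    case (2 d)
    then show ?thesis using cD(3)[of y d] seg_cell_iff[OF u 2(2,3)] by (simp add: wall_def)
  next
    case (3 d)
    then show ?thesis using cD(4)[of y d] seg_cell_iff[OF u 3(2,3)]
      by (simp add: wall_def mirror_eq_iff)
  qed (use that in simp)
  have "case lab x of
       None \<Rightarrow> line_step c x = None \<or> line_step c x = Some OldWall \<and> (lab (x - 1) \<noteq> None \<or> lab (x + 1) \<noteq> None)
     | Some (e, d) \<Rightarrow> line_step c x = Some (if e = 1 then seg_cell m (u + 1) d else mirror (seg_cell m (u + 1) d))"
    for x
    using labelling_cases[OF lab, of x]
  proof cases
    case 1
    show ?thesis using cD(1,2)[OF 1] nowall[of "x - 1"] nowall[of "x + 1"] 1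
      by (auto simp: line_step_def)
  next
    case (2 d)
    have "rule1 (c (x - 1)) (seg_cell m u d) (c (x + 1)) = seg_cell m (u + 1) d"
      by (rule seg_step(1)[OF u 2(2,3)]) (use 2 cD in auto)
    then show ?thesis using 2 cD(3)[of x d] by (simp add: line_step_def)
  next
    case (3 d)
    define l where "l = map_option mirror (c (x + 1))"
    define r where "r = map_option mirror (c (x - 1))"
    have mm: "mirror (mirror y) = y" for y using mirror_eq_iff by blast
    then have cc: "c (x + 1) = map_option mirror l" "c (x - 1) = map_option mirror r"
      by (simp_all add: l_def r_def option.map_comp comp_def option.map_ident)
    have "rule1 (map_option mirror r) (mirror (seg_cell m u d)) (map_option mirror l)
        = mirror (seg_cell m (u + 1) d)"
      by (rule seg_step(2)[OF u 3(2,3)])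
        (use 3 cD(1)[of "x + 1"] cD(1)[of "x - 1"] cD(4)[of "x + 1"] cD(4)[of "x - 1"] mm
          in \<open>auto simp: l_def r_def\<close>)
    then show ?thesis using 3 cD(4)[of x d] cc by (simp add: line_step_def)
  qed
  then show ?thesis unfolding line_state_def by blast
qed

text \<open>Signals start at the new walls only, so in the first half the direction is reversed.
  Both halves have length \<open>mid1 m - 1\<close>, because
  \<open>mid2 m = m + 1 - mid1 m\<close>.\<close>

definition halve :: "int \<Rightarrow> (int \<Rightarrow> (int \<times> int) option) \<Rightarrow> int \<Rightarrow> (int \<times> int) option" where
  "halve m lab x = (case lab x of None \<Rightarrow> None | Some (e, d) \<Rightarrow>
     if d < mid1 m then Some (- e, mid1 m - d) else if mid2 m < d then Some (e, d - mid2 m) else None)"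

lemma labelling_halve:
  assumes lab: "labelling m lab"
  shows "labelling (mid1 m - 1) (halve m lab)"
  unfolding labelling_def
proof (intro allI impI)
  note H = mid_bounds[of m]
  fix x e' d' assume h: "halve m lab x = Some (e', d')"
  then obtain e d where ed: "lab x = Some (e, d)" by (auto simp: halve_def split: option.splits)
  note * = lab[unfolded labelling_def, rule_format, OF ed]
  consider "d < mid1 m" "e' = - e" "d' = mid1 m - d" | "\<not> d < mid1 m" "mid2 m < d" "e' = e" "d' = d - mid2 m"
    using h ed by (auto simp: halve_def split: if_splits)
  then show "(e' = 1 \<or> e' = - 1) \<and> 1 \<le> d' \<and> d' \<le> mid1 m - 1 \<and>
       halve m lab (x + e') = (if d' = mid1 m - 1 then None else Some (e', d' + 1)) \<and>
       halve m lab (x - e') = (if d' = 1 then None else Some (e', d' - 1))"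
  proof cases
    case 1
    then show ?thesis using * H by (auto simp: halve_def)
  next
    case 2
    then show ?thesis using * H by (auto simp: halve_def)
  qed
qed

lemma line_state_half_time:
  assumes "labelling m lab" "line_state m (half_time m) lab c" "lab x = Some (e, d)"
  shows "c x = Some (if d = mid1 m \<or> d = mid2 m then NewWall else Blank)"
proof -
  have "1 \<le> d \<and> d \<le> m" using assms(1,3) unfolding labelling_def by blast
  then have "half_time m \<noteq> 1" using half_time_bounds[of m] by auto
  then show ?thesis using assms(2,3) unfolding line_state_def by (auto simp: seg_cell_def dest!: spec[of _ x])
qed

text \<open>For \<open>m \<ge> 3\<close> the halves are non-empty, so every wall still has a blank
  neighbour and becomes an old wall instead of firing.\<close>

lemma line_state_halve:
  assumes lab: "labelling m lab" and c: "line_state m (half_time m) lab c" and m: "3 \<le> m"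
  shows "line_state (mid1 m - 1) 1 (halve m lab) (line_step c)"
proof -
  note cD = line_stateD[OF c]
  note cH = line_state_half_time[OF lab c]
  note H = mid_bounds[of m]
  have go: "line_step c x = Some OldWall" if "c x = Some NewWall \<or> c x = Some OldWall" "c (x - 1) = Some Blank \<or> c (x + 1) = Some Blank" for x
    using that by (auto simp: line_step_def wall_def)
  have "case halve m lab x of
       None \<Rightarrow> line_step c x = None \<or> line_step c x = Some OldWall \<and>
          (halve m lab (x - 1) \<noteq> None \<or> halve m lab (x + 1) \<noteq> None)
     | Some (e, d) \<Rightarrow> line_step c x = Some (if e = 1 then seg_cell (mid1 m - 1) 1 d
          else mirror (seg_cell (mid1 m - 1) 1 d))" for x
    using labelling_cases[OF lab, of x]
  proof cases
    case 1
    have h: "halve m lab x = None" using 1 by (simp add: halve_def)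
    \<comment> \<open>A segment cell next to a wall is at an end of its segment, hence no middle
      cell when \<open>m \<ge> 3\<close>.\<close>
    have "c y = Some Blank \<and> halve m lab y \<noteq> None" if y: "lab y \<noteq> None" "y = x - 1 \<or> y = x + 1" for y
    proof -
      obtain e d where ed: "lab y = Some (e, d)" using y(1) by (cases "lab y") auto
      have "lab (y + 1) = None \<or> lab (y - 1) = None" using y(2) 1 by auto
      moreover have "(e = 1 \<or> e = - 1) \<and> lab (y + e) = (if d = m then None else Some (e, d + 1)) \<and>
          lab (y - e) = (if d = 1 then None else Some (e, d - 1))"
        using lab ed unfolding labelling_def by blast
      ultimately have "d = 1 \<or> d = m" by (auto split: if_splits)
      then show ?thesis using cH[OF ed] ed H m by (auto simp: halve_def)
    qed
    then have "line_step c x = Some OldWall \<and> (halve m lab (x - 1) \<noteq> None \<or> halve m lab (x + 1) \<noteq> None)"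
      if "c x = Some OldWall" using cD(2)[OF 1 that] go that by blast
    then show ?thesis using cD(1)[OF 1] h by (auto simp: line_step_def)
  next
    case (2 d)
    consider "d < mid1 m" | "d = mid1 m" | "mid1 m < d" "d = mid2 m" | "mid2 m < d"
      using H by linarith
    then show ?thesis
    proof cases
      case 1
      have "c (x - 1) \<in> {None, Some OldWall, Some Blank}"
        using 2 1 cD(1)[of "x - 1"] cH[of "x - 1" 1 "d - 1"] H by (auto split: if_splits)
      moreover have "c (x + 1) = Some (if d + 1 = mid1 m then NewWall else Blank)"
        using 2 1 cH[of "x + 1" 1 "d + 1"] H by (auto split: if_splits)
      moreover have "c x = Some Blank" using cH[OF 2(1)] 1 H by auto
      ultimately have "line_step c x = Some (if d + 1 = mid1 m then LGen else Blank)"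
        by (auto simp: line_step_def)
      then show ?thesis using 2 1 by (auto simp: halve_def seg_cell_def)
    next
      case h2: 2
      have "c (x - 1) = Some Blank" "halve m lab (x - 1) \<noteq> None"
        using 2 h2 cH[of "x - 1" 1 "d - 1"] H m by (auto simp: halve_def split: if_splits)
      then show ?thesis using 2 h2 go[of x] cH[OF 2(1)] H by (auto simp: halve_def)
    next
      case 3
      have "c (x + 1) = Some Blank" "halve m lab (x + 1) \<noteq> None"
        using 2 3 cH[of "x + 1" 1 "d + 1"] H m by (auto simp: halve_def split: if_splits)
      then show ?thesis using 2 3 go[of x] cH[OF 2(1)] H by (auto simp: halve_def)
    next
      case 4
      have "c (x + 1) \<in> {None, Some OldWall, Some Blank}"
        using 2 4 cD(1)[of "x + 1"] cH[of "x + 1" 1 "d + 1"] H by (auto split: if_splits)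
      moreover have "c (x - 1) = Some (if d - 1 = mid2 m then NewWall else Blank)"
        using 2 4 cH[of "x - 1" 1 "d - 1"] H by (auto split: if_splits)
      moreover have "c x = Some Blank" using cH[OF 2(1)] 4 H by auto
      ultimately have "line_step c x = Some (if d - 1 = mid2 m then RGen else Blank)"
        by (auto simp: line_step_def)
      then show ?thesis using 2 4 H by (auto simp: halve_def seg_cell_def)
    qed
  next
    case (3 d)
    consider "d < mid1 m" | "d = mid1 m" | "mid1 m < d" "d = mid2 m" | "mid2 m < d"
      using H by linarith
    then show ?thesis
    proof cases
      case 1
      have "c (x + 1) \<in> {None, Some OldWall, Some Blank}"
        using 3 1 cD(1)[of "x + 1"] cH[of "x + 1" "- 1" "d - 1"] H by (auto split: if_splits)
      moreover have "c (x - 1) = Some (if d + 1 = mid1 m then NewWall else Blank)"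
        using 3 1 cH[of "x - 1" "- 1" "d + 1"] H by (auto split: if_splits)
      moreover have "c x = Some Blank" using cH[OF 3(1)] 1 H by auto
      ultimately have "line_step c x = Some (if d + 1 = mid1 m then RGen else Blank)"
        by (auto simp: line_step_def)
      then show ?thesis using 3 1 by (auto simp: halve_def seg_cell_def)
    next
      case 2
      have "c (x + 1) = Some Blank" "halve m lab (x + 1) \<noteq> None"
        using 3 2 cH[of "x + 1" "- 1" "d - 1"] H m by (auto simp: halve_def split: if_splits)
      then show ?thesis using 3 2 go[of x] cH[OF 3(1)] H by (auto simp: halve_def)
    next
      case h3: 3
      have "c (x - 1) = Some Blank" "halve m lab (x - 1) \<noteq> None"
        using 3 h3 cH[of "x - 1" "- 1" "d + 1"] H m by (auto simp: halve_def split: if_splits)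
      then show ?thesis using 3 h3 go[of x] cH[OF 3(1)] H by (auto simp: halve_def)
    next
      case 4
      have "c (x - 1) \<in> {None, Some OldWall, Some Blank}"
        using 3 4 cD(1)[of "x - 1"] cH[of "x - 1" "- 1" "d + 1"] H by (auto split: if_splits)
      moreover have "c (x + 1) = Some (if d - 1 = mid2 m then NewWall else Blank)"
        using 3 4 cH[of "x + 1" "- 1" "d - 1"] H by (auto split: if_splits)
      moreover have "c x = Some Blank" using cH[OF 3(1)] 4 H by auto
      ultimately have "line_step c x = Some (if d - 1 = mid2 m then LGen else Blank)"
        by (auto simp: line_step_def)
      then show ?thesis using 3 4 H by (auto simp: halve_def seg_cell_def)
    qed
  qed
  then show ?thesis unfolding line_state_def by blast
qed

lemma seg_cell_not_Fire: "seg_cell m u d \<noteq> Fire"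
proof -
  have if_ne: "x \<noteq> z \<Longrightarrow> y \<noteq> z \<Longrightarrow> (if b then x else y) \<noteq> z" for b and x y z :: cell by simp
  show ?thesis unfolding seg_cell_def by (intro if_ne) simp_all
qed

lemma line_state_not_Fire:
  assumes "line_state m u lab c"
  shows "c x \<noteq> Some Fire"
proof (cases "lab x")
  case None
  then show ?thesis using line_stateD(1)[OF assms, of x] by auto
next
  case (Some ed)
  obtain e d where ed: "ed = (e, d)" by fastforce
  have "c x = Some (if e = 1 then seg_cell m u d else mirror (seg_cell m u d))"
    using assms Some ed unfolding line_state_def by (auto dest!: spec[of _ x])
  moreover have "mirror (seg_cell m u d) \<noteq> Fire"
    using seg_cell_not_Fire[of m u d] mirror_eq_iff[of _ Fire] by simp
  ultimately show ?thesis using seg_cell_not_Fire[of m u d] by auto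
qed

text \<open>Segments of length at most two consist of middle cells, so all of them fill with walls
  at the same moment.\<close>

lemma line_state_fire:
  assumes lab: "labelling m lab" and c: "line_state m (half_time m) lab c" and m: "m \<le> 2"
    and x: "c x \<noteq> None"
  shows "line_step c x = Some Fire"
proof -
  have "wall (c y)" for y
  proof (cases "lab y")
    case None
    then show ?thesis using line_stateD(1)[OF c None] by (auto simp: wall_def)
  next
    case (Some ed)
    obtain e d where ed: "ed = (e, d)" by fastforce
    have "1 \<le> d \<and> d \<le> m" using lab Some ed unfolding labelling_def by blast
    then show ?thesis using line_state_half_time[OF lab c Some[unfolded ed]] m mid_bounds[of m]
      by (auto simp: wall_def)
  qed
  note walls = this
  obtain a where a: "c x = Some a" using x by blast
  then have "a = NewWall \<or> a = OldWall" using walls[of x] by (auto simp: wall_def)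
  then show ?thesis using a walls by (auto simp: line_step_def)
qed

lemma line_state_steps:
  assumes "labelling m lab" "line_state m 1 lab c" "int k < half_time m"
  shows "line_state m (1 + int k) lab ((line_step ^^ k) c)"
  using assms(3)
proof (induction k)
  case (Suc k)
  then show ?case using line_state_step[OF assms(1), of "1 + int k" "(line_step ^^ k) c"]
    by (simp add: algebra_simps)
qed (use assms in simp)

lemma line_state_synchronises:
  assumes "1 \<le> m" "labelling m lab" "line_state m 1 lab c"
  shows "\<exists>t. (\<forall>u<t. \<forall>x. (line_step ^^ u) c x \<noteq> Some Fire) \<and>
    (\<forall>x. c x \<noteq> None \<longrightarrow> (line_step ^^ t) c x = Some Fire)"
  using assms
proof (induction "nat m" arbitrary: m lab c rule: less_induct)
  case less
  \<comment> \<open>The clock \<open>u\<close> starts at 1, so \<open>half_time m\<close> is reached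
    one step earlier; the step after that is time 1 of the halves.\<close>
  define h where "h = nat (half_time m) - 1"
  have "1 < half_time m" using half_time_bounds[of m] less.prems(1) by auto
  then have h: "1 + int h = half_time m" by (simp add: h_def)
  have st: "line_state m (1 + int k) lab ((line_step ^^ k) c)" if "k \<le> h" for k
    using line_state_steps[OF less.prems(2,3)] that h by simp
  let ?c = "(line_step ^^ h) c"
  have end_st: "line_state m (half_time m) lab ?c" using st[of h] h by simp
  have noF: "(line_step ^^ k) c x \<noteq> Some Fire" if "k \<le> h" for k x
    using line_state_not_Fire[OF st[OF that]] .
  have dom: "(line_step ^^ k) c x = None \<longleftrightarrow> c x = None" for k x
    by (induction k) (auto simp: line_step_def)
  show ?case
  proof (cases "3 \<le> m")
    case True
    let ?m = "mid1 m - 1"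
    have "line_state ?m 1 (halve m lab) (line_step ?c)"
      using line_state_halve[OF less.prems(2) end_st True] .
    moreover have "1 \<le> ?m" "nat ?m < nat m" using mid_bounds[of m] True by auto
    ultimately obtain t where t:
      "\<And>u x. u < t \<Longrightarrow> (line_step ^^ u) (line_step ?c) x \<noteq> Some Fire"
      "\<And>x. line_step ?c x \<noteq> None \<Longrightarrow> (line_step ^^ t) (line_step ?c) x = Some Fire"
      using less.hyps[OF _ _ labelling_halve[OF less.prems(2)]] by meson
    have eq: "(line_step ^^ (u + Suc h)) c = (line_step ^^ u) (line_step ?c)" for u
      by (simp only: funpow_add comp_def) simp
    have "(line_step ^^ u) c x \<noteq> Some Fire" if "u < t + Suc h" for u x
    proof (cases "u \<le> h")
      case False
      then show ?thesis using t(1)[of "u - Suc h" x] eq[of "u - Suc h"] that by simp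
    qed (rule noF)
    moreover have "(line_step ^^ (t + Suc h)) c x = Some Fire" if "c x \<noteq> None" for x
      unfolding eq by (rule t(2)) (use that dom[of "Suc h" x] in simp)
    ultimately show ?thesis by blast
  next
    case False
    have "(line_step ^^ Suc h) c x = Some Fire" if "c x \<noteq> None" for x
      using line_state_fire[OF less.prems(2) end_st, of x] False that dom[of h x] by simp
    then show ?thesis using noF by (intro exI[of _ "Suc h"]) (auto simp: less_Suc_eq_le)
  qed
qed

section \<open>A line with the general at an inner cell\<close>

definition line_init :: "int \<Rightarrow> int \<Rightarrow> int \<Rightarrow> cell option" where
  "line_init r s x = (if r \<le> x \<and> x \<le> s then Some (if x = 0 then Start else Blank) else None)"

lemma line_init_steps:
  assumes "r \<le> 0" "0 \<le> s" "int k \<le> - r"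
  shows "(line_step ^^ k) (line_init r s) x =
    (if r \<le> x \<and> x \<le> s then Some (if x = - int k then Start else Blank) else None)"
  using assms(3)
proof (induction k arbitrary: x)
  case (Suc k)
  then show ?case using assms(1,2) by (auto simp: line_step_def)
qed (simp add: line_init_def)

text \<open>After \<open>- r\<close> steps \<open>Start\<close> is at the left end, and one step
  later it is a generator. The whole line is then one segment, with the ends of the line as its
  walls.\<close>

lemma line_synchronises:
  assumes "r \<le> 0" "0 \<le> s"
  shows "\<exists>t. (\<forall>u<t. \<forall>x. (line_step ^^ u) (line_init r s) x \<noteq> Some Fire) \<and>
    (\<forall>x. r \<le> x \<longrightarrow> x \<le> s \<longrightarrow> (line_step ^^ t) (line_init r s) x = Some Fire)"
proof -
  define k where "k = nat (- r)"
  have k: "int k = - r" using assms by (simp add: k_def)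
  let ?m = "s - r + 1"
  define lab where "lab x = (if r \<le> x \<and> x \<le> s then Some (1 :: int, x - r + 1) else None)" for x
  let ?c = "(line_step ^^ Suc k) (line_init r s)"
  have c: "?c x = (if r \<le> x \<and> x \<le> s then Some (if x = r then RGen else Blank) else None)" for x
    using assms k by (auto simp: line_step_def line_init_steps)
  have "labelling ?m lab" by (auto simp: labelling_def lab_def split: if_splits)
  moreover have "line_state ?m 1 lab ?c"
    unfolding line_state_def using c by (auto simp: lab_def seg_cell_def)
  ultimately obtain t where t: "\<And>u x. u < t \<Longrightarrow> (line_step ^^ u) ?c x \<noteq> Some Fire"
    "\<And>x. ?c x \<noteq> None \<Longrightarrow> (line_step ^^ t) ?c x = Some Fire"
    using line_state_synchronises[of ?m lab ?c] assms by auto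
  have eq: "(line_step ^^ (u + Suc k)) (line_init r s) = (line_step ^^ u) ?c" for u
    by (simp only: funpow_add comp_def)
  have "(line_step ^^ u) (line_init r s) x \<noteq> Some Fire" if "u < t + Suc k" for u x
  proof (cases "u \<le> k")
    case True
    then show ?thesis using line_init_steps[OF assms, of u x] k by auto
  next
    case False
    then show ?thesis using t(1)[of "u - Suc k" x] eq[of "u - Suc k"] that by simp
  qed
  moreover have "(line_step ^^ (t + Suc k)) (line_init r s) x = Some Fire" if "r \<le> x" "x \<le> s" for x
    unfolding eq by (rule t(2)) (use that c in simp)
  ultimately show ?thesis by blast
qed

section \<open>Automata over arbitrary types\<close>

definition nbrs :: "pos set \<Rightarrow> (pos \<Rightarrow> 'q) \<Rightarrow> pos \<Rightarrow> nat \<Rightarrow> 'q option" where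
  "nbrs S f q k = (if k < 4 \<and> shift q k \<in> S then Some (f (shift q k)) else None)"

fun grun :: "(bool \<times> bool \<times> bool \<times> bool \<Rightarrow> 'q) \<Rightarrow> 'q \<Rightarrow> ('q \<Rightarrow> (nat \<Rightarrow> 'q option) \<Rightarrow> 'q)
    \<Rightarrow> pos set \<Rightarrow> nat \<Rightarrow> pos \<Rightarrow> 'q" where
  "grun ini q0 stp S 0 = (\<lambda>q. if q = (0,0) then ini (bc S (0,0)) else q0)"
| "grun ini q0 stp S (Suc t) = (\<lambda>q. stp (grun ini q0 stp S t q) (nbrs S (grun ini q0 stp S t) q))"

text \<open>The condition concerns the states met in a run, not closure under \<open>stp\<close>.
  The step function of an automaton that stores positions may leave the finite set \<open>St\<close>
  on arbitrary inputs, although its runs on paths stay inside.\<close>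

lemma ex_fsa:
  fixes ini :: "bool \<times> bool \<times> bool \<times> bool \<Rightarrow> 'q"
  assumes fin: "finite St" and q0: "q0 \<in> St" "q0 \<notin> Fi" and ini: "\<And>b. ini b \<in> St"
    and quiet: "\<And>nb. (\<And>k. nb k \<in> {None, Some q0}) \<Longrightarrow> stp q0 nb = q0"
  shows "\<exists>A. wf_fsa A \<and> (\<forall>S t. (\<forall>u\<le>t. \<forall>q\<in>S. grun ini q0 stp S u q \<in> St) \<longrightarrow>
    (\<forall>q\<in>S. run A S t q \<in> firing A \<longleftrightarrow> grun ini q0 stp S t q \<in> Fi))"
proof -
  obtain enc :: "'q \<Rightarrow> nat" where inj: "inj_on enc St"
    using finite_imp_inj_to_nat_seg[OF fin] by blast
  define dec where "dec = inv_into St enc"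
  have dec: "dec (enc x) = x" if "x \<in> St" for x
    using inj that by (simp add: dec_def)
  define inputs :: "nat option \<Rightarrow> nat option \<Rightarrow> nat option \<Rightarrow> nat option \<Rightarrow> nat \<Rightarrow> 'q option"
    where "inputs y0 y1 y2 y3 k = map_option dec
      (if k = 0 then y0 else if k = 1 then y1 else if k = 2 then y2 else if k = 3 then y3 else None)"
    for y0 y1 y2 y3 k
  \<comment> \<open>Transitions leaving \<^term>\<open>St\<close> are redirected to \<^term>\<open>q0\<close>, so that \<^term>\<open>St\<close> need not be closed under \<^term>\<open>stp\<close>.\<close>
  define nxt where "nxt x nb = (if stp x nb \<in> St then stp x nb else q0)" for x nb
  \<comment> \<open>There is one general state per boundary condition, numbered by
    \<open>to_nat\<close>, so that the initial state can depend on the whole boundary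
    condition.\<close>
  define A where "A = \<lparr>states = enc ` St, quiescent = enc q0,
    ngen = Suc (Max (range (to_nat :: bool \<times> bool \<times> bool \<times> bool \<Rightarrow> nat))),
    gen = (\<lambda>k. enc (ini (from_nat k))), firing = enc ` (Fi \<inter> St), tau = to_nat,
    delta = (\<lambda>x y0 y1 y2 y3. enc (nxt (dec x) (inputs y0 y1 y2 y3)))\<rparr>"
  have nxt_St: "nxt x nb \<in> St" for x nb using q0 by (simp add: nxt_def)
  have enc_Fi: "enc x \<in> enc ` (Fi \<inter> St) \<longleftrightarrow> x \<in> Fi" if "x \<in> St" for x
    using inj that by (auto dest: inj_onD)
  have quiet': "nxt q0 (inputs y0 y1 y2 y3) = q0"
    if "{y0, y1, y2, y3} \<subseteq> {None, Some (enc q0)}" for y0 y1 y2 y3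
  proof -
    have "inputs y0 y1 y2 y3 k \<in> {None, Some q0}" for k
      using that dec[OF q0(1)] by (auto simp: inputs_def)
    then have "stp q0 (inputs y0 y1 y2 y3) = q0" by (rule quiet)
    then show ?thesis by (simp add: nxt_def)
  qed
  have wf: "wf_fsa A"
    unfolding wf_fsa_def
  proof (intro conjI allI ballI impI)
    show "tau A b < ngen A" for b by (simp add: A_def less_Suc_eq_le)
    show "quiescent A \<notin> firing A" using enc_Fi q0 by (simp add: A_def)
    show "delta A (quiescent A) y0 y1 y2 y3 = quiescent A"
      if "{y0, y1, y2, y3} \<subseteq> {None, Some (quiescent A)}" for y0 y1 y2 y3
      using quiet' that dec[OF q0(1)] by (simp add: A_def)
  qed (use fin q0 ini nxt_St in \<open>auto simp: A_def\<close>)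
  have run: "run A S t q \<in> firing A \<longleftrightarrow> grun ini q0 stp S t q \<in> Fi"
    if St: "\<And>u q. u \<le> t \<Longrightarrow> q \<in> S \<Longrightarrow> grun ini q0 stp S u q \<in> St" and q: "q \<in> S" for S t q
  proof -
    have "run A S u q = enc (grun ini q0 stp S u q)" if "u \<le> t" "q \<in> S" for u q
      using that
    proof (induction u arbitrary: q)
      case 0
      then show ?case by (simp add: A_def)
    next
      case (Suc u)
      let ?g = "grun ini q0 stp S u"
      have IH: "run A S u q' = enc (?g q')" if "q' \<in> S" for q' using Suc that by simp
      let ?y = "\<lambda>k. if shift q k \<in> S then Some (run A S u (shift q k)) else None"
      have y: "dec (run A S u q') = ?g q'" if "q' \<in> S" for q'
        unfolding IH[OF that] by (rule dec, rule St) (use Suc.prems that in auto)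
      have "inputs (?y 0) (?y 1) (?y 2) (?y 3) k = nbrs S ?g q k" for k
        by (cases "k < 4") (auto dest!: less_4_cases simp: inputs_def nbrs_def y)
      then have inputs: "inputs (?y 0) (?y 1) (?y 2) (?y 3) = nbrs S ?g q" by blast
      have "run A S (Suc u) q = enc (nxt (dec (run A S u q)) (inputs (?y 0) (?y 1) (?y 2) (?y 3)))"
        unfolding run_Suc by (simp add: A_def)
      also have "\<dots> = enc (nxt (?g q) (nbrs S ?g q))"
        unfolding y[OF Suc.prems(2)] inputs ..
      also have "nxt (?g q) (nbrs S ?g q) = grun ini q0 stp S (Suc u) q"
        using St[OF Suc.prems] by (simp add: nxt_def)
      finally show ?case .
    qed
    from this[OF order_refl q] have "run A S t q \<in> firing A \<longleftrightarrow> enc (grun ini q0 stp S t q) \<in> enc ` (Fi \<inter> St)"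
      by (simp add: A_def)
    then show ?thesis unfolding enc_Fi[OF St[OF order_refl q]] .
  qed
  show ?thesis by (intro exI[of _ A] conjI wf allI impI ballI run) blast+
qed

section \<open>Synchronising paths in the plane\<close>

definition dirp :: "pos \<Rightarrow> pos \<Rightarrow> nat" where
  "dirp q q' = (THE k. k < 4 \<and> shift q k = q')"

lemma dirp_eq: "k < 4 \<Longrightarrow> dirp q (shift q k) = k"
  unfolding dirp_def by (rule the_equality) (auto dest: shift_inj)

lemma adj_dirp:
  assumes "adj q q'"
  shows "dirp q q' < 4" "shift q (dirp q q') = q'" "dirp q' q = opp (dirp q q')"
proof -
  obtain k where k: "k < 4" "q' = shift q k" using assms unfolding adj_def by blast
  then show "dirp q q' < 4" "shift q (dirp q q') = q'" by (simp_all add: dirp_eq)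
  show "dirp q' q = opp (dirp q q')"
    using k dirp_eq[OF opp_less, of q' k] by (simp add: dirp_eq shift_opp)
qed

definition left_port :: "int \<Rightarrow> (int \<Rightarrow> pos) \<Rightarrow> int \<Rightarrow> nat option" where
  "left_port r p l = (if r < l then Some (dirp (p l) (p (l - 1))) else None)"

definition right_port :: "int \<Rightarrow> (int \<Rightarrow> pos) \<Rightarrow> int \<Rightarrow> nat option" where
  "right_port s p l = (if l < s then Some (dirp (p l) (p (l + 1))) else None)"

lemma nbrs_path:
  assumes p: "g2path r s p" and l: "r \<le> l" "l \<le> s"
  shows "r < l \<Longrightarrow> nbrs (p ` {r..s}) f (p l) (dirp (p l) (p (l - 1))) = Some (f (p (l - 1)))"
    and "l < s \<Longrightarrow> nbrs (p ` {r..s}) f (p l) (dirp (p l) (p (l + 1))) = Some (f (p (l + 1)))"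
    and "nbrs (p ` {r..s}) f (p l) k = Some y \<Longrightarrow>
      (r < l \<and> k = dirp (p l) (p (l - 1)) \<and> y = f (p (l - 1))) \<or>
      (l < s \<and> k = dirp (p l) (p (l + 1)) \<and> y = f (p (l + 1)))"
proof -
  show "nbrs (p ` {r..s}) f (p l) (dirp (p l) (p (l - 1))) = Some (f (p (l - 1)))" if "r < l"
    using adj_dirp[OF g2pathD(6)[OF p that l(2)]] that l by (auto simp: nbrs_def)
  show "nbrs (p ` {r..s}) f (p l) (dirp (p l) (p (l + 1))) = Some (f (p (l + 1)))" if "l < s"
    using adj_dirp[OF g2pathD(5)[OF p l(1) that]] that l by (auto simp: nbrs_def)
  assume "nbrs (p ` {r..s}) f (p l) k = Some y"
  then have k: "k < 4" "shift (p l) k \<in> p ` {r..s}" "y = f (shift (p l) k)"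
    by (auto simp: nbrs_def split: if_splits)
  then show "(r < l \<and> k = dirp (p l) (p (l - 1)) \<and> y = f (p (l - 1))) \<or>
      (l < s \<and> k = dirp (p l) (p (l + 1)) \<and> y = f (p (l + 1)))"
    using g2path_nbr[OF p l k(1)] dirp_eq[OF k(1), of "p l"] by metis
qed

lemma dirp_distinct:
  assumes p: "g2path r s p" and l: "r < l" "l < s"
  shows "dirp (p l) (p (l - 1)) \<noteq> dirp (p l) (p (l + 1))"
proof
  assume eq: "dirp (p l) (p (l - 1)) = dirp (p l) (p (l + 1))"
  have "shift (p l) (dirp (p l) (p (l - 1))) = p (l - 1)"
    by (rule adj_dirp(2), rule g2pathD(6)[OF p]) (use l in auto)
  moreover have "shift (p l) (dirp (p l) (p (l + 1))) = p (l + 1)"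
    by (rule adj_dirp(2), rule g2pathD(5)[OF p]) (use l in auto)
  ultimately have "p (l - 1) = p (l + 1)" using eq by argo
  then show False using g2pathD(4)[OF p, of "l - 1" "l + 1"] l by simp
qed

section \<open>Orienting the path by ports\<close>

definition least_dir :: "(nat \<Rightarrow> bool) \<Rightarrow> nat option" where
  "least_dir P = (if \<exists>k<4. P k then Some (LEAST k. k < 4 \<and> P k) else None)"

lemma least_dir_Some:
  assumes "k < 4" "P k" "\<And>k'. k' < 4 \<Longrightarrow> P k' \<Longrightarrow> k \<le> k'"
  shows "least_dir P = Some k"
proof -
  have "(LEAST k. k < 4 \<and> P k) = k" by (rule Least_equality) (use assms in auto)
  then show ?thesis using assms(1,2) by (auto simp: least_dir_def)
qed

lemma least_dir_None: "(\<And>k. k < 4 \<Longrightarrow> \<not> P k) \<Longrightarrow> least_dir P = None"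
  by (auto simp: least_dir_def)

lemma least_dir_in: "least_dir P \<in> insert None (Some ` {..<4})"
proof (cases "\<exists>k<4. P k")
  case True
  then have "(LEAST k. k < 4 \<and> P k) < 4" by (metis (mono_tags, lifting) LeastI_ex)
  then show ?thesis by (simp add: least_dir_def)
qed (auto simp: least_dir_def)

text \<open>An awake node stores the directions of its left and right neighbour and a cell of the line
  automaton; \<^term>\<open>None\<close> is a node not yet reached by the general, and acts as a blank cell.\<close>

type_synonym node = "(nat option \<times> nat option \<times> cell) option"

fun node_cell :: "node \<Rightarrow> cell" where
  "node_cell None = Blank"
| "node_cell (Some (lp, rp, a)) = a"

fun port_input :: "(nat \<Rightarrow> node option) \<Rightarrow> nat option \<Rightarrow> cell option" where
  "port_input nb None = None"
| "port_input nb (Some k) = map_option node_cell (nb k)"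

text \<open>An absent node is \<open>None\<close> and a sleeping one \<open>Some None\<close>, so a
  sleeping neighbour is found as well.\<close>

definition other_port :: "(nat \<Rightarrow> node option) \<Rightarrow> nat \<Rightarrow> nat option" where
  "other_port nb k = least_dir (\<lambda>k'. k' \<noteq> k \<and> nb k' \<noteq> None)"

text \<open>The neighbour in direction \<open>k\<close> points back to this node through its right
  port, so it is the left neighbour.\<close>

definition from_left :: "(nat \<Rightarrow> node option) \<Rightarrow> nat \<Rightarrow> bool" where
  "from_left nb k \<longleftrightarrow> (\<exists>lp a. nb k = Some (Some (lp, Some (opp k), a)))"

definition from_right :: "(nat \<Rightarrow> node option) \<Rightarrow> nat \<Rightarrow> bool" where
  "from_right nb k \<longleftrightarrow> (\<exists>rp a. nb k = Some (Some (Some (opp k), rp, a)))"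

definition node_ports :: "(nat \<Rightarrow> node option) \<Rightarrow> (nat option \<times> nat option) option" where
  "node_ports nb = (case least_dir (from_left nb) of
       Some k \<Rightarrow> Some (Some k, other_port nb k)
     | None \<Rightarrow> (case least_dir (from_right nb) of
         Some k \<Rightarrow> Some (other_port nb k, Some k)
       | None \<Rightarrow> None))"

fun node_step :: "node \<Rightarrow> (nat \<Rightarrow> node option) \<Rightarrow> node" where
  "node_step (Some (lp, rp, a)) nb = Some (lp, rp, rule1 (port_input nb lp) a (port_input nb rp))"
| "node_step None nb = map_option
     (\<lambda>(lp, rp). (lp, rp, rule1 (port_input nb lp) Blank (port_input nb rp))) (node_ports nb)"

fun bit4 :: "bool \<times> bool \<times> bool \<times> bool \<Rightarrow> nat \<Rightarrow> bool" where
  "bit4 (b0, b1, b2, b3) k = (if k = 0 then b0 else if k = 1 then b1 else if k = 2 then b2 else b3)"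

lemma bit4_bc: "k < 4 \<Longrightarrow> bit4 (bc S q) k \<longleftrightarrow> shift q k \<in> S"
  by (auto simp: bc_def dest!: less_4_cases)

text \<open>The general cannot know the orientation of the path. It calls its smaller direction left
  and the other one right; a single neighbour always becomes the left one.\<close>

definition node_init :: "bool \<times> bool \<times> bool \<times> bool \<Rightarrow> node" where
  "node_init b = Some (least_dir (bit4 b), least_dir (\<lambda>k. bit4 b k \<and> Some k \<noteq> least_dir (bit4 b)), Start)"

abbreviation node_run :: "pos set \<Rightarrow> nat \<Rightarrow> pos \<Rightarrow> node" where
  "node_run \<equiv> grun node_init None node_step"

text \<open>The choice of the general may contradict the indexing. The second outcome is the first
  one for the reversed path.\<close>

lemma node_init_oriented:
  assumes p: "g2path r s p"
  shows "node_init (bc (p ` {r..s}) (0,0)) = Some (left_port r p 0, right_port s p 0, Start) \<or>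
    node_init (bc (p ` {r..s}) (0,0)) = Some (right_port s p 0, left_port r p 0, Start)"
proof -
  note D = g2pathD[OF p]
  let ?b = "bit4 (bc (p ` {r..s}) (0,0))"
  let ?L = "dirp (p 0) (p (- 1))" and ?R = "dirp (p 0) (p 1)"
  have b: "?b k \<longleftrightarrow> (r < 0 \<and> k = ?L) \<or> (0 < s \<and> k = ?R)" if k: "k < 4" for k
  proof -
    have "?b k \<longleftrightarrow> shift (p 0) k \<in> p ` {r..s}" using bit4_bc[OF k] D(3) by simp
    also have "\<dots> \<longleftrightarrow> (0 < s \<and> shift (p 0) k = p 1) \<or> (r < 0 \<and> shift (p 0) k = p (- 1))"
      using g2path_nbr[OF p D(1,2) k] by simp
    also have "\<dots> \<longleftrightarrow> (r < 0 \<and> k = ?L) \<or> (0 < s \<and> k = ?R)"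
      using dirp_eq[OF k, of "p 0"] adj_dirp(2)[OF D(5)[of 0]] adj_dirp(2)[OF D(6)[of 0]] D(1,2) by auto
    finally show ?thesis .
  qed
  have L4: "?L < 4" if "r < 0" using adj_dirp(1)[OF D(6)[of 0]] that D(2) by simp
  have R4: "?R < 4" if "0 < s" using adj_dirp(1)[OF D(5)[of 0]] that D(1) by simp
  consider "\<not> r < 0" "\<not> 0 < s" | "r < 0" "\<not> 0 < s" | "\<not> r < 0" "0 < s" | "r < 0" "0 < s" by blast
  then show ?thesis
  proof cases
    case 1
    have "least_dir ?b = None" "least_dir (\<lambda>k. ?b k \<and> Some k \<noteq> least_dir ?b) = None"
      by (rule least_dir_None, use b 1 in blast)+
    then show ?thesis using 1 by (simp add: node_init_def left_port_def right_port_def)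
  next
    case 2
    have f: "least_dir ?b = Some ?L" by (rule least_dir_Some) (use b L4 2 in auto)
    have "least_dir (\<lambda>k. ?b k \<and> Some k \<noteq> least_dir ?b) = None"
      unfolding f by (rule least_dir_None) (use b 2 in auto)
    then show ?thesis using 2 f by (simp add: node_init_def left_port_def right_port_def)
  next
    case 3
    have f: "least_dir ?b = Some ?R" by (rule least_dir_Some) (use b R4 3 in auto)
    have "least_dir (\<lambda>k. ?b k \<and> Some k \<noteq> least_dir ?b) = None"
      unfolding f by (rule least_dir_None) (use b 3 in auto)
    then show ?thesis using 3 f by (simp add: node_init_def left_port_def right_port_def)
  next
    case 4
    have ne: "?L \<noteq> ?R" using dirp_distinct[OF p, of 0] 4 by simp
    show ?thesis
    proof (cases "?L < ?R")
      case True
      have f: "least_dir ?b = Some ?L" by (rule least_dir_Some) (use b L4 4 True in auto)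
      have "least_dir (\<lambda>k. ?b k \<and> Some k \<noteq> least_dir ?b) = Some ?R"
        unfolding f by (rule least_dir_Some) (use b R4 4 ne in auto)
      then show ?thesis using 4 f by (simp add: node_init_def left_port_def right_port_def)
    next
      case False
      have f: "least_dir ?b = Some ?R" by (rule least_dir_Some) (use b R4 4 False in auto)
      have "least_dir (\<lambda>k. ?b k \<and> Some k \<noteq> least_dir ?b) = Some ?L"
        unfolding f by (rule least_dir_Some) (use b L4 4 ne in auto)
      then show ?thesis using 4 f by (simp add: node_init_def left_port_def right_port_def)
    qed
  qed
qed

lemma other_port_path:
  assumes p: "g2path r s p" and l: "r \<le> l" "l \<le> s"
  shows "r < l \<Longrightarrow> other_port (nbrs (p ` {r..s}) f (p l)) (dirp (p l) (p (l - 1))) = right_port s p l"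
    and "l < s \<Longrightarrow> other_port (nbrs (p ` {r..s}) f (p l)) (dirp (p l) (p (l + 1))) = left_port r p l"
proof -
  let ?nb = "nbrs (p ` {r..s}) f (p l)"
  let ?L = "dirp (p l) (p (l - 1))" and ?R = "dirp (p l) (p (l + 1))"
  note N = nbrs_path[OF p l, of f]
  have nb: "?nb k \<noteq> None \<Longrightarrow> (r < l \<and> k = ?L) \<or> (l < s \<and> k = ?R)" for k using N(3)[of k] by blast
  have ne: "?L \<noteq> ?R" if "r < l" "l < s" using dirp_distinct[OF p that] .
  have L4: "?L < 4" if "r < l" using adj_dirp(1)[OF g2pathD(6)[OF p that l(2)]] .
  have R4: "?R < 4" if "l < s" using adj_dirp(1)[OF g2pathD(5)[OF p l(1) that]] .
  show "other_port ?nb ?L = right_port s p l" if rl: "r < l"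
  proof (cases "l < s")
    case True
    have "other_port ?nb ?L = Some ?R"
      unfolding other_port_def by (rule least_dir_Some) (use R4 True N(2) ne rl nb in auto)
    then show ?thesis using True by (simp add: right_port_def)
  next
    case False
    have "other_port ?nb ?L = None"
      unfolding other_port_def by (rule least_dir_None) (use False nb in blast)
    then show ?thesis using False by (simp add: right_port_def)
  qed
  show "other_port ?nb ?R = left_port r p l" if ls: "l < s"
  proof (cases "r < l")
    case True
    have "other_port ?nb ?R = Some ?L"
      unfolding other_port_def by (rule least_dir_Some) (use L4 True N(1) ne ls nb in auto)
    then show ?thesis using True by (simp add: left_port_def)
  next
    case False
    have "other_port ?nb ?R = None"
      unfolding other_port_def by (rule least_dir_None) (use False nb in blast)
    then show ?thesis using False by (simp add: left_port_def)
  qed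
qed

text \<open>The second claim justifies that a sleeping node acts as a blank cell.\<close>

lemma line_run_props:
  assumes "r \<le> 0" "0 \<le> s"
  shows "(line_step ^^ t) (line_init r s) x = None \<longleftrightarrow> \<not> (r \<le> x \<and> x \<le> s)"
    and "r \<le> x \<Longrightarrow> x \<le> s \<Longrightarrow> int t < \<bar>x\<bar> \<Longrightarrow> (line_step ^^ t) (line_init r s) x = Some Blank"
proof -
  show dom: "(line_step ^^ t) (line_init r s) x = None \<longleftrightarrow> \<not> (r \<le> x \<and> x \<le> s)" for t x
    by (induction t) (auto simp: line_step_def line_init_def)
  show "(line_step ^^ t) (line_init r s) x = Some Blank" if "r \<le> x" "x \<le> s" "int t < \<bar>x\<bar>"
    using that
  proof (induction t arbitrary: x)
    case 0
    then show ?case by (auto simp: line_init_def)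
  next
    case (Suc t)
    let ?c = "(line_step ^^ t) (line_init r s)"
    have "?c y \<in> {None, Some Blank}" if "y = x - 1 \<or> y = x + 1" for y
      using Suc.IH[of y] dom[of t y] that Suc.prems(3) by (cases "r \<le> y \<and> y \<le> s") auto
    then have "?c (x - 1) \<in> {None, Some Blank}" "?c (x + 1) \<in> {None, Some Blank}" by blast+
    moreover have "?c x = Some Blank" using Suc by auto
    ultimately have "line_step ?c x = Some Blank" unfolding line_step_def[of ?c x] by auto
    then show ?case by simp
  qed
qed

text \<open>When a node is woken, exactly one neighbour is awake, the one closer to the general, and
  its ports tell on which side it lies. The woken node updates its blank cell in the same step, so
  the line is simulated without delay.\<close>

lemma node_run_path:
  assumes p: "g2path r s p"
    and init: "node_init (bc (p ` {r..s}) (0,0)) = Some (left_port r p 0, right_port s p 0, Start)"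
    and l: "r \<le> l" "l \<le> s"
  shows "node_run (p ` {r..s}) t (p l) = (if \<bar>l\<bar> \<le> int t
    then Some (left_port r p l, right_port s p l, the ((line_step ^^ t) (line_init r s) l)) else None)"
  using l
proof (induction t arbitrary: l)
  case 0
  then have "p l = (0,0) \<longleftrightarrow> l = 0" using g2pathD(4)[OF p, of l 0] g2pathD(1-3)[OF p] by auto
  then show ?case using init g2pathD(1,2)[OF p] by (auto simp: line_init_def)
next
  case (Suc t)
  note D = g2pathD[OF p]
  let ?S = "p ` {r..s}"
  let ?f = "node_run ?S t" and ?c = "(line_step ^^ t) (line_init r s)"
  let ?nb = "nbrs ?S ?f (p l)"
  let ?L = "dirp (p l) (p (l - 1))" and ?R = "dirp (p l) (p (l + 1))"
  note N = nbrs_path[OF p Suc.prems, of ?f]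
  have cell: "Some (node_cell (?f (p m))) = ?c m" if "r \<le> m" "m \<le> s" for m
    using Suc.IH[OF that] line_run_props[OF D(1,2), where t=t and x=m] that by (cases "?c m") auto
  have inL: "port_input ?nb (left_port r p l) = ?c (l - 1)"
    using N(1) cell[of "l - 1"] line_run_props(1)[OF D(1,2), of t "l - 1"] Suc.prems
    by (auto simp: left_port_def)
  have inR: "port_input ?nb (right_port s p l) = ?c (l + 1)"
    using N(2) cell[of "l + 1"] line_run_props(1)[OF D(1,2), of t "l + 1"] Suc.prems
    by (auto simp: right_port_def)
  have ex: "?c l \<noteq> None" using line_run_props(1)[OF D(1,2)] Suc.prems by blast
  have step: "the ((line_step ^^ Suc t) (line_init r s) l) = rule1 (?c (l - 1)) (the (?c l)) (?c (l + 1))"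
    using ex by (auto simp: line_step_def[of ?c l])
  have asleep: "?f (p m) = None" if "r \<le> m" "m \<le> s" "int t < \<bar>m\<bar>" for m
    using Suc.IH[OF that(1,2)] that(3) by simp
  have Suc_eq: "node_run ?S (Suc t) (p l) = node_step (?f (p l)) ?nb" by simp
  consider "\<bar>l\<bar> \<le> int t" | "l = int t + 1" | "l = - int t - 1" | "int t + 1 < \<bar>l\<bar>" by linarith
  then show ?case
  proof cases
    case 1
    then show ?thesis unfolding Suc_eq Suc.IH[OF Suc.prems] step using inL inR by simp
  next
    case 2
    have rl: "r < l" using 2 D(1) by simp
    have "?f (p (l - 1)) = Some (left_port r p (l - 1), right_port s p (l - 1), the (?c (l - 1)))"
      using Suc.IH[of "l - 1"] 2 rl Suc.prems by simp
    moreover have "right_port s p (l - 1) = Some (opp ?L)"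
      using adj_dirp(3)[OF D(6)[OF rl Suc.prems(2)]] Suc.prems by (simp add: right_port_def)
    ultimately have fl: "from_left ?nb ?L" using N(1)[OF rl] by (simp add: from_left_def)
    have L: "k = ?L" if "?nb k = Some y" "y \<noteq> None" for k y
    proof (rule ccontr)
      assume "k \<noteq> ?L"
      then have ls: "l < s" and y: "y = ?f (p (l + 1))" using N(3)[OF that(1)] by blast+
      have "?f (p (l + 1)) = None" by (rule asleep) (use ls 2 Suc.prems in auto)
      then show False using that(2) y by simp
    qed
    have "k = ?L" if kl: "from_left ?nb k" for k
    proof -
      obtain lp a where "?nb k = Some (Some (lp, Some (opp k), a))"
        using kl unfolding from_left_def by blast
      then show ?thesis by (rule L) simp
    qed
    then have le: "?L \<le> k" if "from_left ?nb k" for k using that by blast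
    have "least_dir (from_left ?nb) = Some ?L"
      by (rule least_dir_Some, rule adj_dirp(1)[OF D(6)[OF rl Suc.prems(2)]], rule fl, rule le)
    then have "node_ports ?nb = Some (left_port r p l, right_port s p l)"
      using other_port_path(1)[OF p Suc.prems rl] rl by (simp add: node_ports_def left_port_def)
    moreover have "?c l = Some Blank" using line_run_props(2)[OF D(1,2) Suc.prems] 2 by simp
    moreover have "?f (p l) = None" by (rule asleep) (use 2 Suc.prems in auto)
    ultimately show ?thesis unfolding Suc_eq step using 2 inL inR by simp
  next
    case 3
    have ls: "l < s" using 3 D(2) by simp
    have f1: "?f (p (l + 1)) = Some (left_port r p (l + 1), right_port s p (l + 1), the (?c (l + 1)))"
      using Suc.IH[of "l + 1"] 3 ls Suc.prems by simp
    have opp: "dirp (p (l + 1)) (p l) = opp ?R" using adj_dirp(3)[OF D(5)[OF Suc.prems(1) ls]] .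
    then have "left_port r p (l + 1) = Some (opp ?R)"
      using Suc.prems by (simp add: left_port_def)
    then have fr: "from_right ?nb ?R" using N(2)[OF ls] f1 by (simp add: from_right_def)
    have R: "k = ?R \<and> y = ?f (p (l + 1))" if "?nb k = Some y" "y \<noteq> None" for k y
    proof (rule ccontr)
      assume "\<not> (k = ?R \<and> y = ?f (p (l + 1)))"
      then have rl: "r < l" and y: "y = ?f (p (l - 1))" using N(3)[OF that(1)] by blast+
      have "?f (p (l - 1)) = None" by (rule asleep) (use rl 3 Suc.prems in auto)
      then show False using that(2) y by simp
    qed
    \<comment> \<open>\<open>node_ports\<close> tests \<open>from_left\<close> first. The right
      neighbour points here with its left port, and its right port has a different direction, so
      this test fails.\<close>
    have nl: "\<not> from_left ?nb k" for k
    proof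
      assume "from_left ?nb k"
      then obtain lp a where k: "?nb k = Some (Some (lp, Some (opp k), a))" using from_left_def by blast
      then have kR: "k = ?R" and "right_port s p (l + 1) = Some (opp k)" using R[OF k] f1 by auto
      then have ls1: "l + 1 < s" and "dirp (p (l + 1)) (p (l + 1 + 1)) = opp ?R"
        by (auto simp: right_port_def split: if_splits)
      then show False using dirp_distinct[OF p, of "l + 1"] opp Suc.prems by simp
    qed
    have "k = ?R" if kr: "from_right ?nb k" for k
    proof -
      obtain rp a where "?nb k = Some (Some (Some (opp k), rp, a))"
        using kr unfolding from_right_def by blast
      then have "k = ?R \<and> Some (Some (opp k), rp, a) = ?f (p (l + 1))" by (rule R) simp
      then show ?thesis by simp
    qed
    then have le: "?R \<le> k" if "from_right ?nb k" for k using that by blast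
    have "least_dir (from_right ?nb) = Some ?R"
      by (rule least_dir_Some, rule adj_dirp(1)[OF D(5)[OF Suc.prems(1) ls]], rule fr, rule le)
    moreover have "least_dir (from_left ?nb) = None" using nl by (intro least_dir_None)
    ultimately have "node_ports ?nb = Some (left_port r p l, right_port s p l)"
      using other_port_path(2)[OF p Suc.prems ls] ls by (simp add: node_ports_def right_port_def)
    moreover have "?c l = Some Blank" using line_run_props(2)[OF D(1,2) Suc.prems] 3 by simp
    moreover have "?f (p l) = None" by (rule asleep) (use 3 Suc.prems in auto)
    ultimately show ?thesis unfolding Suc_eq step using 3 inL inR by simp
  next
    case 4
    have "?f (p (l - 1)) = None" if "r < l" by (rule asleep) (use that 4 Suc.prems in auto)
    moreover have "?f (p (l + 1)) = None" if "l < s" by (rule asleep) (use that 4 Suc.prems in auto)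
    ultimately have no: "y = None" if "?nb k = Some y" for k y
      using N(3)[OF that] by auto
    have "\<not> from_left ?nb k" "\<not> from_right ?nb k" for k
      unfolding from_left_def from_right_def using no by blast+
    then have "least_dir (from_left ?nb) = None" "least_dir (from_right ?nb) = None"
      by (auto intro!: least_dir_None)
    moreover have "?f (p l) = None" by (rule asleep) (use 4 Suc.prems in auto)
    ultimately show ?thesis unfolding Suc_eq using 4 by (simp add: node_ports_def)
  qed
qed

lemma ports_in:
  assumes "g2path r s p" "r \<le> l" "l \<le> s"
  shows "left_port r p l \<in> insert None (Some ` {..<4})" "right_port s p l \<in> insert None (Some ` {..<4})"
  using adj_dirp(1)[OF g2pathD(6)[OF assms(1), of l]] adj_dirp(1)[OF g2pathD(5)[OF assms(1), of l]] assms(2,3)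
  by (auto simp: left_port_def right_port_def)

lemma finite_cell: "finite (UNIV :: cell set)"
proof -
  have "UNIV = {Blank, Start, NewWall, OldWall, RFast, LFast, RSlow1, RSlow2, RSlow3, LSlow1, LSlow2, LSlow3, RGen, LGen, Fire}"
    using cell.exhaust by auto
  then show ?thesis by (metis finite.emptyI finite.insertI)
qed

lemma ex_solution: "\<exists>A. is_solution A"
proof -
  let ?P = "insert None (Some ` {..<4 :: nat})"
  let ?St = "insert None (Some ` (?P \<times> ?P \<times> (UNIV :: cell set)))"
  let ?Fi = "{Some (lp, rp, Fire) | lp rp. True}"
  have "\<exists>A. wf_fsa A \<and> (\<forall>S t. (\<forall>u\<le>t. \<forall>q\<in>S. node_run S u q \<in> ?St) \<longrightarrow>
      (\<forall>q\<in>S. run A S t q \<in> firing A \<longleftrightarrow> node_run S t q \<in> ?Fi))"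
  proof (rule ex_fsa[of ?St None ?Fi node_init node_step])
    show "finite ?St" using finite_cell by simp
    show "node_init b \<in> ?St" for b
      unfolding node_init_def
      by (intro insertI2 imageI SigmaI least_dir_in UNIV_I)
    show "node_step None nb = None" if nb: "\<And>k. nb k \<in> {None, Some None}" for nb
    proof -
      have "\<not> from_left nb k" "\<not> from_right nb k" for k
        using nb[of k] by (auto simp: from_left_def from_right_def)
      then have "least_dir (from_left nb) = None" "least_dir (from_right nb) = None"
        by (auto intro!: least_dir_None)
      then show ?thesis by (simp add: node_ports_def)
    qed
  qed auto
  then obtain A where wf: "wf_fsa A"
    and A: "\<And>S t. \<forall>u\<le>t. \<forall>q\<in>S. node_run S u q \<in> ?St \<Longrightarrow>
      \<forall>q\<in>S. run A S t q \<in> firing A \<longleftrightarrow> node_run S t q \<in> ?Fi"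
    by blast
  have fires: "\<exists>t. fires_at A (p ` {r..s}) t"
    if p: "g2path r s p"
      and init: "node_init (bc (p ` {r..s}) (0,0)) = Some (left_port r p 0, right_port s p 0, Start)" for r s p
  proof -
    note D = g2pathD[OF p]
    let ?c = "\<lambda>t. (line_step ^^ t) (line_init r s)"
    note run = node_run_path[OF p init]
    have St: "node_run (p ` {r..s}) u q \<in> ?St" if "q \<in> p ` {r..s}" for u q
    proof -
      obtain l where "r \<le> l" "l \<le> s" "q = p l" using \<open>q \<in> _\<close> by auto
      then show ?thesis using run[of l u] ports_in[OF p, of l] by auto
    qed
    have A': "run A (p ` {r..s}) t q \<in> firing A \<longleftrightarrow> node_run (p ` {r..s}) t q \<in> ?Fi"
      if "q \<in> p ` {r..s}" for t q
      by (rule A[rule_format, OF _ that], rule St)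
    have F: "run A (p ` {r..s}) t (p l) \<in> firing A \<longleftrightarrow> ?c t l = Some Fire" if l: "r \<le> l" "l \<le> s" for t l
    proof -
      obtain a where a: "?c t l = Some a" using line_run_props(1)[OF D(1,2)] l by blast
      have "run A (p ` {r..s}) t (p l) \<in> firing A \<longleftrightarrow> node_run (p ` {r..s}) t (p l) \<in> ?Fi"
        by (rule A') (use l in simp)
      also have "\<dots> \<longleftrightarrow> \<bar>l\<bar> \<le> int t \<and> a = Fire" unfolding run[OF l] a by simp
      also have "\<dots> \<longleftrightarrow> ?c t l = Some Fire"
        using a line_run_props(2)[OF D(1,2) l, where t=t] by (cases "\<bar>l\<bar> \<le> int t") auto
      finally show ?thesis .
    qed
    obtain t where "\<And>u x. u < t \<Longrightarrow> ?c u x \<noteq> Some Fire" "\<And>x. r \<le> x \<Longrightarrow> x \<le> s \<Longrightarrow> ?c t x = Some Fire"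
      using line_synchronises[OF D(1,2)] by blast
    then have "fires_at A (p ` {r..s}) t" unfolding fires_at_def by (simp add: F)
    then show ?thesis ..
  qed
  have "\<exists>t. fires_at A (set xs) t" if xs: "lconfig xs" for xs
  proof -
    obtain r s p where p: "g2path r s p" and set: "set xs = p ` {r..s}"
      using lconfig_path[OF xs] .
    show ?thesis
    proof (cases "node_init (bc (p ` {r..s}) (0,0)) = Some (left_port r p 0, right_port s p 0, Start)")
      case True
      then show ?thesis using fires[OF p] set by simp
    next
      \<comment> \<open>The general has called its right neighbour left. Read backwards, the path
        has the orientation that the general chose.\<close>
      case False
      then have "node_init (bc (p ` {r..s}) (0,0)) = Some (right_port s p 0, left_port r p 0, Start)"
        using node_init_oriented[OF p] by blast
      moreover have "left_port (- s) (\<lambda>l. p (- l)) 0 = right_port s p 0"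
        "right_port (- r) (\<lambda>l. p (- l)) 0 = left_port r p 0"
        by (simp_all add: left_port_def right_port_def)
      ultimately show ?thesis
        using fires[OF g2path_mirror[OF p]] image_uminus_interval[of p s r] set by simp
    qed
  qed
  then have "is_solution A" using wf by (simp add: is_solution_def)
  then show ?thesis ..
qed

section \<open>Delaying a solution while collecting boundary conditions\<close>

text \<open>Up to time \<^term>\<open>T\<close> an awake node stores the time, its own position and the boundary conditions
  that it has learnt. At time \<^term>\<open>Suc T\<close> all nodes forget this and the given solution is started.\<close>

type_synonym bcond = "bool \<times> bool \<times> bool \<times> bool"
type_synonym probe = "(nat \<times> pos \<times> (pos \<times> bcond) set) option"

definition pattern :: "(nat \<Rightarrow> 'q option) \<Rightarrow> bcond" where
  "pattern nb = (nb 0 \<noteq> None, nb 1 \<noteq> None, nb 2 \<noteq> None, nb 3 \<noteq> None)"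

lemma pattern_nbrs: "pattern (nbrs S f q) = bc S q"
  by (simp add: pattern_def nbrs_def bc_def)

definition learnt :: "(nat \<Rightarrow> (probe \<times> nat) option) \<Rightarrow> (pos \<times> bcond) set" where
  "learnt nb = {z. \<exists>k t q K x. nb k = Some (Some (t, q, K), x) \<and> z \<in> K}"

text \<open>A sleeping node infers the time and its own position from an awake neighbour: one in
  direction \<open>k\<close> stores the position shifted by \<open>k\<close>. The bound by
  \<open>T\<close> prevents nodes from waking after the probing phase.\<close>

definition wakes :: "nat \<Rightarrow> (nat \<Rightarrow> (probe \<times> nat) option) \<Rightarrow> nat \<times> pos \<Rightarrow> bool" where
  "wakes T nb z \<longleftrightarrow> fst z < T \<and> (\<exists>k K x. nb k = Some (Some (fst z, shift (snd z) k, K), x))"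

fun probe_step :: "nat \<Rightarrow> probe \<Rightarrow> (nat \<Rightarrow> (probe \<times> nat) option) \<Rightarrow> probe" where
  "probe_step T (Some (t, q, K)) nb =
     (if t < T then Some (Suc t, q, insert (q, pattern nb) (K \<union> learnt nb)) else None)"
| "probe_step T None nb =
     (if \<exists>z. wakes T nb z
      then let z = SOME z. wakes T nb z in Some (Suc (fst z), snd z, insert (snd z, pattern nb) (learnt nb))
      else None)"

text \<open>The second component simulates \<open>A\<close>. It stays quiescent until the origin,
  its probe showing time \<open>T\<close>, enters a general state; time 0 of \<open>A\<close> is
  time \<open>T + 1\<close> here.\<close>

definition delay_step :: "fsa \<Rightarrow> nat \<Rightarrow> probe \<times> nat \<Rightarrow> (nat \<Rightarrow> (probe \<times> nat) option) \<Rightarrow> probe \<times> nat" where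
  "delay_step A T z nb = (probe_step T (fst z) nb,
     if \<exists>K. fst z = Some (T, (0,0), K) then gen A (tau A (pattern nb))
     else delta A (snd z) (map_option snd (nb 0)) (map_option snd (nb 1))
            (map_option snd (nb 2)) (map_option snd (nb 3)))"

lemma delay_step_Pair:
  "delay_step A T (P, x) nb = (probe_step T P nb,
     if \<exists>K. P = Some (T, (0,0), K) then gen A (tau A (pattern nb))
     else delta A x (map_option snd (nb 0)) (map_option snd (nb 1))
            (map_option snd (nb 2)) (map_option snd (nb 3)))"
  by (simp add: delay_step_def)

definition delay_init :: "fsa \<Rightarrow> bcond \<Rightarrow> probe \<times> nat" where
  "delay_init A b = (Some (0, (0,0), {((0,0), b)}), quiescent A)"

abbreviation delay_run :: "fsa \<Rightarrow> nat \<Rightarrow> pos set \<Rightarrow> nat \<Rightarrow> pos \<Rightarrow> probe \<times> nat" where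
  "delay_run A T \<equiv> grun (delay_init A) (None, quiescent A) (delay_step A T)"

text \<open>The boundary condition of node \<^term>\<open>m\<close> enters the network at time \<^term>\<open>\<bar>m\<bar>\<close>, when the node wakes up, and
  reaches node \<^term>\<open>l\<close> at time \<^term>\<open>\<bar>m\<bar> + \<bar>m - l\<bar>\<close>.\<close>

definition knowledge :: "int \<Rightarrow> int \<Rightarrow> (int \<Rightarrow> pos) \<Rightarrow> nat \<Rightarrow> int \<Rightarrow> (pos \<times> bcond) set" where
  "knowledge r s p t l = (\<lambda>m. (p m, bc (p ` {r..s}) (p m))) ` {m. r \<le> m \<and> m \<le> s \<and> \<bar>m\<bar> + \<bar>m - l\<bar> \<le> int t}"

lemma knowledge_empty: "int t < \<bar>l\<bar> \<Longrightarrow> knowledge r s p t l = {}"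
  by (auto simp: knowledge_def)

lemma knowledge_Suc:
  assumes "r \<le> l" "l \<le> s" "\<bar>l\<bar> \<le> int (Suc t)"
  shows "knowledge r s p (Suc t) l = insert (p l, bc (p ` {r..s}) (p l)) (knowledge r s p t l \<union>
    (if r < l then knowledge r s p t (l - 1) else {}) \<union> (if l < s then knowledge r s p t (l + 1) else {}))"
proof -
  let ?M = "\<lambda>t l. {m. r \<le> m \<and> m \<le> s \<and> \<bar>m\<bar> + \<bar>m - l\<bar> \<le> int t}"
  have "?M (Suc t) l = insert l (?M t l \<union> (if r < l then ?M t (l - 1) else {}) \<union>
      (if l < s then ?M t (l + 1) else {}))"
    using assms by auto
  then show ?thesis unfolding knowledge_def by (simp only: image_insert image_Un) (simp split: if_split)
qed

lemma snd_nbrs: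
  assumes "k < 4"
  shows "map_option snd (nbrs S f q k) = (if shift q k \<in> S then Some (snd (f (shift q k))) else None)"
  using assms by (simp add: nbrs_def)

lemma delay_run_early:
  assumes wf: "wf_fsa A" and p: "g2path r s p" and l: "r \<le> l" "l \<le> s" and t: "t \<le> T"
  shows "delay_run A T (p ` {r..s}) t (p l) =
    (if \<bar>l\<bar> \<le> int t then Some (t, p l, knowledge r s p t l) else None, quiescent A)"
  using l t
proof (induction t arbitrary: l)
  case 0
  note D = g2pathD[OF p]
  have "p l = (0,0) \<longleftrightarrow> l = 0" using D(4)[of l 0] D(1-3) 0 by auto
  moreover have "knowledge r s p 0 0 = {((0,0), bc (p ` {r..s}) (0,0))}"
    using D(1-3) by (auto simp: knowledge_def)
  ultimately show ?case using D(3) by (simp add: delay_init_def)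
next
  case (Suc t)
  let ?S = "p ` {r..s}"
  let ?f = "delay_run A T ?S t"
  define nb where "nb = nbrs ?S ?f (p l)"
  have tT: "t < T" using Suc.prems by simp
  have f: "?f (p m) = (if \<bar>m\<bar> \<le> int t then Some (t, p m, knowledge r s p t m) else None, quiescent A)"
    if "r \<le> m" "m \<le> s" for m
    using Suc.IH[OF that] tT by simp
  have N: "\<exists>m. r \<le> m \<and> m \<le> s \<and> (m = l - 1 \<or> m = l + 1) \<and> shift (p l) k = p m \<and> y = ?f (p m)"
    if "nb k = Some y" for k y
  proof -
    have k: "k < 4" "shift (p l) k \<in> ?S" "y = ?f (shift (p l) k)"
      using that by (auto simp: nb_def nbrs_def split: if_splits)
    then consider "l < s" "shift (p l) k = p (l + 1)" | "r < l" "shift (p l) k = p (l - 1)"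
      using g2path_nbr[OF p Suc.prems(1,2) k(1)] by blast
    then show ?thesis
    proof cases
      case 1
      then show ?thesis using k(3) Suc.prems(1,2) by (intro exI[of _ "l + 1"]) simp
    next
      case 2
      then show ?thesis using k(3) Suc.prems(1,2) by (intro exI[of _ "l - 1"]) simp
    qed
  qed
  have N': "\<exists>k. nb k = Some (?f (p m)) \<and> shift (p l) k = p m"
    if "r \<le> m" "m \<le> s" "m = l - 1 \<or> m = l + 1" for m
  proof -
    have "adj (p l) (p m)"
      using that g2pathD(5)[OF p, of l] g2pathD(6)[OF p, of l] Suc.prems(1,2) by auto
    then obtain k where "k < 4" "p m = shift (p l) k" unfolding adj_def by blast
    moreover have "p m \<in> ?S" using that by simp
    ultimately show ?thesis by (intro exI[of _ k]) (simp add: nb_def nbrs_def)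
  qed
  have learnt: "learnt nb = (if r < l then knowledge r s p t (l - 1) else {}) \<union>
      (if l < s then knowledge r s p t (l + 1) else {})" (is "?A = ?B")
  proof (intro equalityI subsetI)
    fix z assume "z \<in> ?A"
    then obtain k t' q K x where k: "nb k = Some (Some (t', q, K), x)" "z \<in> K" by (auto simp: learnt_def)
    obtain m where m: "r \<le> m" "m \<le> s" "m = l - 1 \<or> m = l + 1" "(Some (t', q, K), x) = ?f (p m)"
      using N[OF k(1)] by blast
    then have "K = knowledge r s p t m" using f[OF m(1,2)] by (auto split: if_splits)
    then show "z \<in> ?B" using m(1-3) k(2) by auto
  next
    fix z assume "z \<in> ?B"
    then consider "r < l" "z \<in> knowledge r s p t (l - 1)" | "l < s" "z \<in> knowledge r s p t (l + 1)"
      by (auto split: if_splits)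
    then have "\<exists>m. r \<le> m \<and> m \<le> s \<and> (m = l - 1 \<or> m = l + 1) \<and> z \<in> knowledge r s p t m"
    proof cases
      case 1
      then show ?thesis using Suc.prems(1,2) by (intro exI[of _ "l - 1"]) auto
    next
      case 2
      then show ?thesis using Suc.prems(1,2) by (intro exI[of _ "l + 1"]) auto
    qed
    then obtain m where m: "r \<le> m" "m \<le> s" "m = l - 1 \<or> m = l + 1" and z: "z \<in> knowledge r s p t m"
      by blast
    obtain k where k: "nb k = Some (?f (p m))" using N'[OF m] by blast
    have "\<bar>m\<bar> \<le> int t" using z knowledge_empty[of t m r s p] by fastforce
    then have "nb k = Some (Some (t, p m, knowledge r s p t m), quiescent A)"
      using k f[OF m(1,2)] by simp
    then show "z \<in> ?A" unfolding learnt_def using z by blast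
  qed
  have quiet: "map_option snd (nb k) \<in> {None, Some (quiescent A)}" for k
  proof (cases "nb k")
    case (Some y)
    then obtain m where "r \<le> m" "m \<le> s" "y = ?f (p m)" using N[OF Some] by blast
    then show ?thesis using Some f[of m] by simp
  qed simp
  have delta: "delta A (quiescent A) (map_option snd (nb 0)) (map_option snd (nb 1))
      (map_option snd (nb 2)) (map_option snd (nb 3)) = quiescent A"
    by (rule wf_fsa_quiescentD[OF wf]) (rule quiet)+
  have eq: "delay_run A T ?S (Suc t) (p l) = delay_step A T (?f (p l)) nb" by (simp add: nb_def)
  have pat: "pattern nb = bc ?S (p l)" unfolding nb_def by (rule pattern_nbrs)
  consider "\<bar>l\<bar> \<le> int t" | "\<bar>l\<bar> = int t + 1" | "int t + 1 < \<bar>l\<bar>" by linarith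
  then show ?case
  proof cases
    case 1
    then have "knowledge r s p (Suc t) l =
        insert (p l, bc ?S (p l)) (knowledge r s p t l \<union> learnt nb)"
      unfolding learnt using knowledge_Suc[OF Suc.prems(1,2), of t p] by (simp add: Un_assoc)
    then show ?thesis
      unfolding eq f[OF Suc.prems(1,2)] using 1 tT delta pat by (simp add: delay_step_Pair)
  next
    case 2
    then have K: "knowledge r s p (Suc t) l = insert (p l, bc ?S (p l)) (learnt nb)"
      unfolding learnt using knowledge_Suc[OF Suc.prems(1,2), of t p] knowledge_empty[of t l r s p] by simp
    define m where "m = (if l > 0 then l - 1 else l + 1)"
    have m: "r \<le> m" "m \<le> s" "m = l - 1 \<or> m = l + 1" "\<bar>m\<bar> \<le> int t"
      using 2 Suc.prems(1,2) g2pathD(1,2)[OF p] by (auto simp: m_def)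
    obtain k where k: "nb k = Some (?f (p m))" "shift (p l) k = p m" using N'[OF m(1-3)] by blast
    have wake: "wakes T nb (t, p l)"
    proof -
      have "nb k = Some (Some (t, shift (p l) k, knowledge r s p t m), quiescent A)"
        using k f[OF m(1,2)] m(4) by simp
      then show ?thesis unfolding wakes_def fst_conv snd_conv using tT by blast
    qed
    \<comment> \<open>The choice by \<open>SOME\<close> is forced: all awake neighbours store the
      time \<open>t\<close> and their true positions, and shifting is injective.\<close>
    have uniq: "z = (t, p l)" if z: "wakes T nb z" for z
    proof -
      obtain k K x where k: "nb k = Some (Some (fst z, shift (snd z) k, K), x)"
        using z unfolding wakes_def by blast
      obtain m where m: "r \<le> m" "m \<le> s" "shift (p l) k = p m" "(Some (fst z, shift (snd z) k, K), x) = ?f (p m)"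
        using N[OF k] by blast
      then have "fst z = t" "shift (snd z) k = shift (p l) k"
        using f[OF m(1,2)] by (auto split: if_splits)
      then show ?thesis using shift_inj_pos by (metis prod.collapse)
    qed
    have some: "(SOME z. wakes T nb z) = (t, p l)"
      by (rule some_equality[where P="wakes T nb", OF wake uniq])
    have ex: "\<exists>z. wakes T nb z" using wake by blast
    have "probe_step T None nb = Some (Suc t, p l, knowledge r s p (Suc t) l)"
      unfolding probe_step.simps if_P[OF ex] some Let_def K pat by simp
    then show ?thesis
      unfolding eq f[OF Suc.prems(1,2)] using 2 delta by (simp add: delay_step_Pair)
  next
    case 3
    have "\<not> wakes T nb z" for z
    proof
      assume "wakes T nb z"
      then obtain k K x where k: "nb k = Some (Some (fst z, shift (snd z) k, K), x)"
        unfolding wakes_def by blast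
      obtain m where m: "r \<le> m" "m \<le> s" "m = l - 1 \<or> m = l + 1" "(Some (fst z, shift (snd z) k, K), x) = ?f (p m)"
        using N[OF k] by blast
      then have "\<bar>m\<bar> \<le> int t" using f[OF m(1,2)] by (auto split: if_splits)
      then show False using m(3) 3 by auto
    qed
    then have "probe_step T None nb = None" by simp
    then show ?thesis
      unfolding eq f[OF Suc.prems(1,2)] using 3 delta by (simp add: delay_step_Pair)
  qed
qed

lemma delta_nbrs_snd:
  assumes "\<And>k. shift q k \<in> S \<Longrightarrow> snd (f (shift q k)) = run A S u (shift q k)"
  shows "delta A (run A S u q) (map_option snd (nbrs S f q 0)) (map_option snd (nbrs S f q 1))
      (map_option snd (nbrs S f q 2)) (map_option snd (nbrs S f q 3)) = run A S (Suc u) q"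
proof -
  have "map_option snd (nbrs S f q k) = (if shift q k \<in> S then Some (run A S u (shift q k)) else None)"
    if "k < 4" for k unfolding snd_nbrs[OF that] using assms by simp
  then show ?thesis unfolding run_Suc by (simp del: run.simps)
qed

lemma delay_run_late:
  assumes wf: "wf_fsa A" and p: "g2path r s p" and l: "r \<le> l" "l \<le> s"
  shows "delay_run A T (p ` {r..s}) (Suc (T + u)) (p l) = (None, run A (p ` {r..s}) u (p l))"
  using l
proof (induction u arbitrary: l)
  case 0
  let ?S = "p ` {r..s}"
  let ?f = "delay_run A T ?S T"
  define nb where "nb = nbrs ?S ?f (p l)"
  note D = g2pathD[OF p]
  have f: "?f (p m) = (if \<bar>m\<bar> \<le> int T then Some (T, p m, knowledge r s p T m) else None, quiescent A)"
    if "r \<le> m" "m \<le> s" for m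
    using delay_run_early[OF wf p that order_refl] .
  have N: "\<exists>m. r \<le> m \<and> m \<le> s \<and> y = ?f (p m)" if "nb k = Some y" for k y
    using that by (auto simp: nb_def nbrs_def split: if_splits)
  have quiet: "map_option snd (nb k) \<in> {None, Some (quiescent A)}" for k
  proof (cases "nb k")
    case (Some y)
    then obtain m where "r \<le> m" "m \<le> s" "y = ?f (p m)" using N[OF Some] by blast
    then show ?thesis using Some f[of m] by simp
  qed simp
  have delta: "delta A (quiescent A) (map_option snd (nb 0)) (map_option snd (nb 1))
      (map_option snd (nb 2)) (map_option snd (nb 3)) = quiescent A"
    by (rule wf_fsa_quiescentD[OF wf]) (rule quiet)+
  \<comment> \<open>Awake neighbours show the time \<open>T\<close> now, which \<open>wakes\<close>
    excludes.\<close>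
  have "\<not> wakes T nb z" for z
  proof
    assume "wakes T nb z"
    then obtain k K x where z: "fst z < T" and k: "nb k = Some (Some (fst z, shift (snd z) k, K), x)"
      unfolding wakes_def by blast
    obtain m where m: "r \<le> m" "m \<le> s" "(Some (fst z, shift (snd z) k, K), x) = ?f (p m)"
      using N[OF k] by blast
    then have "fst z = T" using f[OF m(1,2)] by (auto split: if_splits)
    then show False using z by simp
  qed
  then have asleep: "probe_step T (fst (?f (p l))) nb = None" using f[OF 0] by simp
  have pat: "pattern nb = bc ?S (p l)" unfolding nb_def by (rule pattern_nbrs)
  have l0: "p l = (0,0) \<longleftrightarrow> l = 0" using D(4)[of l 0] D(1-3) 0 by auto
  have "delay_run A T ?S (Suc (T + 0)) (p l) = delay_step A T (?f (p l)) nb" by (simp add: nb_def)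
  also have "\<dots> = (None, run A ?S 0 (p l))"
  proof (cases "l = 0")
    case True
    then show ?thesis using asleep f[OF 0] l0 pat by (simp add: delay_step_Pair)
  next
    case False
    then show ?thesis using asleep f[OF 0] l0 delta by (simp add: delay_step_Pair)
  qed
  finally show ?case .
next
  case (Suc u)
  let ?S = "p ` {r..s}"
  let ?f = "delay_run A T ?S (Suc (T + u))"
  define nb where "nb = nbrs ?S ?f (p l)"
  have N: "fst y = None" if "nb k = Some y" for k y
    using that Suc.IH by (auto simp: nb_def nbrs_def simp del: grun.simps split: if_splits)
  have "\<not> wakes T nb z" for z
    unfolding wakes_def using N by fastforce
  note asleep = this
  have delta: "delta A (run A ?S u (p l)) (map_option snd (nb 0)) (map_option snd (nb 1))
      (map_option snd (nb 2)) (map_option snd (nb 3)) = run A ?S (Suc u) (p l)"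
    unfolding nb_def by (rule delta_nbrs_snd) (use Suc.IH in \<open>auto simp del: grun.simps run.simps\<close>)
  have "delay_run A T ?S (Suc (T + Suc u)) (p l) = delay_step A T (?f (p l)) nb"
    unfolding add_Suc_right grun.simps(2)[of _ _ _ _ "Suc (T + u)"] nb_def ..
  also have "\<dots> = (None, run A ?S (Suc u) (p l))"
    unfolding Suc.IH[OF Suc.prems]
    using asleep delta by (simp add: delay_step_Pair del: run.simps grun.simps)
  finally show ?case .
qed

section \<open>The delayed automaton as a solution\<close>

lemma wf_fsa_deltaD:
  assumes "wf_fsa A" "x \<in> states A" "\<And>y. y \<in> {y0, y1, y2, y3} \<Longrightarrow> y = None \<or> the y \<in> states A"
  shows "delta A x y0 y1 y2 y3 \<in> states A"
proof -
  have "\<forall>x\<in>states A. \<forall>y0 y1 y2 y3.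
      (\<forall>y\<in>{y0, y1, y2, y3}. y = None \<or> the y \<in> states A) \<longrightarrow> delta A x y0 y1 y2 y3 \<in> states A"
    by (insert assms(1), unfold wf_fsa_def, elim conjE, assumption)
  note closed = this[THEN bspec, OF assms(2), THEN spec, THEN spec, THEN spec, THEN spec, THEN mp]
  show ?thesis by (rule closed, rule ballI) (rule assms(3))
qed

lemma run_states:
  assumes "wf_fsa A"
  shows "run A S t q \<in> states A"
proof (induction t arbitrary: q)
  case 0
  have "\<forall>k<ngen A. gen A k \<in> states A" "\<forall>b. tau A b < ngen A"
    by (insert assms, unfold wf_fsa_def, elim conjE, assumption)+
  then have "gen A (tau A b) \<in> states A" for b by blast
  moreover have "quiescent A \<in> states A" using assms by (simp add: wf_fsa_def)
  ultimately show ?case by simp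
next
  case (Suc t)
  let ?y = "\<lambda>q'. if q' \<in> S then Some (run A S t q') else None"
  have "?y q' = None \<or> the (?y q') \<in> states A" for q' using Suc.IH by simp
  then have "y = None \<or> the y \<in> states A"
    if "y \<in> {?y (shift q 0), ?y (shift q 1), ?y (shift q 2), ?y (shift q 3)}" for y
    using that by (elim insertE emptyE) (simp_all only:)
  then show ?case unfolding run_Suc by (rule wf_fsa_deltaD[OF assms Suc.IH])
qed

text \<open>\<open>M\<close> is the knowledge that triggers firing at \<open>T\<close>. The second
  hypothesis makes the decision unanimous: as soon as one awake node knows \<open>M\<close>, all
  nodes are awake and know it. The path may be re-indexed for this, because its set of nodes does
  not fix a direction.\<close>

lemma ex_delayed_solution:
  fixes M :: "(pos \<times> bcond) set"
  assumes sol: "is_solution A"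
    and M: "\<And>r s p l. g2path r s p \<Longrightarrow> r \<le> l \<Longrightarrow> l \<le> s \<Longrightarrow> \<bar>l\<bar> \<le> int T \<Longrightarrow> M \<subseteq> knowledge r s p T l \<Longrightarrow>
      \<exists>r' s' p'. g2path r' s' p' \<and> p' ` {r'..s'} = p ` {r..s} \<and>
        (\<forall>l. r' \<le> l \<longrightarrow> l \<le> s' \<longrightarrow> \<bar>l\<bar> \<le> int T \<and> M \<subseteq> knowledge r' s' p' T l)"
  shows "\<exists>A'. is_solution A' \<and> (\<forall>r s p. g2path r s p \<longrightarrow>
    (\<forall>l. r \<le> l \<longrightarrow> l \<le> s \<longrightarrow> \<bar>l\<bar> \<le> int T \<and> M \<subseteq> knowledge r s p T l) \<longrightarrow> fires_at A' (p ` {r..s}) T)"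
proof -
  have wf: "wf_fsa A" using sol by (simp add: is_solution_def)
  let ?St = "insert None (Some ` ({..T} \<times> box T \<times> Pow (box T \<times> (UNIV :: bcond set)))) \<times> states A"
  \<comment> \<open>A node fires at \<open>T\<close> if it knows \<open>M\<close>, and otherwise
    with \<open>A\<close> once its probe is cleared. A node not yet woken has no probe either, but
    there \<open>A\<close> is quiescent.\<close>
  define Fi where "Fi = {(Some (T, q, K), x) | q K x. M \<subseteq> K} \<union> {(None :: probe, x) | x. x \<in> firing A}"
  have "\<exists>A'. wf_fsa A' \<and> (\<forall>S t. (\<forall>u\<le>t. \<forall>q\<in>S. delay_run A T S u q \<in> ?St) \<longrightarrow>
      (\<forall>q\<in>S. run A' S t q \<in> firing A' \<longleftrightarrow> delay_run A T S t q \<in> Fi))"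
  proof (rule ex_fsa[of ?St "(None, quiescent A)" Fi "delay_init A" "delay_step A T"])
    show "finite ?St" using wf finite_box by (simp add: wf_fsa_def)
    show "(None, quiescent A) \<in> ?St" using wf by (simp add: wf_fsa_def)
    show "(None, quiescent A) \<notin> Fi" using wf by (simp add: wf_fsa_def Fi_def)
    show "delay_init A b \<in> ?St" for b using wf by (auto simp: wf_fsa_def delay_init_def box_def)
    show "delay_step A T (None, quiescent A) nb = (None, quiescent A)"
      if nb: "\<And>k. nb k \<in> {None, Some (None, quiescent A)}" for nb
    proof -
      have "\<not> wakes T nb z" for z
      proof
        assume "wakes T nb z"
        then obtain k K x where "nb k = Some (Some (fst z, shift (snd z) k, K), x)"
          unfolding wakes_def by blast
        then show False using nb[of k] by simp
      qed
      moreover have "map_option snd (nb k) \<in> {None, Some (quiescent A)}" for k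
        using nb[of k] by auto
      then have "delta A (quiescent A) (map_option snd (nb 0)) (map_option snd (nb 1))
          (map_option snd (nb 2)) (map_option snd (nb 3)) = quiescent A"
        by (intro wf_fsa_quiescentD[OF wf])
      ultimately show ?thesis by (simp add: delay_step_def)
    qed
  qed
  then obtain A' where wf': "wf_fsa A'"
    and A': "\<And>S t. \<forall>u\<le>t. \<forall>q\<in>S. delay_run A T S u q \<in> ?St \<Longrightarrow>
      \<forall>q\<in>S. run A' S t q \<in> firing A' \<longleftrightarrow> delay_run A T S t q \<in> Fi"
    by blast
  have fire: "run A' (p ` {r..s}) t (p l) \<in> firing A' \<longleftrightarrow>
      (t = T \<and> \<bar>l\<bar> \<le> int T \<and> M \<subseteq> knowledge r s p T l) \<or>
      (T < t \<and> run A (p ` {r..s}) (t - Suc T) (p l) \<in> firing A)"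
    if p: "g2path r s p" and l: "r \<le> l" "l \<le> s" for r s p l t
  proof -
    have late: "delay_run A T (p ` {r..s}) u (p m) = (None, run A (p ` {r..s}) (u - Suc T) (p m))"
      if "r \<le> m" "m \<le> s" "T < u" for m u
      using delay_run_late[OF wf p that(1,2), of T "u - Suc T"] that(3) by (simp del: grun.simps)
    have "knowledge r s p u m \<subseteq> box T \<times> UNIV" if "u \<le> T" for u m
    proof -
      have "p n \<in> box T" if "r \<le> n" "n \<le> s" "\<bar>n\<bar> + \<bar>n - m\<bar> \<le> int u" for n
        using g2path_box[OF p that(1,2), of T] that(3) \<open>u \<le> T\<close> by simp
      then show ?thesis unfolding knowledge_def by auto
    qed
    moreover have "p m \<in> box T" if "r \<le> m" "m \<le> s" "\<bar>m\<bar> \<le> int u" "u \<le> T" for m u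
      using g2path_box[OF p that(1,2), of T] that(3,4) by simp
    ultimately have St: "delay_run A T (p ` {r..s}) u (p m) \<in> ?St" if "r \<le> m" "m \<le> s" for u m
      using delay_run_early[OF wf p that, of u T] late[OF that, of u] run_states[OF wf] wf that
      by (cases "u \<le> T") (auto simp: wf_fsa_def simp del: grun.simps run.simps)
    have "run A' (p ` {r..s}) t (p l) \<in> firing A' \<longleftrightarrow> delay_run A T (p ` {r..s}) t (p l) \<in> Fi"
      by (rule A'[rule_format]) (use St l in auto)
    also have "\<dots> \<longleftrightarrow> (t = T \<and> \<bar>l\<bar> \<le> int T \<and> M \<subseteq> knowledge r s p T l) \<or>
        (T < t \<and> run A (p ` {r..s}) (t - Suc T) (p l) \<in> firing A)"
    proof (cases "t \<le> T")
      case True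
      have "quiescent A \<notin> firing A" using wf by (simp add: wf_fsa_def)
      then show ?thesis unfolding delay_run_early[OF wf p l True] Fi_def using True by auto
    next
      case False
      then show ?thesis using late[OF l, of t] by (simp add: Fi_def del: grun.simps run.simps)
    qed
    finally show ?thesis .
  qed
  have fires_T: "fires_at A' (p ` {r..s}) T"
    if p: "g2path r s p" and K: "\<forall>l. r \<le> l \<longrightarrow> l \<le> s \<longrightarrow> \<bar>l\<bar> \<le> int T \<and> M \<subseteq> knowledge r s p T l" for r s p
    unfolding fires_at_def
  proof (intro conjI allI impI ballI)
    fix t q assume t: "t < T" and "q \<in> p ` {r..s}"
    then obtain l where l: "r \<le> l" "l \<le> s" "q = p l" by auto
    show "run A' (p ` {r..s}) t q \<notin> firing A'" unfolding l(3) fire[OF p l(1,2)] using t by simp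
  next
    fix q assume "q \<in> p ` {r..s}"
    then obtain l where l: "r \<le> l" "l \<le> s" "q = p l" by auto
    show "run A' (p ` {r..s}) T q \<in> firing A'" unfolding l(3) fire[OF p l(1,2)] using K l by blast
  qed
  have "\<exists>t. fires_at A' (set xs) t" if xs: "lconfig xs" for xs
  proof -
    obtain r s p where p: "g2path r s p" and set: "set xs = p ` {r..s}"
      using lconfig_path[OF xs] .
    show ?thesis
    proof (cases "\<exists>l. r \<le> l \<and> l \<le> s \<and> \<bar>l\<bar> \<le> int T \<and> M \<subseteq> knowledge r s p T l")
      case True
      then obtain l where l: "r \<le> l" "l \<le> s" "\<bar>l\<bar> \<le> int T" "M \<subseteq> knowledge r s p T l" by blast
      obtain r' s' p' where p': "g2path r' s' p'" and eq: "p' ` {r'..s'} = p ` {r..s}"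
        and K: "\<forall>l. r' \<le> l \<longrightarrow> l \<le> s' \<longrightarrow> \<bar>l\<bar> \<le> int T \<and> M \<subseteq> knowledge r' s' p' T l"
        using M[OF p l] by (elim exE conjE)
      have "fires_at A' (p' ` {r'..s'}) T" by (rule fires_T[OF p' K])
      then show ?thesis unfolding set eq by blast
    next
      \<comment> \<open>No node is triggered at \<open>T\<close>, so all of them follow
        \<open>A\<close>, whose clock is \<open>Suc T\<close> steps behind.\<close>
      case False
      obtain u where u: "fires_at A (p ` {r..s}) u"
        using sol xs set unfolding is_solution_def by metis
      have "fires_at A' (p ` {r..s}) (Suc (T + u))"
        unfolding fires_at_def
      proof (intro conjI allI impI ballI)
        fix t q assume t: "t < Suc (T + u)" and "q \<in> p ` {r..s}"
        then obtain l where l: "r \<le> l" "l \<le> s" "q = p l" by auto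
        have quiet: "run A (p ` {r..s}) (t - Suc T) (p l) \<notin> firing A" if "T < t"
        proof -
          have "t - Suc T < u" using t that by simp
          moreover have "\<forall>t'<u. \<forall>q\<in>p ` {r..s}. run A (p ` {r..s}) t' q \<notin> firing A"
            using u unfolding fires_at_def by (rule conjunct1)
          ultimately show ?thesis using l by simp
        qed
        show "run A' (p ` {r..s}) t q \<notin> firing A'"
        proof -
          have no: "\<not> (\<bar>l\<bar> \<le> int T \<and> M \<subseteq> knowledge r s p T l)" using False l(1,2) by blast
          show ?thesis unfolding l(3) fire[OF p l(1,2)]
          proof (rule notI, elim disjE conjE)
            show False if "\<bar>l\<bar> \<le> int T" "M \<subseteq> knowledge r s p T l" using no that by blast
            show False if "T < t" "run A (p ` {r..s}) (t - Suc T) (p l) \<in> firing A" using quiet that by blast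
          qed
        qed
      next
        fix q assume "q \<in> p ` {r..s}"
        then obtain l where l: "r \<le> l" "l \<le> s" "q = p l" by auto
        have "run A (p ` {r..s}) u (p l) \<in> firing A" using u l unfolding fires_at_def by auto
        then show "run A' (p ` {r..s}) (Suc (T + u)) q \<in> firing A'"
          using fire[OF p l(1,2), of "Suc (T + u)"] l by simp
      qed
      then show ?thesis unfolding set by blast
    qed
  qed
  then have "is_solution A'" using wf' by (simp add: is_solution_def)
  moreover have "\<forall>r s p. g2path r s p \<longrightarrow>
      (\<forall>l. r \<le> l \<longrightarrow> l \<le> s \<longrightarrow> \<bar>l\<bar> \<le> int T \<and> M \<subseteq> knowledge r s p T l) \<longrightarrow> fires_at A' (p ` {r..s}) T"
    by (intro allI impI) (rule fires_T)
  ultimately show ?thesis by blast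
qed

section \<open>The upper bound\<close>

text \<open>Walking away from the general, each node of the segment is adjacent to the previous one,
  so in \<open>p'\<close> it is one of the two path neighbours of that node, and the other one is
  already taken. Only the first step on each side has to be given.\<close>

lemma g2path_align:
  assumes p: "g2path r s p" and p': "g2path r' s' p'" and ij: "r \<le> i" "i \<le> 0" "0 \<le> j" "j \<le> s"
    and sub: "\<And>m. i \<le> m \<Longrightarrow> m \<le> j \<Longrightarrow> p m \<in> p' ` {r'..s'}"
    and start: "0 < j \<Longrightarrow> 1 \<le> s' \<and> p' 1 = p 1" "i < 0 \<Longrightarrow> r' \<le> - 1 \<and> p' (- 1) = p (- 1)"
  shows "i \<le> m \<Longrightarrow> m \<le> j \<Longrightarrow> r' \<le> m \<and> m \<le> s' \<and> p' m = p m"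
proof -
  note D = g2pathD[OF p] and D' = g2pathD[OF p']
  \<comment> \<open>\<open>e\<close> is the direction of the walk, which treats both sides of the
    general at once.\<close>
  have step: "r' \<le> e * (m + 1) \<and> e * (m + 1) \<le> s' \<and> p' (e * (m + 1)) = p (e * (m + 1))"
    if e: "e = 1 \<or> e = - 1" and m: "1 \<le> m" "i \<le> e * (m + 1)" "e * (m + 1) \<le> j"
      and IH: "r' \<le> e * m" "e * m \<le> s'" "p' (e * m) = p (e * m)" "p' (e * (m - 1)) = p (e * (m - 1))"
    for e m
  proof -
    have range: "r \<le> e * n \<and> e * n \<le> s" if "n = m - 1 \<or> n = m \<or> n = m + 1" for n
      using e m ij that by auto
    obtain n where n: "r' \<le> n" "n \<le> s'" "p (e * (m + 1)) = p' n"
      using sub[OF m(2,3)] by auto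
    have "adj (p (e * m)) (p (e * (m + 1)))"
    proof (cases "e = 1")
      case True
      then show ?thesis using D(5)[of m] range[of m] range[of "m + 1"] by simp
    next
      case False
      then have "e * m = - m" "e * (m + 1) = - m - 1" using e by auto
      then show ?thesis using D(6)[of "- m"] range[of m] range[of "m + 1"] by simp
    qed
    then have "adj (p' (e * m)) (p' n)" using IH n by simp
    then have "n = e * m + 1 \<or> n = e * m - 1" using D'(7) IH n by blast
    then have "n = e * (m + 1) \<or> n = e * (m - 1)" using e by (auto simp: algebra_simps)
    moreover have "n \<noteq> e * (m - 1)"
    proof
      assume "n = e * (m - 1)"
      then have "p (e * (m + 1)) = p (e * (m - 1))" using n IH by simp
      then have "e * (m + 1) = e * (m - 1)" using D(4) range[of "m - 1"] range[of "m + 1"] by blast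
      then show False using e by auto
    qed
    ultimately show ?thesis using n by simp
  qed
  have main: "r' \<le> e * int n \<and> e * int n \<le> s' \<and> p' (e * int n) = p (e * int n)"
    if e: "e = 1 \<or> e = - 1" and "i \<le> e * int n" "e * int n \<le> j" for e n
    using that(2,3)
  proof (induction n rule: less_induct)
    case (less n)
    consider "n = 0" | "n = 1" | k where "n = Suc (Suc k)" by (metis One_nat_def not0_implies_Suc)
    then show ?case
    proof cases
      case 1
      then show ?thesis using D(3) D'(1-3) by simp
    next
      case 2
      then show ?thesis using e less.prems start D'(1,2) by auto
    next
      case 3
      have "r' \<le> e * int (Suc k) \<and> e * int (Suc k) \<le> s' \<and> p' (e * int (Suc k)) = p (e * int (Suc k))"
        by (rule less.IH) (use e 3 less.prems ij in auto)
      moreover have "p' (e * int k) = p (e * int k)"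
        using less.IH[of k] e 3 less.prems ij by auto
      ultimately show ?thesis
        using step[OF e, of "int (Suc k)"] less.prems 3 by (simp add: algebra_simps)
    qed
  qed
  assume m: "i \<le> m" "m \<le> j"
  show "r' \<le> m \<and> m \<le> s' \<and> p' m = p m"
  proof (cases "0 \<le> m")
    case True
    then show ?thesis using main[of 1 "nat m"] m by simp
  next
    case False
    then show ?thesis using main[of "- 1" "nat (- m)"] m by simp
  qed
qed

text \<open>The neighbours of the general in the segment are among \<open>p' 1\<close> and
  \<open>p' (- 1)\<close>, and they are distinct. So they agree with the indexing of
  \<open>p'\<close> or with that of its reversal.\<close>

lemma g2path_reorient:
  assumes p: "g2path r s p" and p': "g2path r' s' p'" and ij: "r \<le> i" "i \<le> 0" "0 \<le> j" "j \<le> s"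
    and sub: "\<And>m. i \<le> m \<Longrightarrow> m \<le> j \<Longrightarrow> p m \<in> p' ` {r'..s'}"
  shows "\<exists>r'' s'' p''. g2path r'' s'' p'' \<and> p'' ` {r''..s''} = p' ` {r'..s'} \<and>
    (\<forall>m. i \<le> m \<longrightarrow> m \<le> j \<longrightarrow> r'' \<le> m \<and> m \<le> s'' \<and> p'' m = p m)"
proof -
  note D = g2pathD[OF p] and D' = g2pathD[OF p']
  have near: "(1 \<le> s' \<and> p' 1 = p m) \<or> (r' \<le> - 1 \<and> p' (- 1) = p m)"
    if m: "m = 1 \<or> m = - 1" "i \<le> m" "m \<le> j" for m
  proof -
    obtain n where n: "r' \<le> n" "n \<le> s'" "p m = p' n" using sub[OF m(2,3)] by auto
    have "adj (p 0) (p m)" using m D(5)[of 0] D(6)[of 0] ij by auto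
    then have "adj (p' 0) (p' n)" using D(3) D'(3) n(3) by simp
    then have "n = 0 + 1 \<or> n = 0 - 1" using D'(7)[of 0 n] D'(1,2) n(1,2) by blast
    then show ?thesis using n by auto
  qed
  have ne: "p 1 \<noteq> p (- 1)" if "0 < j" "i < 0" using D(4)[of 1 "- 1"] that ij by auto
  consider (same) "0 < j \<longrightarrow> 1 \<le> s' \<and> p' 1 = p 1" "i < 0 \<longrightarrow> r' \<le> - 1 \<and> p' (- 1) = p (- 1)"
    | (opp) "0 < j \<longrightarrow> r' \<le> - 1 \<and> p' (- 1) = p 1" "i < 0 \<longrightarrow> 1 \<le> s' \<and> p' 1 = p (- 1)"
    using near[of 1] near[of "- 1"] ne ij by (cases "0 < j"; cases "i < 0") auto
  then show ?thesis
  proof cases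
    case same
    have "r' \<le> m \<and> m \<le> s' \<and> p' m = p m" if "i \<le> m" "m \<le> j" for m
      by (rule g2path_align[OF p p' ij sub _ _ that]) (use same in auto)
    then show ?thesis using p' by blast
  next
    case opp
    have "- s' \<le> m \<and> m \<le> - r' \<and> p' (- m) = p m" if "i \<le> m" "m \<le> j" for m
      by (rule g2path_align[OF p g2path_mirror[OF p'] ij _ _ _ that])
        (use opp sub image_uminus_interval[of p' s' r'] in auto)
    then show ?thesis
      by - (rule exI[of _ "- s'"], rule exI[of _ "- r'"], rule exI[of _ "\<lambda>l. p' (- l)"],
          intro conjI g2path_mirror[OF p'] image_uminus_interval, blast)
  qed
qed

lemma W_of_path:
  assumes p': "g2path r' s' p'" and ij: "i \<le> 0" "0 \<le> j" "r' \<le> i" "j \<le> s'"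
    and eq: "\<And>m. i \<le> m \<Longrightarrow> m \<le> j \<Longrightarrow> p' m = p m"
    and bc: "\<And>m. i \<le> m \<Longrightarrow> m \<le> j \<Longrightarrow> bc (p' ` {r'..s'}) (p m) = bc (p ` {r..s}) (p m)"
  shows "(map p' [r'..i - 1], map p' [j + 1..s']) \<in> W r s p i j"
proof -
  have "[r'..s'] = [r'..i - 1] @ [i..s']" using ij upto_split1[of r' i s'] by simp
  also have "[i..s'] = [i..j] @ [j + 1..s']" using ij upto_split2[of i j s'] by simp
  finally have "map p' [r'..i - 1] @ map p' [i..j] @ map p' [j + 1..s'] = map p' [r'..s']" by simp
  moreover have "map p' [i..j] = map p [i..j]" using eq by simp
  ultimately have xs: "map p' [r'..i - 1] @ map p [i..j] @ map p' [j + 1..s'] = map p' [r'..s']" by simp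
  show ?thesis
    unfolding W_def mem_Collect_eq prod.case xs image_map_upto using p' bc by (simp add: g2path_def)
qed

lemma firing_time_upper_bound:
  assumes p: "g2path r s p" and ij: "(i, j) \<in> idx r s"
    and T: "\<And>x0 x1. (x0, x1) \<in> W r s p i j \<Longrightarrow>
      - 2 * i + j + int (length x1) \<le> int T \<and> 2 * j - i + int (length x0) \<le> int T"
  shows "\<exists>A. is_solution A \<and> ft (p ` {r..s}) A = T"
proof -
  have ij': "r \<le> i" "i \<le> 0" "0 \<le> j" "j \<le> s" using ij by (auto simp: idx_def)
  let ?M = "(\<lambda>m. (p m, bc (p ` {r..s}) (p m))) ` {i..j}"
  have known: "\<bar>l\<bar> \<le> int T \<and> ?M \<subseteq> knowledge r' s' p' T l"
    if p': "g2path r' s' p'" and l: "r' \<le> l" "l \<le> s'"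
      and eq: "\<And>m. i \<le> m \<Longrightarrow> m \<le> j \<Longrightarrow> r' \<le> m \<and> m \<le> s' \<and> p' m = p m"
      and bc: "\<And>m. i \<le> m \<Longrightarrow> m \<le> j \<Longrightarrow> bc (p' ` {r'..s'}) (p m) = bc (p ` {r..s}) (p m)" for r' s' p' l
  proof -
    have ends: "r' \<le> i" "j \<le> s'" using eq[of i] eq[of j] ij' by auto
    have "(map p' [r'..i - 1], map p' [j + 1..s']) \<in> W r s p i j"
      using W_of_path[OF p' ij'(2,3) ends] eq bc by blast
    \<comment> \<open>Here \<open>length x0 = i - r'\<close> and
      \<open>length x1 = s' - j\<close>.\<close>
    then have TT: "- 2 * i + s' \<le> int T" "2 * j - r' \<le> int T"
      using T ends by force+
    have "?M \<subseteq> knowledge r' s' p' T l"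
    proof
      fix z assume "z \<in> ?M"
      then obtain m where m: "i \<le> m" "m \<le> j" "z = (p' m, bc (p' ` {r'..s'}) (p' m))"
        using eq bc by auto
      \<comment> \<open>The extreme cases are m = j with l = r' and m = i with l = s'.\<close>
      have "\<bar>m\<bar> + \<bar>m - l\<bar> \<le> int T" using TT m l ij' ends by linarith
      then show "z \<in> knowledge r' s' p' T l"
        unfolding knowledge_def m(3) using eq[OF m(1,2)] by (intro image_eqI[of _ _ m]) auto
    qed
    moreover have "\<bar>l\<bar> \<le> int T" using TT l ij' by linarith
    ultimately show ?thesis by simp
  qed
  obtain A where A: "is_solution A" using ex_solution by blast
  have "\<exists>A'. is_solution A' \<and> (\<forall>r s p. g2path r s p \<longrightarrow>
    (\<forall>l. r \<le> l \<longrightarrow> l \<le> s \<longrightarrow> \<bar>l\<bar> \<le> int T \<and> ?M \<subseteq> knowledge r s p T l) \<longrightarrow> fires_at A' (p ` {r..s}) T)"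
  proof (rule ex_delayed_solution[OF A])
    fix r' s' p' l
    assume p': "g2path r' s' p'" and "?M \<subseteq> knowledge r' s' p' T l"
    have M: "p m \<in> p' ` {r'..s'} \<and> bc (p' ` {r'..s'}) (p m) = bc (p ` {r..s}) (p m)"
      if "i \<le> m" "m \<le> j" for m
    proof -
      have "(p m, bc (p ` {r..s}) (p m)) \<in> knowledge r' s' p' T l"
        using \<open>?M \<subseteq> _\<close> that by auto
      then obtain n where "r' \<le> n" "n \<le> s'" "p m = p' n"
        "bc (p ` {r..s}) (p m) = bc (p' ` {r'..s'}) (p' n)"
        unfolding knowledge_def by auto
      then show ?thesis by simp
    qed
    have sub: "p m \<in> p' ` {r'..s'}" if "i \<le> m" "m \<le> j" for m using M[OF that] by (rule conjunct1)
    have "\<exists>r'' s'' p''. g2path r'' s'' p'' \<and> p'' ` {r''..s''} = p' ` {r'..s'} \<and>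
        (\<forall>m. i \<le> m \<longrightarrow> m \<le> j \<longrightarrow> r'' \<le> m \<and> m \<le> s'' \<and> p'' m = p m)"
      by (rule g2path_reorient[OF p p' ij']) (rule sub)
    then obtain r'' s'' p'' where p'': "g2path r'' s'' p''" "p'' ` {r''..s''} = p' ` {r'..s'}"
      "\<forall>m. i \<le> m \<longrightarrow> m \<le> j \<longrightarrow> r'' \<le> m \<and> m \<le> s'' \<and> p'' m = p m"
      by (elim exE conjE)
    have bc: "bc (p'' ` {r''..s''}) (p m) = bc (p ` {r..s}) (p m)" if "i \<le> m" "m \<le> j" for m
      unfolding p''(2) using M[OF that] by (rule conjunct2)
    have "\<forall>l. r'' \<le> l \<longrightarrow> l \<le> s'' \<longrightarrow> \<bar>l\<bar> \<le> int T \<and> ?M \<subseteq> knowledge r'' s'' p'' T l"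
      by (intro allI impI, rule known[OF p''(1) _ _ p''(3)[rule_format] bc])
    then show "\<exists>r'' s'' p''. g2path r'' s'' p'' \<and> p'' ` {r''..s''} = p' ` {r'..s'} \<and>
        (\<forall>l. r'' \<le> l \<longrightarrow> l \<le> s'' \<longrightarrow> \<bar>l\<bar> \<le> int T \<and> ?M \<subseteq> knowledge r'' s'' p'' T l)"
      using p''(1,2) by blast
  qed
  then obtain A' where A': "is_solution A'"
    and fires: "\<forall>r s p. g2path r s p \<longrightarrow>
      (\<forall>l. r \<le> l \<longrightarrow> l \<le> s \<longrightarrow> \<bar>l\<bar> \<le> int T \<and> ?M \<subseteq> knowledge r s p T l) \<longrightarrow> fires_at A' (p ` {r..s}) T"
    by (elim exE conjE)
  have "\<forall>l. r \<le> l \<longrightarrow> l \<le> s \<longrightarrow> \<bar>l\<bar> \<le> int T \<and> ?M \<subseteq> knowledge r s p T l"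
    by (intro allI impI, rule known[OF p]) (use ij' in auto)
  then have "fires_at A' (p ` {r..s}) T"
    by (rule fires[THEN spec, THEN spec, THEN spec, THEN mp, THEN mp, OF p])
  then have "ft (p ` {r..s}) A' = T" by (rule ft_eq) (use g2pathD(1,2)[OF p] in auto)
  then show ?thesis using A' by blast
qed

theorem theorem7:
  fixes r s :: int and p :: "int \<Rightarrow> int \<times> int"
  assumes "g2path r s p" and "CNI r s p"
  shows "enat (mft (p ` {r..s})) =
    Min ((\<lambda>(i, j). max (enat (nat (- 2 * i + j)) + gW r s p i j)
                        (enat (nat (2 * j - i)) + fW r s p i j)) ` idx r s)"
proof -
  let ?C = "p ` {r..s}"
  define v where "v = (\<lambda>(i, j). max (enat (nat (- 2 * i + j)) + gW r s p i j)
                        (enat (nat (2 * j - i)) + fW r s p i j))"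
  have idx: "idx r s = {r..0} \<times> {0..s}" by (auto simp: idx_def)
  have fin: "finite (v ` idx r s)" unfolding idx by simp
  have rs: "(r, s) \<in> idx r s" using g2pathD(1,2)[OF assms(1)] by (simp add: idx_def)
  \<comment> \<open>The term at \<open>(r, s)\<close> is finite, so the minimum is a natural
    number.\<close>
  have "fW r s p r s = enat 0" "gW r s p r s = enat 0"
    unfolding fW_def gW_def U_def V_def W_full[OF assms(1)] by simp_all
  then have "v (r, s) \<noteq> \<infinity>" by (simp add: v_def)
  moreover have "Min (v ` idx r s) \<le> v (r, s)" using fin rs by simp
  ultimately obtain T where T: "Min (v ` idx r s) = enat T" by (cases "Min (v ` idx r s)") auto
  have "Min (v ` idx r s) \<in> v ` idx r s" using fin rs by (intro Min_in) auto
  then obtain i j where ij: "(i, j) \<in> idx r s" "v (i, j) = enat T" using T by auto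
  have attained: "\<exists>A. is_solution A \<and> ft ?C A = T"
  proof (rule firing_time_upper_bound[OF assms(1) ij(1)])
    fix x0 x1 assume x: "(x0, x1) \<in> W r s p i j"
    have len: "enat (length x0) \<le> fW r s p i j" "enat (length x1) \<le> gW r s p i j"
      unfolding fW_def gW_def U_def V_def using x by (force intro: Sup_upper)+
    have "max (enat (nat (- 2 * i + j)) + gW r s p i j) (enat (nat (2 * j - i)) + fW r s p i j) = enat T"
      using ij(2) by (simp add: v_def)
    then have bound: "enat (nat (- 2 * i + j)) + gW r s p i j \<le> enat T"
      "enat (nat (2 * j - i)) + fW r s p i j \<le> enat T"
      by (metis max.cobounded1, metis max.cobounded2)
    have "enat (nat (2 * j - i)) + enat (length x0) \<le> enat T"
      by (rule order_trans[OF add_left_mono[OF len(1)] bound(2)])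
    moreover have "enat (nat (- 2 * i + j)) + enat (length x1) \<le> enat T"
      by (rule order_trans[OF add_left_mono[OF len(2)] bound(1)])
    ultimately show "- 2 * i + j + int (length x1) \<le> int T \<and> 2 * j - i + int (length x0) \<le> int T"
      using ij(1) by (auto simp: idx_def)
  qed
  have minimal: "T \<le> n" if n: "\<exists>A. is_solution A \<and> ft ?C A = n" for n
  proof -
    obtain A where A: "is_solution A" "ft ?C A = n" using n by blast
    have "lconfig (map p [r..s])" using assms(1) by (simp add: g2path_def)
    then have "\<exists>t. fires_at A (set (map p [r..s])) t" using A(1) unfolding is_solution_def by blast
    then obtain t where t: "fires_at A ?C t" unfolding image_map_upto ..
    then have "ft ?C A = t" by (rule ft_eq) (use g2pathD(1,2)[OF assms(1)] in auto)
    then have "fires_at A ?C n" using A(2) t by simp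
    from firing_time_lower_bound[OF A(1) assms(1,2) this]
    obtain z where z: "z \<in> idx r s" and "case z of (i, j) \<Rightarrow>
        max (enat (nat (- 2 * i + j)) + gW r s p i j) (enat (nat (2 * j - i)) + fW r s p i j) \<le> enat n"
      by (rule bexE)
    then have vz: "v z \<le> enat n" by (cases z) (simp add: v_def)
    have "Min (v ` idx r s) \<le> enat n"
      by (rule order_trans[OF Min_le[OF fin imageI[OF z]] vz])
    then show ?thesis using T by simp
  qed
  have "mft ?C = T" unfolding mft_def by (rule Least_equality, rule attained, rule minimal)
  then show ?thesis using T[unfolded v_def] by (simp only:)
qed

end
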